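(* (a) For each positive integer $n$, each regular $n$-ary tree is reversible. In particular, for each ordinal $\alpha>0$ the complete $n$-ary tree ${}^{<\alpha}n$ of height $\alpha$ is reversible. (b) For each integer $n\geq 2$ there is a reversible $n$-ary Aronszajn tree. (c) If there exists a Suslin tree (respectively, a Kurepa tree), then for each integer $n\geq 2$ there is a reversible $n$-ary Suslin tree (respectively, a reversible $n$-ary Kurepa tree).
   Context: A tree is a strict partial order $\langle T,<\rangle$ such that for each $t\in T$ the set $(\cdot,t):=\{s\in T:s<t\}$ is well-ordered or empty. The height of $t$ is the order type of $(\cdot,t)$; the height of $T$ is the least ordinal $\alpha$ such that $T$ has no elements of height $\alpha$. The nodes of $T$ are the equivalence classes of the relation $s\sim t \Leftrightarrow (\cdot,s)=(\cdot,t)$; all elements of a node have the same height, called the height of the node. A tree is $\lambda$-ary (for a cardinal $\lambda>0$) iff $|N|=\lambda$ for each node $N$ of successor height (equivalently, each non-maximal $t\in T$ has exactly $\lambda$ immediate successors). A tree is regular iff it has a root (least element) and $|N|=1$ for each node $N$ of limit height. ${}^{<\alpha}\lambda=\bigcup_{\beta<\alpha}{}^{\beta}\lambda$ is the tree of all sequences in $\lambda$ of length $<\alpha$, ordered by proper extension. A tree is reversible iff every condensation of $T$, i.e. every bijection $f:T\to T$ such that $x<y$ implies $f(x)<f(y)$, is an automorphism of $T$. Aronszajn, Suslin and Kurepa trees are understood in the usual sense (trees of height $\omega_1$). *)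

theory Defs
  imports Main "HOL-Library.Countable_Set"
begin

unbundle cardinal_syntax

text \<open>
  Ordinals are well-orders \<open>r\<close> (in the reflexive convention of \<^const>\<open>Well_order\<close>), identified up
  to \<open>=o\<close> and compared by \<open>\<le>o\<close>.
\<close>

definition succ_ordinal :: "'a rel \<Rightarrow> bool" where
  "succ_ordinal r \<longleftrightarrow> Well_order r \<and> (\<exists>m\<in>Field r. \<forall>x\<in>Field r. (x, m) \<in> r)"

definition limit_ordinal :: "'a rel \<Rightarrow> bool" where
  "limit_ordinal r \<longleftrightarrow> Well_order r \<and> Field r \<noteq> {} \<and> \<not> succ_ordinal r"

abbreviation omega1 :: "nat set rel" where
  "omega1 \<equiv> cardSuc natLeq"

abbreviation omega2 :: "nat set set rel" where
  "omega2 \<equiv> cardSuc omega1"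

text \<open>
  A strict order is given by a carrier \<open>T\<close> and a predicate \<open>lt\<close>, of which only the restriction to
  \<open>T\<close> matters.
\<close>

definition preds :: "'a set \<Rightarrow> ('a \<Rightarrow> 'a \<Rightarrow> bool) \<Rightarrow> 'a \<Rightarrow> 'a set" where
  "preds T lt t = {s\<in>T. lt s t}"

text \<open>
  The reflexive order on the predecessors of \<open>t\<close>. In a tree it is a well-order, so it represents the
  order type of the set of predecessors.
\<close>

definition height_at :: "'a set \<Rightarrow> ('a \<Rightarrow> 'a \<Rightarrow> bool) \<Rightarrow> 'a \<Rightarrow> 'a rel" where
  "height_at T lt t = {(x, y). x \<in> preds T lt t \<and> y \<in> preds T lt t \<and> (x = y \<or> lt x y)}"

definition is_tree :: "'a set \<Rightarrow> ('a \<Rightarrow> 'a \<Rightarrow> bool) \<Rightarrow> bool" where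
  "is_tree T lt \<longleftrightarrow> irreflp_on T lt \<and> transp_on T lt \<and>
     (\<forall>t\<in>T. well_order_on (preds T lt t) (height_at T lt t))"

text \<open>
  The least ordinal that is not the height of an element. It suffices that \<open>\<beta>\<close> ranges over the
  well-orders on the type of \<open>\<alpha>\<close>, since every ordinal below \<open>\<alpha>\<close> is represented there.
\<close>

definition has_height :: "'a set \<Rightarrow> ('a \<Rightarrow> 'a \<Rightarrow> bool) \<Rightarrow> 'b rel \<Rightarrow> bool" where
  "has_height T lt \<alpha> \<longleftrightarrow> Well_order \<alpha> \<and> \<not> (\<exists>t\<in>T. height_at T lt t =o \<alpha>) \<and>
     (\<forall>\<beta> :: 'b rel. Well_order \<beta> \<and> \<not> (\<exists>t\<in>T. height_at T lt t =o \<beta>) \<longrightarrow> \<alpha> \<le>o \<beta>)"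

definition nodes :: "'a set \<Rightarrow> ('a \<Rightarrow> 'a \<Rightarrow> bool) \<Rightarrow> 'a set set" where
  "nodes T lt = T // {(s, t). s \<in> T \<and> t \<in> T \<and> preds T lt s = preds T lt t}"

text \<open>
  All elements of a node have the same height, which is the height of the node. For \<open>n > 0\<close> the
  condition \<open>card N = n\<close> includes the finiteness of \<open>N\<close>.
\<close>

definition nary_tree :: "nat \<Rightarrow> 'a set \<Rightarrow> ('a \<Rightarrow> 'a \<Rightarrow> bool) \<Rightarrow> bool" where
  "nary_tree n T lt \<longleftrightarrow> is_tree T lt \<and>
     (\<forall>N\<in>nodes T lt. (\<forall>t\<in>N. succ_ordinal (height_at T lt t)) \<longrightarrow> card N = n)"

definition regular_tree :: "'a set \<Rightarrow> ('a \<Rightarrow> 'a \<Rightarrow> bool) \<Rightarrow> bool" where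
  "regular_tree T lt \<longleftrightarrow> is_tree T lt \<and> (\<exists>r\<in>T. \<forall>t\<in>T. t \<noteq> r \<longrightarrow> lt r t) \<and>
     (\<forall>N\<in>nodes T lt. (\<forall>t\<in>N. limit_ordinal (height_at T lt t)) \<longrightarrow> card N = 1)"

definition condensation :: "'a set \<Rightarrow> ('a \<Rightarrow> 'a \<Rightarrow> bool) \<Rightarrow> ('a \<Rightarrow> 'a) \<Rightarrow> bool" where
  "condensation T lt f \<longleftrightarrow> bij_betw f T T \<and> (\<forall>x\<in>T. \<forall>y\<in>T. lt x y \<longrightarrow> lt (f x) (f y))"

definition automorphism :: "'a set \<Rightarrow> ('a \<Rightarrow> 'a \<Rightarrow> bool) \<Rightarrow> ('a \<Rightarrow> 'a) \<Rightarrow> bool" where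
  "automorphism T lt f \<longleftrightarrow> bij_betw f T T \<and> (\<forall>x\<in>T. \<forall>y\<in>T. lt x y \<longleftrightarrow> lt (f x) (f y))"

definition reversible :: "'a set \<Rightarrow> ('a \<Rightarrow> 'a \<Rightarrow> bool) \<Rightarrow> bool" where
  "reversible T lt \<longleftrightarrow> (\<forall>f. condensation T lt f \<longrightarrow> automorphism T lt f)"

text \<open>
  For a well-order \<open>\<alpha>\<close>, the ordinals below \<open>\<alpha>\<close> are the proper initial segments \<open>underS \<alpha> \<beta>\<close> with
  \<open>\<beta> \<in> Field \<alpha>\<close>. A sequence of length \<open>\<beta>\<close> is a partial function with that domain.
\<close>

definition complete_tree :: "'b rel \<Rightarrow> nat \<Rightarrow> ('b \<Rightarrow> nat option) set" where
  "complete_tree \<alpha> n = {s. \<exists>\<beta>\<in>Field \<alpha>. dom s = underS \<alpha> \<beta> \<and> ran s \<subseteq> {..<n}}"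

definition proper_ext :: "('b \<Rightarrow> nat option) \<Rightarrow> ('b \<Rightarrow> nat option) \<Rightarrow> bool" where
  "proper_ext s t \<longleftrightarrow> s \<subseteq>\<^sub>m t \<and> s \<noteq> t"

definition level :: "'a set \<Rightarrow> ('a \<Rightarrow> 'a \<Rightarrow> bool) \<Rightarrow> 'b rel \<Rightarrow> 'a set" where
  "level T lt \<alpha> = {t\<in>T. height_at T lt t =o \<alpha>}"

definition antichain :: "'a set \<Rightarrow> ('a \<Rightarrow> 'a \<Rightarrow> bool) \<Rightarrow> 'a set \<Rightarrow> bool" where
  "antichain T lt A \<longleftrightarrow> A \<subseteq> T \<and> (\<forall>x\<in>A. \<forall>y\<in>A. x \<noteq> y \<longrightarrow> \<not> lt x y)"

text \<open>A branch is a maximal chain.\<close>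

abbreviation branch :: "'a set \<Rightarrow> ('a \<Rightarrow> 'a \<Rightarrow> bool) \<Rightarrow> 'a set \<Rightarrow> bool" where
  "branch T lt \<equiv> pred_on.maxchain T lt"

text \<open>
  In a tree of height \<open>omega1\<close> every level is the level of some \<open>\<alpha>\<close> on the type of \<open>omega1\<close>.
\<close>

definition omega1_tree :: "'a set \<Rightarrow> ('a \<Rightarrow> 'a \<Rightarrow> bool) \<Rightarrow> bool" where
  "omega1_tree T lt \<longleftrightarrow> is_tree T lt \<and> has_height T lt omega1 \<and>
     (\<forall>\<alpha> :: nat set rel. countable (level T lt \<alpha>))"

definition aronszajn_tree :: "'a set \<Rightarrow> ('a \<Rightarrow> 'a \<Rightarrow> bool) \<Rightarrow> bool" where
  "aronszajn_tree T lt \<longleftrightarrow> omega1_tree T lt \<and> (\<forall>B. branch T lt B \<longrightarrow> countable B)"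

definition suslin_tree :: "'a set \<Rightarrow> ('a \<Rightarrow> 'a \<Rightarrow> bool) \<Rightarrow> bool" where
  "suslin_tree T lt \<longleftrightarrow> is_tree T lt \<and> has_height T lt omega1 \<and>
     (\<forall>B. branch T lt B \<longrightarrow> countable B) \<and> (\<forall>A. antichain T lt A \<longrightarrow> countable A)"

definition kurepa_tree :: "'a set \<Rightarrow> ('a \<Rightarrow> 'a \<Rightarrow> bool) \<Rightarrow> bool" where
  "kurepa_tree T lt \<longleftrightarrow> omega1_tree T lt \<and>
     omega2 \<le>o card_of {B. branch T lt B \<and> uncountable B}"

end

theory Submission
  imports Defs "HOL-Library.Product_Lexorder" "HOL-Library.Countable_Set_Type"
begin

text \<open>
  Reversibility of a regular \<open>n\<close>-ary tree is a finite counting argument, one node at a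
  time. A condensation \<open>f\<close> maps the predecessors of \<open>x\<close> into the
  predecessors of \<open>f x\<close>. If an element \<open>y\<close> below \<open>f x\<close> is
  missed and \<open>y\<close> is chosen first, then the node of \<open>y\<close> lies over the image
  of the predecessors of \<open>x\<close>. By induction the preimages of the elements of that node
  all lie in the node of \<open>x\<close>. Both nodes are finite and have the same size
  (\<open>n\<close> or \<open>1\<close>), so every element of the node of \<open>x\<close> is used
  up, including \<open>x\<close> itself, which puts \<open>f x\<close> into the node of its own
  predecessor \<open>y\<close>. Hence \<open>f\<close> maps predecessors onto predecessors and is an
  automorphism (\<open>regular_nary_reversible\<close>).

  It remains to find regular \<open>n\<close>-ary trees. A set of sequences that is closed under
  initial segments is regular, since a sequence of limit length is determined by its initial
  segments. It is \<open>n\<close>-ary as soon as the last entry of any of its sequences may be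
  changed freely (locale \<open>sequence_tree\<close>). The complete tree is of this kind. For the
  other trees the positions of the sequences form the lexicographic product of
  \<open>\<omega>\<^sub>1\<close> and \<open>\<omega>\<close>, so that each countable ordinal has a
  block of \<open>\<omega>\<close> positions in which a natural number can be marked.

  An Aronszajn tree consists of all finite modifications of the graphs of a coherent sequence of
  finite-to-one functions \<open>coh a\<close> on the countable ordinals
  (\<open>coh_tree_aronszajn\<close>).

  An arbitrary tree of height \<open>\<omega>\<^sub>1\<close> with countable levels is coded by
  0-1-sequences: number each level injectively and write the numbers of the elements of a downset
  \<open>{x. x \<le> y}\<close> into the blocks given by their ranks (locale
  \<open>ranked_tree\<close>). If a Kurepa tree is coded, then the codes together with all their
  one-step extensions form a regular \<open>n\<close>-ary Kurepa tree, since the uncountable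
  branches are coded injectively (\<open>nary_kurepa_tree\<close>).

  For a Suslin tree such added leaves may form an uncountable antichain. Here one first prunes the
  tree so that every element has incomparable extensions. In the binary tree of codes every
  \<open>s\<close> then has a maximal antichain \<open>frame s\<close> of exactly \<open>n\<close>
  elements above it. Closing the root under these antichains and under limits gives a subset
  \<open>frame_tree\<close> that is regular and \<open>n\<close>-ary, and maximality of the
  antichains makes it cofinal, hence uncountable. As a suborder of the codes it has neither
  uncountable chains nor uncountable antichains (\<open>nary_suslin_tree\<close>).
\<close>

section \<open>Trees and their nodes\<close>

lemma mem_preds [simp]: "s \<in> preds T lt t \<longleftrightarrow> s \<in> T \<and> lt s t"
  by (simp add: preds_def)

text \<open>
  Well-foundedness of the whole order replaces the well-orders on the single sets of predecessors: a
  minimal element of \<open>Q\<close> is found among the predecessors of any element of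
  \<open>Q\<close>. In this form the property passes to subsets and to isomorphic copies at once.
\<close>
lemma is_tree_iff:
  "is_tree T lt \<longleftrightarrow> irreflp_on T lt \<and> transp_on T lt \<and>
     (\<forall>t\<in>T. \<forall>x\<in>preds T lt t. \<forall>y\<in>preds T lt t. x = y \<or> lt x y \<or> lt y x) \<and>
     wf {(x, y). x \<in> T \<and> y \<in> T \<and> lt x y}" (is "?L \<longleftrightarrow> ?R")
proof
  assume L: ?L
  then have ir: "irreflp_on T lt" and tr: "transp_on T lt"
    and wo: "\<And>t. t \<in> T \<Longrightarrow> well_order_on (preds T lt t) (height_at T lt t)"
    by (auto simp: is_tree_def)
  have "x = y \<or> lt x y \<or> lt y x" if "t \<in> T" "x \<in> preds T lt t" "y \<in> preds T lt t" for t x y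
    using wo[OF that(1)] that
    unfolding well_order_on_def linear_order_on_def total_on_def height_at_def by blast
  moreover have "wf {(x, y). x \<in> T \<and> y \<in> T \<and> lt x y}" (is "wf ?r")
  proof (rule wfI_min)
    fix x Q assume x: "x \<in> (Q :: 'a set)"
    show "\<exists>z\<in>Q. \<forall>y. (y, z) \<in> ?r \<longrightarrow> y \<notin> Q"
    proof (cases "x \<in> T \<and> (\<exists>y\<in>preds T lt x. y \<in> Q)")
      case False
      then show ?thesis using x by (intro bexI[of _ x]) auto
    next
      case True
      then have "wf (height_at T lt x - Id)" using wo unfolding well_order_on_def by blast
      moreover have "preds T lt x \<inter> Q \<noteq> {}" using True by auto
      ultimately obtain z where z: "z \<in> preds T lt x \<inter> Q"
        "\<And>y. (y, z) \<in> height_at T lt x - Id \<Longrightarrow> y \<notin> preds T lt x \<inter> Q"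
        by (meson wfE_min ex_in_conv)
      have "y \<notin> Q" if "(y, z) \<in> ?r" for y
      proof
        assume "y \<in> Q"
        have yz: "y \<in> T" "z \<in> T" "lt y z" using that by auto
        then have "lt y x" "y \<noteq> z" using z(1) True tr ir
          by (auto dest: transp_onD irreflp_onD)
        then have "(y, z) \<in> height_at T lt x - Id" using yz z(1) by (auto simp: height_at_def)
        then show False using z(2) \<open>y \<in> Q\<close> yz \<open>lt y x\<close> by auto
      qed
      then show ?thesis using z(1) by blast
    qed
  qed
  ultimately show ?R using ir tr by blast
next
  assume R: ?R
  then have ir: "irreflp_on T lt" and tr: "transp_on T lt" by auto
  have "well_order_on (preds T lt t) (height_at T lt t)" if t: "t \<in> T" for t
    unfolding well_order_on_def linear_order_on_def partial_order_on_def preorder_on_def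
  proof (intro conjI)
    show "trans (height_at T lt t)" using tr
      by (auto simp: height_at_def trans_def dest: transp_onD)
    show "antisym (height_at T lt t)" using tr ir
      by (auto simp: height_at_def antisym_def dest: transp_onD irreflp_onD)
    show "total_on (preds T lt t) (height_at T lt t)"
      using R t unfolding height_at_def total_on_def by blast
    show "wf (height_at T lt t - Id)"
      by (rule wf_subset[of "{(x, y). x \<in> T \<and> y \<in> T \<and> lt x y}"]) (use R in \<open>auto simp: height_at_def\<close>)
  qed (auto simp: height_at_def refl_on_def)
  then show ?L using ir tr by (auto simp: is_tree_def)
qed

lemma tree_irrefl: "is_tree T lt \<Longrightarrow> x \<in> T \<Longrightarrow> \<not> lt x x"
  by (auto simp: is_tree_def dest: irreflp_onD)

lemma tree_trans: "is_tree T lt \<Longrightarrow> lt x y \<Longrightarrow> lt y z \<Longrightarrow> x \<in> T \<Longrightarrow> y \<in> T \<Longrightarrow> z \<in> T \<Longrightarrow> lt x z"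
  by (auto simp: is_tree_def dest: transp_onD)

lemma tree_linear:
  "is_tree T lt \<Longrightarrow> lt x t \<Longrightarrow> lt y t \<Longrightarrow> x \<in> T \<Longrightarrow> y \<in> T \<Longrightarrow> t \<in> T \<Longrightarrow> x = y \<or> lt x y \<or> lt y x"
  unfolding is_tree_iff by fastforce

lemma tree_induct [consumes 2, case_names less]:
  assumes "is_tree T lt" "t \<in> T"
    and step: "\<And>t. t \<in> T \<Longrightarrow> (\<And>s. s \<in> T \<Longrightarrow> lt s t \<Longrightarrow> P s) \<Longrightarrow> P t"
  shows "P t"
proof -
  have "wf {(x, y). x \<in> T \<and> y \<in> T \<and> lt x y}" using assms(1) by (simp add: is_tree_iff)
  then show ?thesis using assms(2)
    by (induction t rule: wf_induct_rule) (use step in blast)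
qed

lemma tree_minimal:
  assumes "is_tree T lt" "A \<subseteq> T" "A \<noteq> {}"
  obtains m where "m \<in> A" "\<And>y. y \<in> A \<Longrightarrow> \<not> lt y m"
proof -
  have "wf {(x, y). x \<in> T \<and> y \<in> T \<and> lt x y}" using assms(1) by (simp add: is_tree_iff)
  then obtain m where "m \<in> A" "\<And>y. (y, m) \<in> {(x, y). x \<in> T \<and> y \<in> T \<and> lt x y} \<Longrightarrow> y \<notin> A"
    using assms(3) by (meson wfE_min ex_in_conv)
  then show thesis using that assms(2) by blast
qed

lemma is_tree_subset:
  assumes "is_tree T lt" "S \<subseteq> T" shows "is_tree S lt"
proof -
  have "wf {(x, y). x \<in> S \<and> y \<in> S \<and> lt x y}"
    by (rule wf_subset[of "{(x, y). x \<in> T \<and> y \<in> T \<and> lt x y}"]) (use assms in \<open>auto simp: is_tree_iff\<close>)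
  moreover have "irreflp_on S lt" "transp_on S lt"
    using assms by (auto simp: is_tree_def intro: irreflp_on_subset transp_on_subset)
  moreover have "x = y \<or> lt x y \<or> lt y x" if "t \<in> S" "x \<in> preds S lt t" "y \<in> preds S lt t" for t x y
    using tree_linear[OF assms(1), of x t y] that assms(2) by auto
  ultimately show ?thesis unfolding is_tree_iff by blast
qed

definition node :: "'a set \<Rightarrow> ('a \<Rightarrow> 'a \<Rightarrow> bool) \<Rightarrow> 'a \<Rightarrow> 'a set" where
  "node T lt t = {s\<in>T. preds T lt s = preds T lt t}"

definition has_max :: "('a \<Rightarrow> 'a \<Rightarrow> bool) \<Rightarrow> 'a set \<Rightarrow> bool" where
  "has_max lt A \<longleftrightarrow> (\<exists>m\<in>A. \<forall>x\<in>A. x = m \<or> lt x m)"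

lemma nodes_eq: "nodes T lt = node T lt ` T"
  by (auto simp: nodes_def quotient_def node_def)

lemma Field_height_at [simp]: "Field (height_at T lt t) = preds T lt t"
  by (auto simp: height_at_def Field_def)

lemma Well_order_height_at: "is_tree T lt \<Longrightarrow> t \<in> T \<Longrightarrow> Well_order (height_at T lt t)"
  by (simp add: is_tree_def)

lemma succ_height_at:
  "is_tree T lt \<Longrightarrow> t \<in> T \<Longrightarrow> succ_ordinal (height_at T lt t) \<longleftrightarrow> has_max lt (preds T lt t)"
  using Well_order_height_at[of T lt t]
  unfolding succ_ordinal_def has_max_def Field_height_at by (auto simp: height_at_def)

lemma limit_height_at:
  "is_tree T lt \<Longrightarrow> t \<in> T \<Longrightarrow>
    limit_ordinal (height_at T lt t) \<longleftrightarrow> preds T lt t \<noteq> {} \<and> \<not> has_max lt (preds T lt t)"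
  using Well_order_height_at[of T lt t] succ_height_at[of T lt t]
  unfolding limit_ordinal_def Field_height_at by simp

lemma self_in_node: "t \<in> T \<Longrightarrow> t \<in> node T lt t"
  by (simp add: node_def)

text \<open>
  A height is a successor exactly when the predecessors have a maximum, so ordinals disappear from
  the definition.
\<close>
lemma nary_tree_iff:
  "nary_tree n T lt \<longleftrightarrow> is_tree T lt \<and>
     (\<forall>t\<in>T. has_max lt (preds T lt t) \<longrightarrow> card (node T lt t) = n)"
proof (cases "is_tree T lt")
  case True
  have "(\<forall>s\<in>node T lt t. succ_ordinal (height_at T lt s)) \<longleftrightarrow> has_max lt (preds T lt t)"
    if "t \<in> T" for t
    using True succ_height_at[of T lt] self_in_node[OF that] by (auto simp: node_def)
  then show ?thesis by (auto simp: nary_tree_def nodes_eq)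
qed (simp add: nary_tree_def)

lemma regular_tree_iff:
  "regular_tree T lt \<longleftrightarrow> is_tree T lt \<and> (\<exists>r\<in>T. \<forall>t\<in>T. t \<noteq> r \<longrightarrow> lt r t) \<and>
     (\<forall>t\<in>T. preds T lt t \<noteq> {} \<and> \<not> has_max lt (preds T lt t) \<longrightarrow> node T lt t = {t})"
proof (cases "is_tree T lt")
  case True
  have "(\<forall>s\<in>node T lt t. limit_ordinal (height_at T lt s)) \<longleftrightarrow>
      preds T lt t \<noteq> {} \<and> \<not> has_max lt (preds T lt t)" if "t \<in> T" for t
    using True limit_height_at[of T lt] self_in_node[OF that] by (auto simp: node_def)
  moreover have "card (node T lt t) = 1 \<longleftrightarrow> node T lt t = {t}" if "t \<in> T" for t
    using self_in_node[OF that, of lt] by (auto simp: card_1_singleton_iff)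
  ultimately show ?thesis by (auto simp: regular_tree_def nodes_eq)
qed (simp add: regular_tree_def)

text \<open>
  The form in which regularity enters the counting argument: the cardinality of a node depends only
  on whether its predecessors have a maximum. The root covers the case without predecessors.
\<close>
lemma regular_nary_node_card:
  assumes "regular_tree T lt" "nary_tree n T lt" "t \<in> T"
  shows "card (node T lt t) = (if has_max lt (preds T lt t) then n else 1)"
proof -
  have tree: "is_tree T lt" using assms by (simp add: nary_tree_iff)
  obtain r where r: "r \<in> T" "\<And>t. t \<in> T \<Longrightarrow> t \<noteq> r \<Longrightarrow> lt r t"
    using assms(1) by (auto simp: regular_tree_iff)
  have "node T lt t = {t}" if "preds T lt t = {}"
  proof -
    have "s = r" if "s \<in> T" "preds T lt s = {}" for s
      using that r by (metis empty_iff mem_preds)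
    from this[of t] this that assms(3) show ?thesis
      by (intro equalityI subsetI) (metis (mono_tags, lifting) insertI1 mem_Collect_eq node_def,
          simp add: self_in_node)
  qed
  then show ?thesis using assms by (auto simp: nary_tree_iff regular_tree_iff)
qed

section \<open>Condensations of regular trees with finite nodes\<close>

text \<open>
  The claim \<open>f ` preds x = preds (f x)\<close> is proved for all elements of a node at once,
  because the induction step applies it to elements \<open>v\<close> that are known only through
  \<open>preds v \<subset> preds x\<close>, and such a \<open>v\<close> is a sibling of an element
  below \<open>x\<close>, not necessarily itself an element below \<open>x\<close>.
\<close>
theorem regular_nary_reversible:
  assumes reg: "regular_tree T lt" and nary: "nary_tree n T lt" and n: "n \<ge> 1"
  shows "reversible T lt"
  unfolding reversible_def
proof (intro allI impI)
  fix f assume "condensation T lt f"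
  then have bij: "bij_betw f T T" and mono: "\<And>x y. x \<in> T \<Longrightarrow> y \<in> T \<Longrightarrow> lt x y \<Longrightarrow> lt (f x) (f y)"
    by (auto simp: condensation_def)
  have tree: "is_tree T lt" using nary by (simp add: nary_tree_iff)
  note irr = tree_irrefl[OF tree] and tr = tree_trans[OF tree] and lin = tree_linear[OF tree]
  have fT: "f x \<in> T" if "x \<in> T" for x using bij that by (auto simp: bij_betw_def)
  have inj: "x = y" if "f x = f y" "x \<in> T" "y \<in> T" for x y
    using bij that by (auto simp: bij_betw_def inj_on_def)
  have surj: "\<exists>x\<in>T. y = f x" if "y \<in> T" for y using bij that by (auto simp: bij_betw_def)
  let ?P = "preds T lt"
  have sub: "f ` ?P x \<subseteq> ?P (f x)" if "x \<in> T" for x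
    using that mono fT by auto
  have inj_image: "A = B" if "f ` A = f ` B" "A \<subseteq> T" "B \<subseteq> T" for A B
    using that bij by (meson bij_betw_imp_inj_on inj_on_image_eq_iff)
  have main: "\<forall>x'\<in>T. ?P x' = ?P x \<longrightarrow> f ` ?P x' = ?P (f x')" if "x \<in> T" for x
    using tree that
  proof (induction x rule: tree_induct)
    case (less x0)
    (* The first element s of the chain ?P x outside ?P v is a sibling of v below x. *)
    have IH: "f ` ?P v = ?P (f v)" if x: "x \<in> T" "?P x = ?P x0" and v: "v \<in> T" "?P v \<subset> ?P x" for v x
    proof -
      have "?P x - ?P v \<subseteq> T" "?P x - ?P v \<noteq> {}" using v(2) by (auto simp: preds_def)
      then obtain s where s: "s \<in> ?P x - ?P v" "\<And>y. y \<in> ?P x - ?P v \<Longrightarrow> \<not> lt y s"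
        using tree_minimal[OF tree] by metis
      have "?P s = ?P v"
      proof (intro equalityI subsetI)
        fix y assume y: "y \<in> ?P s"
        then have "y \<in> ?P x" using s(1) x(1) tr[of y s x] by auto
        then show "y \<in> ?P v" using s(2)[of y] y by auto
      next
        fix y assume y: "y \<in> ?P v"
        then have "y \<in> ?P x" using v by auto
        then have "y = s \<or> lt y s \<or> lt s y" using s(1) x(1) lin[of y x s] by auto
        then show "y \<in> ?P s" using s(1) y v(1) tr[of s y v] by auto
      qed
      moreover have "s \<in> T" "lt s x0" using s x by auto
      ultimately show ?thesis using less.IH[of s] v by metis
    qed
    show ?case
    proof (intro ballI impI, rule ccontr)
      fix x assume x: "x \<in> T" "?P x = ?P x0" and neq: "f ` ?P x \<noteq> ?P (f x)"
      then have "?P (f x) - f ` ?P x \<noteq> {}" "?P (f x) - f ` ?P x \<subseteq> T"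
        using sub[OF x(1)] by (blast, auto)
      then obtain y where y: "y \<in> ?P (f x) - f ` ?P x"
        "\<And>w. w \<in> ?P (f x) - f ` ?P x \<Longrightarrow> \<not> lt w y"
        using tree_minimal[OF tree] by metis
      have yT: "y \<in> T" "lt y (f x)" using y by auto
      have closed: "w \<in> f ` ?P x" if "u \<in> f ` ?P x" "lt w u" "w \<in> T" for u w
      proof -
        obtain s where s: "s \<in> ?P x" "u = f s" using \<open>u \<in> f ` ?P x\<close> by auto
        have "?P s \<subset> ?P x"
        proof
          show "?P s \<subseteq> ?P x" using s(1) x(1) tr[of _ s x] by auto
          show "?P s \<noteq> ?P x" using s irr by (metis mem_preds)
        qed
        then have "f ` ?P s = ?P u" using IH[OF x, of s] s by simp
        then have "w \<in> f ` ?P s" using that by auto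
        then show ?thesis using \<open>?P s \<subset> ?P x\<close> by blast
      qed
      have Py: "?P y = f ` ?P x"
      proof (intro equalityI subsetI)
        fix w assume w: "w \<in> ?P y"
        then have "w \<in> ?P (f x)" using yT tr[of w y "f x"] fT[OF x(1)] by auto
        then show "w \<in> f ` ?P x" using y(2)[of w] w by auto
      next
        fix w assume w: "w \<in> f ` ?P x"
        then have "w \<in> ?P (f x)" using sub[OF x(1)] by blast
        then have "w = y \<or> lt w y \<or> lt y w" using yT lin[of w "f x" y] fT[OF x(1)] by auto
        then show "w \<in> ?P y" using w y closed[of w y] \<open>w \<in> ?P (f x)\<close> by auto
      qed
      (* All preimages of siblings of y are siblings of x; one with fewer predecessors would contradict IH. *)
      have M: "node T lt y \<subseteq> f ` node T lt x"
      proof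
        fix w assume w: "w \<in> node T lt y"
        then have wT: "w \<in> T" "?P w = f ` ?P x" using Py by (auto simp: node_def)
        then obtain v where v: "v \<in> T" "w = f v" using surj by blast
        have "f ` ?P v \<subseteq> f ` ?P x" using sub[OF v(1)] v wT by simp
        have le: "?P v \<subseteq> ?P x"
        proof
          fix s assume s: "s \<in> ?P v"
          then obtain u where "f s = f u" "u \<in> ?P x" using \<open>f ` ?P v \<subseteq> f ` ?P x\<close> by blast
          then show "s \<in> ?P x" using inj[of s u] s by auto
        qed
        have "?P v = ?P x"
        proof (rule ccontr)
          assume "?P v \<noteq> ?P x"
          then have "f ` ?P v = f ` ?P x" using IH[OF x v(1)] le wT v(2) by auto
          then have "?P v = ?P x" by (rule inj_image) auto
          then show False using \<open>?P v \<noteq> ?P x\<close> by simp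
        qed
        then show "w \<in> f ` node T lt x" using v by (auto simp: node_def)
      qed
      (* The nodes of x and y have the same kind of height, hence the same size. *)
      have max: "has_max lt (?P y) \<longleftrightarrow> has_max lt (?P x)"
      proof
        assume "has_max lt (?P x)"
        then obtain m where m: "m \<in> ?P x" "\<And>z. z \<in> ?P x \<Longrightarrow> z = m \<or> lt z m"
          by (auto simp: has_max_def)
        have "f z = f m \<or> lt (f z) (f m)" if "z \<in> ?P x" for z
          using m(2)[OF that] mono[of z m] that m(1) by auto
        then show "has_max lt (?P y)" unfolding has_max_def Py using m(1) by blast
      next
        assume "has_max lt (?P y)"
        then obtain m where m: "m \<in> ?P x" "\<And>z. z \<in> ?P x \<Longrightarrow> f z = f m \<or> lt (f z) (f m)"
          unfolding Py by (auto simp: has_max_def)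
        have "z = m \<or> lt z m" if z: "z \<in> ?P x" for z
        proof -
          have "z = m \<or> lt z m \<or> lt m z" using lin[of z x m] z m(1) x(1) by auto
          moreover have False if "lt m z"
          proof -
            have "lt (f m) (f z)" using that mono z m(1) by auto
            then show False using m(2)[OF z] irr fT z m(1) tr[of "f m" "f z" "f m"] by auto
          qed
          ultimately show ?thesis by blast
        qed
        then show "has_max lt (?P x)" using m(1) unfolding has_max_def by blast
      qed
      have card: "card (node T lt y) = card (node T lt x)" "card (node T lt x) > 0"
        using regular_nary_node_card[OF reg nary] yT x max n by auto
      have fin: "finite (node T lt x)" using card(2) card_gt_0_iff by blast
      have "card (f ` node T lt x) = card (node T lt x)"
        by (rule card_image) (use inj in \<open>auto simp: inj_on_def node_def\<close>)
      then have "node T lt y = f ` node T lt x"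
        using card_subset_eq[OF finite_imageI[OF fin] M] card by simp
      then have "f x \<in> node T lt y" using self_in_node[OF x(1), of lt] by simp
      then have "?P (f x) = f ` ?P x" using Py by (simp add: node_def)
      then show False using neq by simp
    qed
  qed
  have "lt x y" if "x \<in> T" "y \<in> T" "lt (f x) (f y)" for x y
  proof -
    have "f ` ?P y = ?P (f y)" using main[OF \<open>y \<in> T\<close>] that(2) by blast
    moreover have "f x \<in> ?P (f y)" using that fT by simp
    ultimately obtain z where "f x = f z" "z \<in> ?P y" by blast
    then show ?thesis using inj[of x z] that(1) by auto
  qed
  then show "automorphism T lt f" using bij mono by (auto simp: automorphism_def)
qed

section \<open>Trees of sequences\<close>

lemma proper_ext_iff: "proper_ext s t \<longleftrightarrow> dom s \<subset> dom t \<and> s = t |` dom s"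
proof
  assume L: "proper_ext s t"
  then have le: "s \<subseteq>\<^sub>m t" and ne: "s \<noteq> t" by (auto simp: proper_ext_def)
  have eq: "s = t |` dom s" using le by (auto simp: map_le_def restrict_map_def dom_def fun_eq_iff)
  moreover have "dom s \<subseteq> dom t" using le by (rule map_le_implies_dom_le)
  moreover have "dom s \<noteq> dom t" using eq ne by (metis map_le_antisym map_le_def le)
  ultimately show "dom s \<subset> dom t \<and> s = t |` dom s" by blast
next
  assume "dom s \<subset> dom t \<and> s = t |` dom s"
  then show "proper_ext s t" unfolding proper_ext_def
    by (metis map_le_def restrict_in order_less_irrefl)
qed

lemma proper_ext_trans: "proper_ext s t \<Longrightarrow> proper_ext t u \<Longrightarrow> proper_ext s u"
  unfolding proper_ext_def by (metis map_le_antisym map_le_trans)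

text \<open>
  The relation \<open>r\<close> is kept general: the complete tree uses an arbitrary well-order, and
  all later trees use the order of a well-ordered type.
\<close>
locale sequence_tree =
  fixes r :: "'b rel" and F :: "('b \<Rightarrow> nat option) set"
  assumes wo: "Well_order r"
    and dom: "\<And>s. s \<in> F \<Longrightarrow> \<exists>\<beta>\<in>Field r. dom s = underS r \<beta>"
    and restrict: "\<And>s \<beta>. s \<in> F \<Longrightarrow> \<beta> \<in> dom s \<Longrightarrow> s |` underS r \<beta> \<in> F"
begin

lemma underS_cases:
  assumes "\<beta> \<in> Field r" "\<gamma> \<in> Field r"
  shows "\<beta> = \<gamma> \<or> \<beta> \<in> underS r \<gamma> \<or> \<gamma> \<in> underS r \<beta>"
  using wo assms unfolding well_order_on_def linear_order_on_def total_on_def underS_def by auto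

lemma underS_mono: "\<beta> \<in> underS r \<gamma> \<Longrightarrow> underS r \<beta> \<subset> underS r \<gamma>"
  using wo unfolding well_order_on_def linear_order_on_def partial_order_on_def preorder_on_def
    underS_def trans_def antisym_def by blast

lemma underS_Field: "underS r \<gamma> \<subseteq> Field r"
  by (auto simp: underS_def Field_def)

definition len :: "('b \<Rightarrow> nat option) \<Rightarrow> 'b" where
  "len s = (SOME \<beta>. \<beta> \<in> Field r \<and> dom s = underS r \<beta>)"

lemma len: assumes "s \<in> F" shows "len s \<in> Field r" "dom s = underS r (len s)"
  using dom[OF assms] unfolding len_def by (metis (mono_tags, lifting) someI_ex)+

lemma len_unique: "s \<in> F \<Longrightarrow> \<beta> \<in> Field r \<Longrightarrow> dom s = underS r \<beta> \<Longrightarrow> len s = \<beta>"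
  by (metis len underS_cases underS_mono order_less_irrefl)

lemma dom_restrict: "s \<in> F \<Longrightarrow> \<beta> \<in> dom s \<Longrightarrow> dom (s |` underS r \<beta>) = underS r \<beta>"
  by (metis Int_absorb1 dom_restrict len(2) order_less_imp_le underS_mono)

lemma preds_eq:
  assumes "t \<in> F" shows "preds F proper_ext t = (\<lambda>\<beta>. t |` underS r \<beta>) ` dom t"
proof (intro equalityI subsetI)
  fix s assume "s \<in> preds F proper_ext t"
  then have s: "s \<in> F" "dom s \<subset> dom t" "s = t |` dom s" by (auto simp: proper_ext_iff)
  then have "len s \<in> dom t" using len[OF s(1)] len[OF assms] underS_cases underS_mono
    by (metis order_less_irrefl order_less_trans)
  then show "s \<in> (\<lambda>\<beta>. t |` underS r \<beta>) ` dom t" using s len(2)[OF s(1)] by auto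
next
  fix s assume "s \<in> (\<lambda>\<beta>. t |` underS r \<beta>) ` dom t"
  then obtain \<beta> where b: "\<beta> \<in> dom t" "s = t |` underS r \<beta>" by auto
  then have "dom s = underS r \<beta>" using dom_restrict assms by simp
  then have "proper_ext s t" using b underS_mono len(2)[OF assms] by (auto simp: proper_ext_iff)
  then show "s \<in> preds F proper_ext t" using b restrict assms by simp
qed

lemma len_restrict: "t \<in> F \<Longrightarrow> \<beta> \<in> dom t \<Longrightarrow> len (t |` underS r \<beta>) = \<beta>"
  using len_unique[OF restrict _ dom_restrict] len(2)[of t] underS_Field by blast

lemma len_preds: assumes "t \<in> F" shows "len ` preds F proper_ext t = underS r (len t)"
  using len_restrict[OF assms] len(2)[OF assms] by (force simp: preds_eq[OF assms])

lemma is_tree: "is_tree F proper_ext"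
  unfolding is_tree_iff
proof (intro conjI ballI)
  show "irreflp_on F proper_ext" by (auto simp: irreflp_on_def proper_ext_def)
  show "transp_on F proper_ext" by (auto simp: transp_on_def intro: proper_ext_trans)
  have len_less: "len s \<in> underS r (len t)" if "s \<in> F" "t \<in> F" "proper_ext s t" for s t
    using len_preds[OF that(2)] that by auto
  have "wf (r - Id)" using wo by (simp add: well_order_on_def)
  then have "wf (inv_image (r - Id) len)" by (rule wf_inv_image)
  then show "wf {(x, y). x \<in> F \<and> y \<in> F \<and> proper_ext x y}"
    by (rule wf_subset) (use len_less in \<open>auto simp: underS_def\<close>)
  fix t x y assume t: "t \<in> F" and "x \<in> preds F proper_ext t" "y \<in> preds F proper_ext t"
  then have x: "x \<in> F" "x = t |` dom x" and y: "y \<in> F" "y = t |` dom y"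
    by (auto simp: proper_ext_iff)
  consider "dom x = dom y" | "dom x \<subset> dom y" | "dom y \<subset> dom x"
    using underS_cases[OF len(1)[OF x(1)] len(1)[OF y(1)]] underS_mono len(2) x(1) y(1) by metis
  then show "x = y \<or> proper_ext x y \<or> proper_ext y x"
    by cases (use x y in \<open>metis inf.absorb_iff2 order_less_imp_le proper_ext_iff restrict_restrict\<close>)+
qed

lemma node_same_dom: assumes "t \<in> F" "s \<in> node F proper_ext t" shows "dom s = dom t"
proof -
  have "s \<in> F" "preds F proper_ext s = preds F proper_ext t" using assms by (auto simp: node_def)
  then show ?thesis using len_preds len(2) assms by metis
qed

text \<open>
  Siblings have the same initial segments, since the length of an initial segment determines its
  place among the predecessors. So two siblings can differ only at a last position.
\<close>
lemma node_restrict: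
  assumes "t \<in> F" "s \<in> node F proper_ext t" "\<beta> \<in> dom t" shows "s |` underS r \<beta> = t |` underS r \<beta>"
proof -
  have s: "s \<in> F" "preds F proper_ext s = preds F proper_ext t" using assms by (auto simp: node_def)
  then have "t |` underS r \<beta> \<in> preds F proper_ext s" using preds_eq[OF assms(1)] assms by auto
  then obtain \<gamma> where g: "\<gamma> \<in> dom s" "t |` underS r \<beta> = s |` underS r \<gamma>" using preds_eq[OF s(1)] by auto
  then have "\<gamma> = \<beta>" using len_restrict assms s by metis
  then show ?thesis using g by simp
qed

text \<open>
  The maximum of the predecessors of \<open>t\<close> is \<open>t\<close> without its last entry.
\<close>
lemma has_max_iff:
  assumes "t \<in> F"
  shows "has_max proper_ext (preds F proper_ext t) \<longleftrightarrow> (\<exists>p\<in>dom t. dom t = insert p (underS r p))"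
proof
  assume "has_max proper_ext (preds F proper_ext t)"
  then obtain p where p: "p \<in> dom t"
    "\<And>q. q \<in> dom t \<Longrightarrow> t |` underS r q = t |` underS r p \<or> proper_ext (t |` underS r q) (t |` underS r p)"
    by (auto simp: has_max_def preds_eq[OF assms])
  have "q = p \<or> q \<in> underS r p" if q: "q \<in> dom t" for q
  proof -
    have "underS r q \<subseteq> underS r p" using p(2)[OF q] dom_restrict[OF assms] p(1) q
      by (metis order_less_imp_le order_refl proper_ext_iff)
    moreover have "q \<in> Field r" "p \<in> Field r" using q p(1) len(2)[OF assms] underS_Field by auto
    ultimately show ?thesis using underS_cases underS_mono by (metis less_le_not_le)
  qed
  moreover have "underS r p \<subseteq> dom t" using p(1) len(2)[OF assms] underS_mono by auto
  ultimately show "\<exists>p\<in>dom t. dom t = insert p (underS r p)" using p(1) by blast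
next
  assume "\<exists>p\<in>dom t. dom t = insert p (underS r p)"
  then obtain p where p: "p \<in> dom t" "dom t = insert p (underS r p)" by blast
  have "t |` underS r q = t |` underS r p \<or> proper_ext (t |` underS r q) (t |` underS r p)"
    if q: "q \<in> dom t" for q
  proof (cases "q = p")
    case False
    then have "underS r q \<subset> underS r p" using p q underS_mono by blast
    then have "proper_ext (t |` underS r q) (t |` underS r p)"
      using dom_restrict[OF assms] q p(1)
      by (simp add: proper_ext_iff inf.absorb2 order_less_imp_le)
    then show ?thesis by simp
  qed simp
  then show "has_max proper_ext (preds F proper_ext t)"
    using p(1) unfolding has_max_def preds_eq[OF assms] by blast
qed

lemma regular: assumes "F \<noteq> {}" shows "regular_tree F proper_ext"
  unfolding regular_tree_iff
proof (intro conjI ballI impI is_tree)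
  obtain t where t: "t \<in> F" using assms by blast
  have "Map.empty \<in> F"
  proof (cases "dom t = {}")
    case False
    have "wf (r - Id)" using wo by (simp add: well_order_on_def)
    then obtain b where b: "b \<in> dom t" "\<And>y. (y, b) \<in> r - Id \<Longrightarrow> y \<notin> dom t"
      using False by (meson wfE_min ex_in_conv)
    have "underS r b \<subseteq> dom t" using underS_mono b(1) len(2)[OF t] by auto
    then have "underS r b = {}" using b(2) unfolding underS_def by blast
    then show ?thesis using restrict[OF t b(1)] by simp
  qed (use t in simp)
  then show "\<exists>e\<in>F. \<forall>t\<in>F. t \<noteq> e \<longrightarrow> proper_ext e t"
    by (rule bexI[rotated]) (auto simp: proper_ext_def)
next
  fix t assume t: "t \<in> F" and "preds F proper_ext t \<noteq> {} \<and> \<not> has_max proper_ext (preds F proper_ext t)"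
  then have nm: "\<not> has_max proper_ext (preds F proper_ext t)" by simp
  have "s = t" if s: "s \<in> node F proper_ext t" for s
  proof (rule map_le_antisym)
    have d: "dom s = dom t" using node_same_dom[OF t s] .
    have eq: "s p = t p" if p: "p \<in> dom t" for p
    proof -
      have "underS r p \<subseteq> dom t" using p len(2)[OF t] underS_mono by auto
      then obtain q where q: "q \<in> dom t" "q \<noteq> p" "q \<notin> underS r p"
        using nm p unfolding has_max_iff[OF t] by blast
      then have "p \<in> underS r q" using underS_cases p len(2)[OF t] underS_Field by (metis subsetD)
      then show ?thesis using node_restrict[OF t s q(1)] by (metis restrict_in)
    qed
    show "s \<subseteq>\<^sub>m t" "t \<subseteq>\<^sub>m s" using d eq by (simp_all add: map_le_def)
  qed
  then show "node F proper_ext t = {t}" using self_in_node[OF t] by blast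
qed

end

text \<open>
  If \<open>p\<close> is the last position of \<open>t\<close>, then the node of \<open>t\<close>
  consists of the \<open>n\<close> possible values at \<open>p\<close>.
\<close>
lemma (in sequence_tree) nary:
  assumes ran: "\<And>s. s \<in> F \<Longrightarrow> ran s \<subseteq> {..<n}"
    and sibling: "\<And>s p i. s \<in> F \<Longrightarrow> p \<in> dom s \<Longrightarrow> dom s = insert p (underS r p) \<Longrightarrow> i < n \<Longrightarrow> s(p \<mapsto> i) \<in> F"
  shows "nary_tree n F proper_ext"
  unfolding nary_tree_iff
proof (intro conjI ballI impI is_tree)
  fix t assume t: "t \<in> F" and "has_max proper_ext (preds F proper_ext t)"
  then obtain p where p: "p \<in> dom t" "dom t = insert p (underS r p)" by (auto simp: has_max_iff)
  have "node F proper_ext t = (\<lambda>i. t(p \<mapsto> i)) ` {..<n}" (is "?N = ?R")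
  proof (intro equalityI subsetI)
    fix s assume s: "s \<in> ?N"
    have d: "dom s = dom t" using node_same_dom[OF t s] .
    then obtain v where v: "s p = Some v" using p(1) by auto
    then obtain i where i: "i < n" "v = i" using ran[of s] s by (auto simp: node_def ran_def)
    have "s q = (t(p \<mapsto> i)) q" for q
    proof (cases "q \<in> underS r p")
      case True
      then show ?thesis using node_restrict[OF t s p(1)]
        by (metis fun_upd_other i(2) restrict_in underS_notIn v fun_upd_same)
    next
      case False
      then show ?thesis using d p v i by (metis domIff fun_upd_apply insertE)
    qed
    then have "s = t(p \<mapsto> i)" using i by auto
    then show "s \<in> ?R" using i by blast
  next
    fix s assume "s \<in> ?R"
    then obtain i where i: "i < n" "s = t(p \<mapsto> i)" by auto
    then have s: "s \<in> F" using sibling t p by simp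
    have d: "dom s = dom t" using i p(1) by auto
    have "t |` underS r \<beta> = s |` underS r \<beta>" if "\<beta> \<in> dom t" for \<beta>
    proof -
      have "p \<notin> underS r \<beta>" using that p underS_mono by (metis insertE underS_notIn psubsetD)
      then show ?thesis using i by simp
    qed
    then have "preds F proper_ext s = preds F proper_ext t"
      unfolding preds_eq[OF t] preds_eq[OF s] d by auto
    then show "s \<in> ?N" using s by (simp add: node_def)
  qed
  moreover have "inj_on (\<lambda>i. t(p \<mapsto> i)) {..<n}"
    by (auto simp: inj_on_def dest: map_upd_eqD1)
  ultimately show "card ?N = n" by (simp add: card_image)
qed

theorem complete_tree_reversible:
  assumes "Well_order \<alpha>" "Field \<alpha> \<noteq> {}" "n \<ge> 1"
  shows "reversible (complete_tree \<alpha> n) proper_ext"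
proof -
  interpret sequence_tree \<alpha> "complete_tree \<alpha> n"
  proof
    fix s :: "'a \<Rightarrow> nat option" and \<beta> assume s: "s \<in> complete_tree \<alpha> n" "\<beta> \<in> dom s"
    then obtain \<gamma> where g: "dom s = underS \<alpha> \<gamma>" "ran s \<subseteq> {..<n}" by (auto simp: complete_tree_def)
    have "underS \<alpha> \<beta> \<subseteq> underS \<alpha> \<gamma>" using assms(1) s(2) g
      unfolding well_order_on_def linear_order_on_def partial_order_on_def preorder_on_def
        underS_def trans_def antisym_def by blast
    then have "dom (s |` underS \<alpha> \<beta>) = underS \<alpha> \<beta>" using g by auto
    moreover have "ran (s |` underS \<alpha> \<beta>) \<subseteq> {..<n}" using g(2) by (auto simp: ran_def restrict_map_def split: if_splits)
    moreover have "\<beta> \<in> Field \<alpha>" using s(2) g by (auto simp: underS_def Field_def)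
    ultimately show "s |` underS \<alpha> \<beta> \<in> complete_tree \<alpha> n" by (auto simp: complete_tree_def)
  qed (use assms in \<open>auto simp: complete_tree_def\<close>)
  obtain b where b: "b \<in> Field \<alpha>" using assms(2) by blast
  have "(\<lambda>x. if x \<in> underS \<alpha> b then Some 0 else None) \<in> complete_tree \<alpha> n"
    using b assms(3) by (auto simp: complete_tree_def ran_def dom_def intro!: bexI[of _ b])
  then have "regular_tree (complete_tree \<alpha> n) proper_ext" by (intro regular) blast
  moreover have "nary_tree n (complete_tree \<alpha> n) proper_ext"
  proof (rule nary)
    fix s :: "'a \<Rightarrow> nat option" and p i
    assume "s \<in> complete_tree \<alpha> n" "p \<in> dom s" "i < n"
    then show "s(p \<mapsto> i) \<in> complete_tree \<alpha> n"
      by (auto simp: complete_tree_def insert_absorb ran_def)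
  qed (auto simp: complete_tree_def)
  ultimately show ?thesis using regular_nary_reversible assms(3) by blast
qed

section \<open>The countable ordinals as a type\<close>

lemma Card_order_omega1: "Card_order omega1"
  by (rule cardSuc_Card_order[OF natLeq_Card_order])

lemma Well_order_omega1: "Well_order omega1"
  using Card_order_omega1 by (rule card_order_on_well_order_on)

text \<open>
  As a cardinal, \<open>\<omega>\<^sub>1\<close> is the least well-order of its cardinality, so
  being below it is a matter of the cardinality of the field.
\<close>
lemma ordLess_omega1_iff: "Well_order r \<Longrightarrow> r <o omega1 \<longleftrightarrow> countable (Field r)"
proof
  assume r: "Well_order r" and "r <o omega1"
  then have "|Field r| <o omega1" using card_of_least ordLeq_ordLess_trans by blast
  then have "|Field r| \<le>o natLeq"
    using cardSuc_ordLeq_ordLess[OF natLeq_Card_order card_of_Card_order] by blast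
  then show "countable (Field r)" by (simp add: countable_card_le_natLeq)
next
  assume r: "Well_order r" and c: "countable (Field r)"
  show "r <o omega1"
  proof (rule ccontr)
    assume "\<not> r <o omega1"
    then have "omega1 \<le>o r" using r Well_order_omega1 ordLess_or_ordLeq by blast
    then have "|Field omega1| \<le>o |Field r|" by (rule card_of_mono2)
    then have "|Field omega1| \<le>o natLeq" using c countable_card_le_natLeq ordLeq_transitive by blast
    then have "omega1 \<le>o natLeq"
      using card_of_Field_ordIso[OF Card_order_omega1] ordIso_symmetric ordIso_ordLeq_trans by blast
    then show False using cardSuc_greater[OF natLeq_Card_order] not_ordLess_ordLeq by blast
  qed
qed

text \<open>
  Having \<open>\<omega>\<^sub>1\<close> as an instance of \<^class>\<open>wellorder\<close> makes
  ranks comparable by \<open><\<close> and gives the lexicographic order of positions below as a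
  library instance.
\<close>
typedef w1 = "Field omega1"
  using Field_cardSuc_not_empty[OF natLeq_Card_order] by blast

instantiation w1 :: linorder
begin

definition less_eq_w1 :: "w1 \<Rightarrow> w1 \<Rightarrow> bool" where
  "a \<le> b \<longleftrightarrow> (Rep_w1 a, Rep_w1 b) \<in> omega1"

definition less_w1 :: "w1 \<Rightarrow> w1 \<Rightarrow> bool" where
  "a < b \<longleftrightarrow> Rep_w1 a \<in> underS omega1 (Rep_w1 b)"

instance
proof
  have *: "Refl omega1" "trans omega1" "antisym omega1" "Total omega1"
    using Well_order_omega1 by (auto simp: order_on_defs)
  fix x y z :: w1
  show "x < y \<longleftrightarrow> x \<le> y \<and> \<not> y \<le> x" using * Rep_w1_inject[of x y] Rep_w1[of x]
    unfolding less_w1_def less_eq_w1_def underS_def antisym_def refl_on_def by auto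
  show "x \<le> x" using * Rep_w1[of x] by (auto simp: less_eq_w1_def refl_on_def)
  show "x \<le> y \<Longrightarrow> y \<le> z \<Longrightarrow> x \<le> z" using * by (auto simp: less_eq_w1_def dest: transD)
  show "x \<le> y \<Longrightarrow> y \<le> x \<Longrightarrow> x = y" using * Rep_w1_inject[of x y]
    by (auto simp: less_eq_w1_def antisym_def)
  show "x \<le> y \<or> y \<le> x" using * Rep_w1[of x] Rep_w1[of y] Rep_w1_inject[of x y]
    unfolding less_eq_w1_def total_on_def refl_on_def by metis
qed

end

lemma underS_omega1: "underS omega1 (Rep_w1 a) = Rep_w1 ` {..<a}"
proof -
  have "x \<in> Rep_w1 ` {..<a}" if "x \<in> underS omega1 (Rep_w1 a)" for x
  proof -
    have "x \<in> Field omega1" using that by (auto simp: underS_def Field_def)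
    then have "Rep_w1 (Abs_w1 x) = x" by (rule Abs_w1_inverse)
    then show ?thesis using that by (intro image_eqI[of _ _ "Abs_w1 x"]) (auto simp: less_w1_def)
  qed
  then show ?thesis by (auto simp: less_w1_def)
qed

instance w1 :: wellorder
proof
  fix P :: "w1 \<Rightarrow> bool" and a
  assume step: "\<And>x. (\<And>y. y < x \<Longrightarrow> P y) \<Longrightarrow> P x"
  have "wf (omega1 - Id)" using Well_order_omega1 by (simp add: well_order_on_def)
  then have "wf (inv_image (omega1 - Id) Rep_w1)" by (rule wf_inv_image)
  then show "P a"
    by (induction a rule: wf_induct_rule) (rule step, auto simp: less_w1_def underS_def)
qed

text \<open>
  The ordinal \<open>a\<close> as a well-order on the type of \<open>\<omega>\<^sub>1\<close>, for
  comparison with heights up to \<open>=o\<close>.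
\<close>
definition ord_w1 :: "w1 \<Rightarrow> nat set rel" where
  "ord_w1 a = Restr omega1 (underS omega1 (Rep_w1 a))"

lemma Well_order_ord_w1: "Well_order (ord_w1 a)"
  by (simp add: ord_w1_def Well_order_Restr Well_order_omega1)

lemma ordLess_omega1_imp_ord_w1: assumes "r <o omega1" shows "\<exists>a. r =o ord_w1 a"
proof -
  have "Well_order r" using assms by (simp add: ordLess_def)
  then show ?thesis using ordLess_iff_ordIso_Restr[OF Well_order_omega1] assms
    unfolding ord_w1_def by (metis Rep_w1_cases)
qed

lemma ord_w1_less_omega1: "ord_w1 a <o omega1"
  unfolding ord_w1_def using underS_Restr_ordLess[OF Well_order_omega1] Rep_w1 
  by (metis Field_cardSuc_not_empty natLeq_Card_order)

lemma Field_ord_w1: "Field (ord_w1 a) = Rep_w1 ` {..<a}"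
proof -
  have "(x, x) \<in> omega1" if "x \<in> Rep_w1 ` {..<a}" for x
    using that Well_order_omega1 Rep_w1 by (auto simp: order_on_defs refl_on_def)
  then show ?thesis unfolding ord_w1_def underS_omega1 Field_def by auto
qed

lemma ord_w1_eq: "ord_w1 a = {(Rep_w1 x, Rep_w1 y) | x y. x \<le> y \<and> y < a \<and> x < a}"
  unfolding ord_w1_def underS_omega1 by (auto simp: less_eq_w1_def)

lemma countable_lessThan_w1: "countable {..<a :: w1}"
proof -
  have "countable (Rep_w1 ` {..<a})"
    using ordLess_omega1_iff[OF Well_order_ord_w1] ord_w1_less_omega1 Field_ord_w1 by metis
  then show ?thesis by (rule countable_image_inj_on) (simp add: inj_on_def Rep_w1_inject)
qed

lemma uncountable_w1: "uncountable (UNIV :: w1 set)"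
proof
  assume "countable (UNIV :: w1 set)"
  then have "countable (range Rep_w1)" by simp
  then have "countable (Field omega1)" using type_definition.Rep_range[OF type_definition_w1] by simp
  then have "omega1 <o omega1" using ordLess_omega1_iff[OF Well_order_omega1] by simp
  then show False by (rule ordLess_irreflexive[THEN notE])
qed

lemma countable_bounded_w1:
  assumes "countable A" obtains b :: w1 where "\<And>a. a \<in> A \<Longrightarrow> a < b"
proof -
  have "countable (\<Union>a\<in>A. insert a {..<a})" using assms countable_lessThan_w1 by simp
  then obtain b where "b \<notin> (\<Union>a\<in>A. insert a {..<a})"
    using uncountable_w1 by (metis UNIV_eq_I)
  then show thesis using that[of b] by (metis UN_I insertCI lessThan_iff linorder_neqE)
qed

lemma ord_w1_less: assumes "a < b" shows "ord_w1 a <o ord_w1 b"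
proof -
  have "Rep_w1 a \<in> Field (ord_w1 b)" using assms by (simp add: Field_ord_w1)
  then have "Restr (ord_w1 b) (underS (ord_w1 b) (Rep_w1 a)) <o ord_w1 b"
    using underS_Restr_ordLess[OF Well_order_ord_w1] by blast
  moreover have "Restr (ord_w1 b) (underS (ord_w1 b) (Rep_w1 a)) = ord_w1 a"
    using assms unfolding ord_w1_eq underS_def by (auto simp: Rep_w1_inject)
  ultimately show ?thesis by simp
qed

lemma ord_w1_inj: "ord_w1 a =o ord_w1 b \<Longrightarrow> a = b"
  using ord_w1_less[of a b] ord_w1_less[of b a]
  by (metis linorder_neqE not_ordLess_ordIso ordIso_symmetric)

lemma ord_w1_less_iff: "ord_w1 a <o ord_w1 b \<longleftrightarrow> a < b"
  using ord_w1_less[of a b] ord_w1_less[of b a]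
  by (metis linorder_neqE ordLess_irreflexive ordLess_transitive)

section \<open>Heights of elements\<close>

lemma Restr_height_at:
  assumes "is_tree T lt" "t \<in> T" "s \<in> T" "lt s t"
  shows "Restr (height_at T lt t) (underS (height_at T lt t) s) = height_at T lt s"
proof -
  have "underS (height_at T lt t) s = preds T lt s"
    using assms tree_irrefl[OF assms(1)] tree_trans[OF assms(1), of _ s t]
    by (auto simp: underS_def height_at_def)
  then show ?thesis using assms tree_trans[OF assms(1), of _ s t]
    by (auto simp: height_at_def)
qed

lemma height_at_less:
  assumes "is_tree T lt" "t \<in> T" "s \<in> T" "lt s t"
  shows "height_at T lt s <o height_at T lt t"
proof -
  have "Field (height_at T lt t) \<noteq> {}" using assms by (simp add: preds_def) blast
  then show ?thesis
    using underS_Restr_ordLess[OF Well_order_height_at[OF assms(1,2)], of s] Restr_height_at[OF assms]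
    by simp
qed

lemma height_at_attained:
  assumes "is_tree T lt" "t \<in> T" "r <o height_at T lt t"
  obtains s where "s \<in> T" "lt s t" "r =o height_at T lt s"
proof -
  have "Well_order r" using assms(3) by (simp add: ordLess_def)
  then obtain s where "s \<in> Field (height_at T lt t)"
      "r =o Restr (height_at T lt t) (underS (height_at T lt t) s)"
    using ordLess_iff_ordIso_Restr[OF Well_order_height_at[OF assms(1,2)]] assms(3) by blast
  then show thesis using that[of s] Restr_height_at[OF assms(1,2), of s] by simp
qed

lemma countable_preds_iff:
  "is_tree T lt \<Longrightarrow> t \<in> T \<Longrightarrow> countable (preds T lt t) \<longleftrightarrow> (\<exists>a. height_at T lt t =o ord_w1 a)"
  using ordLess_omega1_iff[OF Well_order_height_at, of T lt t] ordLess_omega1_imp_ord_w1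
    ord_w1_less_omega1 ordIso_ordLess_trans by (metis Field_height_at)

text \<open>
  If some element had uncountably many predecessors, then \<open>\<omega>\<^sub>1\<close> would be
  the height of that element or of one below it. So the first condition expresses that
  \<open>\<omega>\<^sub>1\<close> does not occur as a height, and the second that all smaller
  ordinals do.
\<close>
lemma has_height_omega1_iff:
  assumes tree: "is_tree T lt"
  shows "has_height T lt omega1 \<longleftrightarrow>
    (\<forall>t\<in>T. countable (preds T lt t)) \<and> (\<forall>a. \<exists>t\<in>T. height_at T lt t =o ord_w1 a)"
proof (intro iffI conjI ballI allI)
  assume H: "has_height T lt omega1"
  show "countable (preds T lt t)" if t: "t \<in> T" for t
  proof (rule ccontr)
    assume "uncountable (preds T lt t)"
    then have "\<not> height_at T lt t <o omega1"
      using ordLess_omega1_iff[OF Well_order_height_at[OF tree t]] by simp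
    then have "omega1 \<le>o height_at T lt t"
      using ordLess_or_ordLeq[OF Well_order_height_at[OF tree t] Well_order_omega1] by blast
    moreover have "\<not> omega1 =o height_at T lt t" using H t ordIso_symmetric by (auto simp: has_height_def)
    ultimately have "omega1 <o height_at T lt t" using ordLeq_iff_ordLess_or_ordIso by blast
    then obtain s where "s \<in> T" "omega1 =o height_at T lt s" by (rule height_at_attained[OF tree t])
    then show False using H ordIso_symmetric by (auto simp: has_height_def)
  qed
  show "\<exists>t\<in>T. height_at T lt t =o ord_w1 a" for a
  proof (rule ccontr)
    assume "\<not> ?thesis"
    then have "omega1 \<le>o ord_w1 a" using H Well_order_ord_w1[of a] unfolding has_height_def by metis
    then show False using ord_w1_less_omega1 not_ordLess_ordLeq by blast
  qed
next
  assume A: "(\<forall>t\<in>T. countable (preds T lt t)) \<and> (\<forall>a. \<exists>t\<in>T. height_at T lt t =o ord_w1 a)"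
  have "\<not> height_at T lt t =o omega1" if "t \<in> T" for t
    using A that ordLess_omega1_iff[OF Well_order_height_at[OF tree that]] not_ordLess_ordIso by auto
  moreover have "omega1 \<le>o \<beta>" if "Well_order \<beta>" "\<not> (\<exists>t\<in>T. height_at T lt t =o \<beta>)" for \<beta> :: "nat set rel"
  proof (rule ccontr)
    assume "\<not> omega1 \<le>o \<beta>"
    then have "\<beta> <o omega1" using that(1) Well_order_omega1 ordLess_or_ordLeq by blast
    then obtain a where a: "\<beta> =o ord_w1 a" using ordLess_omega1_imp_ord_w1 by blast
    obtain t where "t \<in> T" "height_at T lt t =o ord_w1 a" using A by blast
    then show False using that(2) a ordIso_symmetric ordIso_transitive by blast
  qed
  ultimately show "has_height T lt omega1" using Well_order_omega1 by (auto simp: has_height_def)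
qed

text \<open>
  Given countable levels, the requirement that all countable ordinals occur as heights amounts to
  uncountability. If \<open>a\<close> does not occur, then the tree is the union of the countably
  many levels below \<open>a\<close>. Conversely, \<open>\<omega>\<^sub>1\<close> different heights
  need uncountably many elements.
\<close>
lemma omega1_tree_iff:
  "omega1_tree T lt \<longleftrightarrow> is_tree T lt \<and> (\<forall>t\<in>T. countable (preds T lt t)) \<and> uncountable T \<and>
     (\<forall>a. countable (level T lt (ord_w1 a)))"
proof (cases "is_tree T lt")
  case tree: True
  show ?thesis
  proof
    assume O: "omega1_tree T lt"
    then have H: "\<forall>t\<in>T. countable (preds T lt t)" "\<forall>a. \<exists>t\<in>T. height_at T lt t =o ord_w1 a"
      using has_height_omega1_iff[OF tree] by (auto simp: omega1_tree_def)
    then obtain t where t: "\<And>a. t a \<in> T" "\<And>a. height_at T lt (t a) =o ord_w1 a" by metis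
    have "inj t" using t(2) ord_w1_inj ordIso_symmetric ordIso_transitive by (metis injI)
    have "uncountable T"
    proof
      assume "countable T"
      then have "countable (range t)" using t(1) by (meson countable_subset image_subsetI)
      then show False using \<open>inj t\<close> uncountable_w1 countable_image_inj_on by blast
    qed
    then show "is_tree T lt \<and> (\<forall>t\<in>T. countable (preds T lt t)) \<and> uncountable T \<and>
      (\<forall>a. countable (level T lt (ord_w1 a)))" using O H by (auto simp: omega1_tree_def)
  next
    assume A: "is_tree T lt \<and> (\<forall>t\<in>T. countable (preds T lt t)) \<and> uncountable T \<and>
      (\<forall>a. countable (level T lt (ord_w1 a)))"
    have "\<exists>t\<in>T. height_at T lt t =o ord_w1 a" for a
    proof (rule ccontr)
      assume no: "\<not> (\<exists>t\<in>T. height_at T lt t =o ord_w1 a)"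
      have "\<exists>b<a. t \<in> level T lt (ord_w1 b)" if t: "t \<in> T" for t
      proof -
        obtain b where b: "height_at T lt t =o ord_w1 b" using A countable_preds_iff[OF tree t] t by blast
        have "\<not> a < b"
        proof
          assume "a < b"
          then have "ord_w1 a <o height_at T lt t"
            using b ord_w1_less ordIso_symmetric ordLess_ordIso_trans by blast
          then obtain s where "s \<in> T" "ord_w1 a =o height_at T lt s"
            by (rule height_at_attained[OF tree t])
          then show False using no ordIso_symmetric by metis
        qed
        moreover have "a \<noteq> b" using b no t by blast
        ultimately have "b < a" by simp
        then show ?thesis using b t by (auto simp: level_def)
      qed
      then have "T \<subseteq> (\<Union>b\<in>{..<a}. level T lt (ord_w1 b))" by blast
      moreover have "countable (\<Union>b\<in>{..<a}. level T lt (ord_w1 b))"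
        using A countable_lessThan_w1 by simp
      ultimately show False using A countable_subset by metis
    qed
    moreover have "countable (level T lt \<alpha>)" for \<alpha> :: "nat set rel"
    proof (cases "level T lt \<alpha> = {}")
      case False
      then obtain t where t: "t \<in> T" "height_at T lt t =o \<alpha>" by (auto simp: level_def)
      obtain a where "height_at T lt t =o ord_w1 a" using A countable_preds_iff[OF tree] t by blast
      then have "\<alpha> =o ord_w1 a" using t ordIso_symmetric ordIso_transitive by blast
      then have "level T lt \<alpha> \<subseteq> level T lt (ord_w1 a)" using ordIso_transitive by (auto simp: level_def)
      then show ?thesis using A countable_subset by blast
    qed simp
    ultimately show "omega1_tree T lt" using A has_height_omega1_iff[OF tree]
      by (simp add: omega1_tree_def)
  qed
qed (simp add: omega1_tree_def)

text \<open>
  From here on ranks in \<^typ>\<open>w1\<close> replace heights, since they can be compared by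
  \<open><\<close> and used as positions.
\<close>
lemma tree_rank:
  assumes tree: "is_tree T lt" and "\<forall>t\<in>T. countable (preds T lt t)"
  obtains \<rho> :: "'a \<Rightarrow> w1"
  where "\<And>s t. s \<in> T \<Longrightarrow> t \<in> T \<Longrightarrow> lt s t \<Longrightarrow> \<rho> s < \<rho> t"
    and "\<And>t a. t \<in> T \<Longrightarrow> a < \<rho> t \<Longrightarrow> \<exists>s\<in>T. lt s t \<and> \<rho> s = a"
    and "\<And>t. t \<in> T \<Longrightarrow> height_at T lt t =o ord_w1 (\<rho> t)"
proof -
  have "\<forall>t\<in>T. \<exists>a. height_at T lt t =o ord_w1 a" using assms(2) countable_preds_iff[OF tree] by simp
  then obtain \<rho> where \<rho>: "\<And>t. t \<in> T \<Longrightarrow> height_at T lt t =o ord_w1 (\<rho> t)" by metis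
  have 1: "\<rho> s < \<rho> t" if "s \<in> T" "t \<in> T" "lt s t" for s t
    using height_at_less[OF tree that(2,1,3)] \<rho>[OF that(1)] \<rho>[OF that(2)]
    by (metis ord_w1_less_iff ordIso_ordLess_trans ordIso_symmetric ordLess_ordIso_trans)
  have 2: "\<exists>s\<in>T. lt s t \<and> \<rho> s = a" if "t \<in> T" "a < \<rho> t" for t a
  proof -
    have "ord_w1 a <o height_at T lt t"
      using \<rho>[OF that(1)] ord_w1_less[OF that(2)] ordIso_symmetric ordLess_ordIso_trans by blast
    then obtain s where s: "s \<in> T" "lt s t" "ord_w1 a =o height_at T lt s"
      by (rule height_at_attained[OF tree \<open>t \<in> T\<close>])
    then have "\<rho> s = a" using \<rho>[OF s(1)] ord_w1_inj ordIso_transitive by metis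
    then show ?thesis using s by blast
  qed
  show thesis using that 1 2 \<rho> by blast
qed

section \<open>Chains and antichains\<close>

text \<open>
  The downward closure of an uncountable chain is a branch: an element comparable with all of it but
  outside would have uncountably many predecessors. This removes maximality from all later
  arguments.
\<close>
lemma countable_branches_iff:
  assumes tree: "is_tree T lt" and pc: "\<forall>t\<in>T. countable (preds T lt t)"
  shows "(\<forall>B. branch T lt B \<longrightarrow> countable B) \<longleftrightarrow> (\<forall>C. pred_on.chain T lt C \<longrightarrow> countable C)"
proof (intro iffI allI impI)
  fix C assume B: "\<forall>B. branch T lt B \<longrightarrow> countable B" and C: "pred_on.chain T lt C"
  show "countable C"
  proof (rule ccontr)
    assume unc: "uncountable C"
    have CT: "C \<subseteq> T" and cmp: "\<And>x y. x \<in> C \<Longrightarrow> y \<in> C \<Longrightarrow> x = y \<or> lt x y \<or> lt y x"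
      using C by (auto simp: pred_on.chain_def)
    define D where "D = {t\<in>T. \<exists>c\<in>C. t = c \<or> lt t c}"
    (* A maximum of C would leave C inside a countable set of predecessors. *)
    have above: "\<exists>c\<in>C. lt t c" if t: "t \<in> D" for t
    proof (rule ccontr)
      assume no: "\<not> ?thesis"
      then have "t \<in> C" using t by (auto simp: D_def)
      then have "c = t \<or> lt c t" if "c \<in> C" for c using no cmp[of c t] that by blast
      then have "C \<subseteq> insert t (preds T lt t)" using CT unfolding preds_def by blast
      then show False using unc pc CT \<open>t \<in> C\<close> by (meson countable_insert countable_subset subsetD)
    qed
    have "pred_on.chain T lt D" unfolding pred_on.chain_def
    proof (intro conjI ballI)
      fix x y assume xy: "x \<in> D" "y \<in> D"
      then obtain c d where c: "c \<in> C" "lt x c" and d: "d \<in> C" "lt y d" using above by metis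
      have T: "x \<in> T" "y \<in> T" "c \<in> T" "d \<in> T" using xy c d CT by (auto simp: D_def)
      have "lt x d \<or> lt y c"
        using cmp[OF c(1) d(1)] c d T tree_trans[OF tree, of x c d] tree_trans[OF tree, of y d c] by blast
      then have "x = y \<or> lt x y \<or> lt y x"
        using tree_linear[OF tree, of x c y] tree_linear[OF tree, of x d y] T c d by blast
      then show "lt\<^sup>=\<^sup>= x y \<or> lt\<^sup>=\<^sup>= y x" by auto
    qed (auto simp: D_def)
    moreover have "\<not> D \<subset> S" if S: "pred_on.chain T lt S" for S
    proof
      assume "D \<subset> S"
      then obtain x where x: "x \<in> S" "x \<notin> D" "x \<in> T" using S by (auto simp: pred_on.chain_def)
      have "C \<subseteq> preds T lt x"
      proof
        fix c assume c: "c \<in> C"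
        then have "c \<in> D" using CT by (auto simp: D_def)
        then have "c \<in> S" using \<open>D \<subset> S\<close> by blast
        then have "c = x \<or> lt c x \<or> lt x c" using S x by (auto simp: pred_on.chain_def)
        then show "c \<in> preds T lt x" using x c CT by (auto simp: D_def)
      qed
      then show False using unc pc x countable_subset by blast
    qed
    ultimately have "branch T lt D" by (auto simp: pred_on.maxchain_def)
    then have "countable D" using B by blast
    moreover have "C \<subseteq> D" using CT by (auto simp: D_def)
    ultimately show False using unc countable_subset by blast
  qed
qed (auto simp: pred_on.maxchain_def)

lemma antichain_level:
  assumes "is_tree T lt" shows "antichain T lt (level T lt \<alpha>)"
proof -
  have "\<not> lt x y" if xy: "x \<in> level T lt \<alpha>" "y \<in> level T lt \<alpha>" for x y
  proof
    assume "lt x y"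
    then have "height_at T lt x <o height_at T lt y"
      using height_at_less[OF assms] xy by (simp add: level_def)
    moreover have "height_at T lt x =o height_at T lt y"
      using xy ordIso_symmetric ordIso_transitive unfolding level_def by blast
    ultimately show False using not_ordLess_ordIso by blast
  qed
  then show ?thesis by (auto simp: antichain_def level_def)
qed

lemma suslin_tree_iff:
  "suslin_tree T lt \<longleftrightarrow> omega1_tree T lt \<and> (\<forall>C. pred_on.chain T lt C \<longrightarrow> countable C) \<and>
    (\<forall>A. antichain T lt A \<longrightarrow> countable A)"
proof (cases "is_tree T lt")
  case tree: True
  show ?thesis
    using has_height_omega1_iff[OF tree] countable_branches_iff[OF tree] antichain_level[OF tree]
    unfolding suslin_tree_def omega1_tree_def by metis
qed (simp add: suslin_tree_def omega1_tree_def)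

lemma suslin_treeI:
  assumes "is_tree T lt" "\<And>t. t \<in> T \<Longrightarrow> countable (preds T lt t)" "uncountable T"
    "\<And>C. pred_on.chain T lt C \<Longrightarrow> countable C" "\<And>A. antichain T lt A \<Longrightarrow> countable A"
  shows "suslin_tree T lt"
proof -
  have "countable (level T lt (ord_w1 a))" for a
    using assms(5) antichain_level[OF assms(1)] by blast
  then show ?thesis using assms by (simp add: suslin_tree_iff omega1_tree_iff)
qed

section \<open>Sequences of countable length\<close>

context sequence_tree
begin

text \<open>
  Levels can be described by lengths: elements of equal height have the same domain.
\<close>
lemma height_at_len:
  assumes t: "t \<in> F"
  shows "height_at F proper_ext t =o Restr r (underS r (len t))"
proof -
  have d: "dom t = underS r (len t)" "len t \<in> Field r" using len[OF t] by auto
  have refl: "\<And>x. x \<in> Field r \<Longrightarrow> (x, x) \<in> r"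
    using wo by (auto simp: order_on_defs refl_on_def)
  have Fld: "Field (Restr r (underS r (len t))) = underS r (len t)"
    using refl underS_Field[of "len t"] unfolding Field_def by blast
  have "iso (height_at F proper_ext t) (Restr r (underS r (len t))) len"
    unfolding iso_iff2 Fld Field_height_at
  proof (intro conjI ballI)
    show "bij_betw len (preds F proper_ext t) (underS r (len t))"
      unfolding bij_betw_def
    proof
      show "inj_on len (preds F proper_ext t)"
        by (rule inj_on_inverseI[of _ "\<lambda>\<beta>. t |` underS r \<beta>"])
          (auto simp: preds_eq[OF t] len_restrict[OF t, OF domI])
    qed (rule len_preds[OF t])
    fix x y assume xy: "x \<in> preds F proper_ext t" "y \<in> preds F proper_ext t"
    then obtain \<beta> \<gamma> where b: "\<beta> \<in> dom t" "x = t |` underS r \<beta>" and g: "\<gamma> \<in> dom t" "y = t |` underS r \<gamma>"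
      by (auto simp: preds_eq[OF t])
    have l: "len x = \<beta>" "len y = \<gamma>" using b g len_restrict[OF t] by auto
    have dx: "dom x = underS r \<beta>" "dom y = underS r \<gamma>" using b g dom_restrict[OF t] by auto
    have F: "x \<in> F" "y \<in> F" using xy by auto
    have fld: "\<beta> \<in> Field r" "\<gamma> \<in> Field r" using b g d underS_Field by auto
    have "(x = y \<or> proper_ext x y) \<longleftrightarrow> (\<beta>, \<gamma>) \<in> r"
    proof
      assume "x = y \<or> proper_ext x y"
      then show "(\<beta>, \<gamma>) \<in> r"
      proof
        assume "x = y" then show ?thesis using l refl fld by simp
      next
        assume "proper_ext x y"
        then have "len x \<in> underS r (len y)" using len_preds[OF F(2)] F by auto
        then show ?thesis using l by (simp add: underS_def)
      qed
    next
      assume bg: "(\<beta>, \<gamma>) \<in> r"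
      show "x = y \<or> proper_ext x y"
      proof (cases "\<beta> = \<gamma>")
        case False
        then have "\<beta> \<in> underS r \<gamma>" using bg by (simp add: underS_def)
        then have sub: "underS r \<beta> \<subset> underS r \<gamma>" by (rule underS_mono)
        have "x = y |` underS r \<beta>" using b g sub by (simp add: inf.absorb2 order_less_imp_le)
        then show ?thesis using sub dx by (simp add: proper_ext_iff)
      qed (use b g in simp)
    qed
    then show "(x, y) \<in> height_at F proper_ext t \<longleftrightarrow> (len x, len y) \<in> Restr r (underS r (len t))"
      using xy l b g d unfolding height_at_def by auto
  qed
  then show ?thesis
    using Well_order_height_at[OF is_tree t] Well_order_Restr[OF wo] unfolding ordIso_def by blast
qed

lemma same_height_same_dom:
  assumes "s \<in> F" "t \<in> F" "height_at F proper_ext s =o height_at F proper_ext t"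
  shows "dom s = dom t"
proof -
  have "len s \<notin> underS r (len t)" if st: "s \<in> F" "t \<in> F"
    "height_at F proper_ext s =o height_at F proper_ext t" for s t
  proof
    assume "len s \<in> underS r (len t)"
    then obtain u where u: "u \<in> F" "proper_ext u t" "len u = len s"
      using len_preds[OF st(2)] by force
    have "height_at F proper_ext u =o height_at F proper_ext s"
      using height_at_len[OF u(1)] height_at_len[OF st(1)] u(3) ordIso_symmetric ordIso_transitive
      by metis
    then have "height_at F proper_ext u =o height_at F proper_ext t"
      using st(3) ordIso_transitive by blast
    then show False using height_at_less[OF is_tree, OF st(2) u(1,2)] not_ordLess_ordIso by blast
  qed
  from this[OF assms] this[OF assms(2,1) ordIso_symmetric[OF assms(3)]]
  have "len s = len t"
    using underS_cases[OF len(1)[OF assms(1)] len(1)[OF assms(2)]] by blast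
  then show ?thesis using len(2) assms by metis
qed

end

lemma Field_le: "Field {(x, y :: 'l :: linorder). x \<le> y} = UNIV"
  by (auto simp: Field_def)

lemma Well_order_le: "Well_order {(x, y :: 'l :: wellorder). x \<le> y}"
proof -
  have "{(x, y :: 'l). x \<le> y} - Id = {(x, y). x < y}" by auto
  then have "wf ({(x, y :: 'l). x \<le> y} - Id)" using wf by simp
  then show ?thesis
    unfolding Field_le order_on_defs refl_on_def trans_def antisym_def total_on_def by auto
qed

text \<open>
  Positions are ordered lexicographically, so they have order type \<open>\<omega> *
  \<omega>\<^sub>1 = \<omega>\<^sub>1\<close>. The block \<open>{a} \<times> UNIV\<close> has room
  for one natural number per countable ordinal.
\<close>
type_synonym pos = "w1 \<times> nat"

lemma countable_lessThan_pos: "countable {..<\<beta> :: pos}"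
proof -
  have "{..<\<beta>} \<subseteq> insert (fst \<beta>) {..<fst \<beta>} \<times> UNIV" by (auto simp: less_prod_def)
  moreover have "countable (insert (fst \<beta>) {..<fst \<beta>} \<times> (UNIV :: nat set))"
    using countable_lessThan_w1 by simp
  ultimately show ?thesis by (rule countable_subset)
qed

locale pos_tree =
  fixes F :: "(pos \<Rightarrow> nat option) set"
  assumes dom_lessThan: "\<And>s. s \<in> F \<Longrightarrow> \<exists>\<beta>. dom s = {..<\<beta>}"
    and restrict_lessThan: "\<And>s \<beta>. s \<in> F \<Longrightarrow> \<beta> \<in> dom s \<Longrightarrow> s |` {..<\<beta>} \<in> F"
begin

lemma underS_le: "underS {(x, y :: 'l :: linorder). x \<le> y} b = {..<b}"
  by (auto simp: underS_def)

sublocale sequence_tree "{(x, y). x \<le> y}" F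
proof
  show "Well_order {(x, y :: pos). x \<le> y}" by (rule Well_order_le)
qed (simp_all only: underS_le Field_le dom_lessThan restrict_lessThan bex_UNIV)

lemma countable_preds: assumes t: "t \<in> F" shows "countable (preds F proper_ext t)"
proof -
  obtain \<beta> where "dom t = {..<\<beta>}" using dom_lessThan[OF t] by blast
  then show ?thesis using countable_lessThan_pos[of \<beta>] by (simp add: preds_eq[OF t])
qed

lemma omega1_treeI:
  assumes "\<And>\<beta>. countable {s\<in>F. dom s = {..<\<beta>}}" "uncountable F"
  shows "omega1_tree F proper_ext"
  unfolding omega1_tree_iff
proof (intro conjI ballI allI is_tree assms countable_preds)
  fix a
  show "countable (level F proper_ext (ord_w1 a))"
  proof (cases "level F proper_ext (ord_w1 a) = {}")
    case False
    then obtain t where t: "t \<in> F" "height_at F proper_ext t =o ord_w1 a" by (auto simp: level_def)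
    obtain \<beta> where b: "dom t = {..<\<beta>}" using dom_lessThan t by blast
    have "dom s = {..<\<beta>}" if "s \<in> F" "height_at F proper_ext s =o ord_w1 a" for s
      using same_height_same_dom[OF that(1) t(1)] that(2) t(2) b ordIso_symmetric ordIso_transitive by metis
    then have "level F proper_ext (ord_w1 a) \<subseteq> {s\<in>F. dom s = {..<\<beta>}}" by (auto simp: level_def)
    then show ?thesis using assms(1) countable_subset by blast
  qed simp
qed

end

section \<open>A regular Aronszajn tree\<close>

text \<open>
  A sequence of finite-to-one functions \<open>coh a\<close> on \<open>{..a}\<close>, any two of
  which differ at finitely many common arguments. Enumerate the ordinals below \<open>a\<close> as
  \<open>g\<^sub>0, g\<^sub>1, \<dots>\<close>. At \<open>x < a\<close> the value copies \<open>coh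
  g\<^sub>n\<close> for the first \<open>n\<close> with \<open>x \<le> g\<^sub>n\<close>, raised to
  at least \<open>n\<close>. Raising makes \<open>coh a\<close> finite-to-one, because small values
  come from finitely many of the \<open>coh g\<^sub>n\<close>. It changes each \<open>coh
  g\<^sub>n\<close> at finitely many places only, because \<open>coh g\<^sub>n\<close> is
  finite-to-one. With the domain \<open>{..a}\<close> in place of \<open>{..<a}\<close>, successors
  and limits need no distinction.
\<close>
function coh :: "w1 \<Rightarrow> w1 \<Rightarrow> nat" where
  "coh a x = (if x < a then
     let n = (LEAST n. x \<le> from_nat_into {..<a} n) in max (coh (from_nat_into {..<a} n) x) n else 0)"
  by auto
termination
proof (relation "inv_image {(a, b). a < b} fst")
  show "wf (inv_image {(a, b :: w1). a < b} fst)" by (intro wf_inv_image wf)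
  fix a x :: w1 and n assume "x < a"
  then have "{..<a} \<noteq> {}" by auto
  then have "from_nat_into {..<a} n \<in> {..<a}" by (rule from_nat_into)
  then show "((from_nat_into {..<a} n, x), (a, x)) \<in> inv_image {(a, b). a < b} fst" by simp
qed

declare coh.simps [simp del]

lemma coh_step:
  assumes "x < a"
  obtains n where "x \<le> from_nat_into {..<a} n" "\<And>m. x \<le> from_nat_into {..<a} m \<Longrightarrow> n \<le> m"
    "coh a x = max (coh (from_nat_into {..<a} n) x) n"
proof -
  have "x \<in> {..<a}" using assms by simp
  then obtain m where "x = from_nat_into {..<a} m"
    using from_nat_into_surj[OF countable_lessThan_w1] by metis
  then have "x \<le> from_nat_into {..<a} m" by simp
  then have "x \<le> from_nat_into {..<a} (LEAST n. x \<le> from_nat_into {..<a} n)" by (rule LeastI)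
  then show thesis using assms by (intro that) (auto simp: coh.simps[of a] Let_def intro: Least_le)
qed

text \<open>
  Both claims support each other. For \<open>b = g\<^sub>m\<close> every \<open>x \<le> b\<close>
  uses an index \<open>n \<le> m\<close>, so that only finitely many comparisons of \<open>coh
  g\<^sub>n\<close> with \<open>coh b\<close> are involved, to which the induction hypothesis for
  the larger of \<open>g\<^sub>n\<close> and \<open>b\<close> applies.
\<close>
lemma coh_finite:
  "(\<forall>k. finite {x. x \<le> a \<and> coh a x \<le> k}) \<and> (\<forall>b<a. finite {x. x \<le> b \<and> coh a x \<noteq> coh b x})"
proof (induction a rule: less_induct)
  case (less a)
  let ?g = "from_nat_into {..<a}"
  have g: "?g n < a" if "x < a" for x n
    using from_nat_into[of "{..<a}" n] that by auto
  have fin: "finite {x. x \<le> b \<and> coh b x \<le> k}" if "b < a" for b k using less.IH[OF that] by blast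
  have coherent: "finite {x. x \<le> b \<and> x \<le> c \<and> coh b x \<noteq> coh c x}" if "b < a" "c < a" for b c
  proof -
    consider "b < c" | "b = c" | "c < b" by fastforce
    then show ?thesis
    proof cases
      case 1
      then have "finite {x. x \<le> b \<and> coh c x \<noteq> coh b x}" using less.IH[OF that(2)] by blast
      then show ?thesis by (rule rev_finite_subset) auto
    next
      case 3
      then have "finite {x. x \<le> c \<and> coh b x \<noteq> coh c x}" using less.IH[OF that(1)] by blast
      then show ?thesis by (rule rev_finite_subset) auto
    qed auto
  qed
  show ?case
  proof (intro conjI allI impI)
    fix k
    have "{x. x \<le> a \<and> coh a x \<le> k} \<subseteq> insert a (\<Union>n\<in>{n. n \<le> k \<and> ?g n < a}. {x. x \<le> ?g n \<and> coh (?g n) x \<le> k})"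
    proof
      fix x assume "x \<in> {x. x \<le> a \<and> coh a x \<le> k}"
      then have x: "x \<le> a" "coh a x \<le> k" by auto
      show "x \<in> insert a (\<Union>n\<in>{n. n \<le> k \<and> ?g n < a}. {x. x \<le> ?g n \<and> coh (?g n) x \<le> k})"
      proof (cases "x = a")
        case False
        then have "x < a" using x by simp
        then obtain n where n: "x \<le> ?g n" "coh a x = max (coh (?g n) x) n" using coh_step by metis
        then have "n \<le> k" "coh (?g n) x \<le> k" using x(2) by auto
        then show ?thesis using n(1) g[OF \<open>x < a\<close>] by blast
      qed simp
    qed
    then show "finite {x. x \<le> a \<and> coh a x \<le> k}"
      by (rule finite_subset) (use fin in simp)
  next
    fix b assume b: "b < a"
    then obtain m where m: "b = ?g m" using from_nat_into_surj[OF countable_lessThan_w1, of b a] by auto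
    have "{x. x \<le> b \<and> coh a x \<noteq> coh b x} \<subseteq>
      (\<Union>n\<in>{..m}. {x. x \<le> ?g n \<and> x \<le> b \<and> coh (?g n) x \<noteq> coh b x} \<union> {x. x \<le> ?g n \<and> coh (?g n) x \<le> n})"
    proof
      fix x assume "x \<in> {x. x \<le> b \<and> coh a x \<noteq> coh b x}"
      then have x: "x \<le> b" "coh a x \<noteq> coh b x" by auto
      then have "x < a" using b by simp
      then obtain n where n: "x \<le> ?g n" "\<And>m. x \<le> ?g m \<Longrightarrow> n \<le> m" "coh a x = max (coh (?g n) x) n"
        using coh_step by metis
      have "n \<le> m" using n(2) x m by simp
      moreover have "coh (?g n) x \<noteq> coh b x \<or> coh (?g n) x \<le> n" using n(3) x(2) by auto
      ultimately show "x \<in> (\<Union>n\<in>{..m}. {x. x \<le> ?g n \<and> x \<le> b \<and> coh (?g n) x \<noteq> coh b x} \<union>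
          {x. x \<le> ?g n \<and> coh (?g n) x \<le> n})"
        using n(1) x(1) by blast
    qed
    then show "finite {x. x \<le> b \<and> coh a x \<noteq> coh b x}"
      by (rule finite_subset) (use fin coherent g[OF b] b in simp)
  qed
qed

text \<open>
  The characteristic function of the graph of \<open>coh a\<close>: each block of positions contains
  a single 1.
\<close>
definition graph_char :: "w1 \<Rightarrow> pos \<Rightarrow> nat" where
  "graph_char a p = (if coh a (fst p) = snd p then 1 else 0)"

text \<open>
  A sequence of length \<open>(a, m)\<close> is compared with the graph of \<open>coh a\<close>,
  whose domain contains \<open>a\<close>, so that the incomplete last block is covered too.
\<close>
definition coh_tree :: "nat \<Rightarrow> (pos \<Rightarrow> nat option) set" where
  "coh_tree n = {f. \<exists>a m. dom f = {..<(a, m)} \<and> ran f \<subseteq> {..<n} \<and>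
     finite {p\<in>dom f. f p \<noteq> Some (graph_char a p)}}"

lemma coh_treeE:
  assumes "s \<in> coh_tree n"
  obtains a m where "dom s = {..<(a, m)}" "ran s \<subseteq> {..<n}" "finite {p\<in>dom s. s p \<noteq> Some (graph_char a p)}"
  using assms unfolding coh_tree_def by blast

lemma graph_char_coherent:
  assumes "b \<le> a" shows "finite {p. fst p \<le> b \<and> graph_char a p \<noteq> graph_char b p}"
proof -
  have "finite {x. x \<le> b \<and> coh a x \<noteq> coh b x}"
    using coh_finite[of a] assms by (cases "a = b") auto
  then have "finite (\<Union>x\<in>{x. x \<le> b \<and> coh a x \<noteq> coh b x}. {(x, coh a x), (x, coh b x)})" by simp
  then show ?thesis
    by (rule rev_finite_subset) (auto simp: graph_char_def split: if_splits)
qed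

interpretation coh_tree: pos_tree "coh_tree n" for n
proof
  fix s \<beta> assume s: "s \<in> coh_tree n" and b: "\<beta> \<in> dom s"
  obtain a m where a: "dom s = {..<(a, m)}" "ran s \<subseteq> {..<n}" "finite {p\<in>dom s. s p \<noteq> Some (graph_char a p)}"
    using s by (rule coh_treeE)
  obtain a' m' where b': "\<beta> = (a', m')" by fastforce
  have le: "a' \<le> a" using b a(1) b' by auto
  have "{..<\<beta>} \<subseteq> dom s" using b a(1) by auto
  then have d: "dom (s |` {..<\<beta>}) = {..<(a', m')}" using b' by auto
  have "{p\<in>dom (s |` {..<\<beta>}). (s |` {..<\<beta>}) p \<noteq> Some (graph_char a' p)} \<subseteq>
      {p\<in>dom s. s p \<noteq> Some (graph_char a p)} \<union> {p. fst p \<le> a' \<and> graph_char a p \<noteq> graph_char a' p}"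
    using b' by (auto simp: less_prod_def split: if_splits)
  then have "finite {p\<in>dom (s |` {..<\<beta>}). (s |` {..<\<beta>}) p \<noteq> Some (graph_char a' p)}"
    by (rule finite_subset) (use a(3) graph_char_coherent[OF le] in simp)
  moreover have "ran (s |` {..<\<beta>}) \<subseteq> {..<n}" using a(2) by (auto simp: ran_def restrict_map_def split: if_splits)
  ultimately show "s |` {..<\<beta>} \<in> coh_tree n" using d unfolding coh_tree_def by blast
qed (auto simp: coh_tree_def)

lemma coh_tree_mem: "n \<ge> 2 \<Longrightarrow> (\<lambda>p. if p < (a, m) then Some (graph_char a p) else None) \<in> coh_tree n"
  unfolding coh_tree_def
  by (auto intro!: exI[of _ a] exI[of _ m] simp: dom_def ran_def graph_char_def split: if_splits)

lemma nary_coh_tree: "nary_tree n (coh_tree n) proper_ext"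
proof (rule coh_tree.nary)
  fix s p i assume s: "s \<in> coh_tree n" and p: "p \<in> dom s" and i: "i < n"
  obtain a m where a: "dom s = {..<(a, m)}" "ran s \<subseteq> {..<n}" "finite {p\<in>dom s. s p \<noteq> Some (graph_char a p)}"
    using s by (rule coh_treeE)
  have "dom (s(p \<mapsto> i)) = {..<(a, m)}" using p a(1) by auto
  moreover have "ran (s(p \<mapsto> i)) \<subseteq> {..<n}" using a(2) i by (auto simp: ran_def)
  moreover have "finite {q\<in>dom (s(p \<mapsto> i)). (s(p \<mapsto> i)) q \<noteq> Some (graph_char a q)}"
    by (rule finite_subset[OF _ finite.insertI[OF a(3), of p]]) auto
  ultimately show "s(p \<mapsto> i) \<in> coh_tree n" unfolding coh_tree_def by blast
qed (auto simp: coh_tree_def)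

text \<open>
  A sequence of given length is determined by the finite set of its deviations from the graph.
\<close>
lemma coh_tree_level: "countable {s\<in>coh_tree n. dom s = {..<\<beta>}}"
proof -
  obtain a m where b: "\<beta> = (a, m)" by fastforce
  let ?D = "\<lambda>s. {(p, i). p \<in> dom s \<and> s p = Some i \<and> i \<noteq> graph_char a p}"
  have fin: "?D s \<in> {A. finite A \<and> A \<subseteq> {..<\<beta>} \<times> UNIV}" if s: "s \<in> {s\<in>coh_tree n. dom s = {..<\<beta>}}" for s
  proof -
    have sn: "s \<in> coh_tree n" "dom s = {..<\<beta>}" using s by simp_all
    obtain a' m' where a: "dom s = {..<(a', m')}" "finite {p\<in>dom s. s p \<noteq> Some (graph_char a' p)}"
      using sn(1) by (rule coh_treeE)
    have "(a', m') = \<beta>" using a(1) sn(2) by (metis lessThan_eq_iff)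
    then have "finite {p\<in>dom s. s p \<noteq> Some (graph_char a p)}" using a(2) b by simp
    then have "finite ((\<lambda>p. (p, the (s p))) ` {p\<in>dom s. s p \<noteq> Some (graph_char a p)})" by simp
    then have "finite (?D s)" by (rule rev_finite_subset) force
    then show ?thesis using sn(2) by auto
  qed
  have "inj_on ?D {s\<in>coh_tree n. dom s = {..<\<beta>}}"
  proof (rule inj_onI)
    fix s t assume "s \<in> {s\<in>coh_tree n. dom s = {..<\<beta>}}" "t \<in> {s\<in>coh_tree n. dom s = {..<\<beta>}}"
    then have d: "dom s = dom t" by auto
    assume eq: "?D s = ?D t"
    show "s = t"
    proof
      fix p
      show "s p = t p"
      proof (cases "p \<in> dom s")
        case True
        then obtain i j where ij: "s p = Some i" "t p = Some j" using d by blast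
        have "(p, i) \<in> ?D s \<longleftrightarrow> (p, i) \<in> ?D t" "(p, j) \<in> ?D s \<longleftrightarrow> (p, j) \<in> ?D t" using eq by auto
        then show ?thesis using ij by auto
      qed (use d in \<open>auto simp: domIff\<close>)
    qed
  qed
  moreover have "countable {A. finite A \<and> A \<subseteq> {..<\<beta>} \<times> (UNIV :: nat set)}"
    using countable_lessThan_pos by (intro countable_Collect_finite_subset) simp
  ultimately show ?thesis
    using fin countable_image_inj_on countable_subset by (metis (no_types, lifting) image_subsetI)
qed

text \<open>
  An infinite set of countable ordinals has a countable infinite subset, and that subset is bounded.
\<close>
lemma countable_if_locally_finite:
  assumes "\<And>a. finite (X \<inter> {..<a :: w1})" shows "countable X"
proof (rule ccontr)
  assume "uncountable X"
  then obtain Y where Y: "Y \<subseteq> X" "countable Y" "infinite Y"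
    by (metis infinite_countable_subset' uncountable_infinite)
  obtain b where "\<And>y. y \<in> Y \<Longrightarrow> y < b" using countable_bounded_w1[OF Y(2)] by blast
  then have "Y \<subseteq> X \<inter> {..<b}" using Y(1) by auto
  then show False using assms Y(3) finite_subset by blast
qed

text \<open>
  An uncountable chain has a union \<open>G\<close> (as a set of positions with value 1) that agrees
  with each graph \<open>coh a\<close> below \<open>(a, 0)\<close> up to finitely many positions.
  Then the ordinals whose block misses \<open>G\<close> are locally finite in number, and so are the
  ordinals \<open>x\<close> with \<open>(x, m) \<in> G\<close> for fixed \<open>m\<close>, as
  \<open>coh a\<close> is finite-to-one. This writes \<open>\<omega>\<^sub>1\<close> as a countable
  union of countable sets.
\<close>
lemma coh_tree_chain:
  assumes "pred_on.chain (coh_tree n) proper_ext C" shows "countable C"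
proof (rule ccontr)
  assume unc: "uncountable C"
  have CT: "C \<subseteq> coh_tree n" and cmp: "\<And>x y. x \<in> C \<Longrightarrow> y \<in> C \<Longrightarrow> x = y \<or> proper_ext x y \<or> proper_ext y x"
    using assms by (auto simp: pred_on.chain_def)
  have unbounded: "\<exists>f\<in>C. {..<(a, 0)} \<subseteq> dom f" for a
  proof (rule ccontr)
    assume no: "\<not> ?thesis"
    have "\<exists>\<beta>\<in>{..<(a, 0)}. dom f = {..<\<beta>}" if f: "f \<in> C" for f
    proof -
      have "f \<in> coh_tree n" using CT f by blast
      then obtain \<beta> where "dom f = {..<\<beta>}" using coh_tree.dom_lessThan by blast
      moreover have "\<beta> < (a, 0)" using no f calculation by (metis lessThan_subset_iff linorder_not_le)
      ultimately show ?thesis by auto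
    qed
    then have "dom ` C \<subseteq> lessThan ` {..<(a, 0)}" by blast
    then have "countable (dom ` C)" using countable_lessThan_pos countable_subset by (metis countable_image)
    moreover have "inj_on dom C" using cmp by (metis inj_onI order_less_irrefl proper_ext_iff)
    ultimately show False using unc countable_image_inj_on by blast
  qed
  define G where "G = {p. \<exists>f\<in>C. f p = Some 1}"
  have fin: "finite {p. p < (a, 0) \<and> (p \<in> G \<longleftrightarrow> graph_char a p \<noteq> 1)}" for a
  proof -
    obtain f where f: "f \<in> C" "{..<(a, 0)} \<subseteq> dom f" using unbounded by blast
    have "f \<in> coh_tree n" using f CT by blast
    have "f |` {..<(a, 0)} \<in> coh_tree n"
    proof (cases "dom f = {..<(a, 0)}")
      case True
      then have "f |` {..<(a, 0)} = f" by (metis domIff ext restrict_in restrict_out)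
      then show ?thesis using \<open>f \<in> coh_tree n\<close> by simp
    next
      case False
      then have "(a, 0) \<in> dom f" using f coh_tree.dom_lessThan[OF \<open>f \<in> coh_tree n\<close>]
        by (metis lessThan_iff lessThan_subset_iff order_le_less)
      then show ?thesis using coh_tree.restrict_lessThan \<open>f \<in> coh_tree n\<close> by blast
    qed
    then obtain a' m' where a: "dom (f |` {..<(a, 0)}) = {..<(a', m')}"
      "finite {p\<in>dom (f |` {..<(a, 0)}). (f |` {..<(a, 0)}) p \<noteq> Some (graph_char a' p)}"
      by (rule coh_treeE)
    have d: "dom (f |` {..<(a, 0)}) = {..<(a, 0)}" using f(2) by auto
    then have "a' = a" using a(1) by (metis Pair_inject lessThan_eq_iff)
    then have "finite {p. p < (a, 0) \<and> f p \<noteq> Some (graph_char a p)}"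
      using a(2) unfolding d by (rule_tac rev_finite_subset) auto
    moreover have "p \<in> G \<longleftrightarrow> f p = Some 1" if p: "p < (a, 0)" for p
    proof
      assume "p \<in> G"
      then obtain h where h: "h \<in> C" "h p = Some 1" by (auto simp: G_def)
      obtain v where v: "f p = Some v" using f(2) p by blast
      have "f = h \<or> f \<subseteq>\<^sub>m h \<or> h \<subseteq>\<^sub>m f" using cmp[OF f(1) h(1)] by (auto simp: proper_ext_def)
      then show "f p = Some 1" using h v by (metis domI map_le_def)
    qed (use f in \<open>auto simp: G_def\<close>)
    ultimately show ?thesis
      by (rule_tac rev_finite_subset) auto
  qed
  have "countable {x. \<forall>m. (x, m) \<notin> G}"
  proof (rule countable_if_locally_finite)
    fix a
    have "finite (fst ` {p. p < (a, 0) \<and> (p \<in> G \<longleftrightarrow> graph_char a p \<noteq> 1)})" using fin by simp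
    then show "finite ({x. \<forall>m. (x, m) \<notin> G} \<inter> {..<a})"
    proof (rule rev_finite_subset, intro subsetI)
      fix x assume x: "x \<in> {x. \<forall>m. (x, m) \<notin> G} \<inter> {..<a}"
      show "x \<in> fst ` {p. p < (a, 0) \<and> (p \<in> G \<longleftrightarrow> graph_char a p \<noteq> 1)}"
        by (rule image_eqI[of _ _ "(x, coh a x)"]) (use x in \<open>auto simp: graph_char_def\<close>)
    qed
  qed
  moreover have "countable {x. (x, m) \<in> G}" for m
  proof (rule countable_if_locally_finite)
    fix a
    have "finite (fst ` {p. p < (a, 0) \<and> (p \<in> G \<longleftrightarrow> graph_char a p \<noteq> 1)} \<union> {x. x \<le> a \<and> coh a x \<le> m})"
      using fin coh_finite by simp
    then show "finite ({x. (x, m) \<in> G} \<inter> {..<a})"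
    proof (rule rev_finite_subset, intro subsetI)
      fix x assume x: "x \<in> {x. (x, m) \<in> G} \<inter> {..<a}"
      show "x \<in> fst ` {p. p < (a, 0) \<and> (p \<in> G \<longleftrightarrow> graph_char a p \<noteq> 1)} \<union> {x. x \<le> a \<and> coh a x \<le> m}"
      proof (cases "coh a x = m")
        case False
        then have "x \<in> fst ` {p. p < (a, 0) \<and> (p \<in> G \<longleftrightarrow> graph_char a p \<noteq> 1)}"
          by (intro image_eqI[of _ _ "(x, m)"]) (use x in \<open>auto simp: graph_char_def\<close>)
        then show ?thesis by simp
      qed (use x in auto)
    qed
  qed
  ultimately have "countable ({x. \<forall>m. (x, m) \<notin> G} \<union> (\<Union>m. {x. (x, m) \<in> G}))" by simp
  moreover have "{x. \<forall>m. (x, m) \<notin> G} \<union> (\<Union>m. {x. (x, m) \<in> G}) = UNIV" by auto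
  ultimately show False using uncountable_w1 by simp
qed

theorem coh_tree_aronszajn:
  assumes "n \<ge> 2"
  shows "regular_tree (coh_tree n) proper_ext" "nary_tree n (coh_tree n) proper_ext"
    "aronszajn_tree (coh_tree n) proper_ext"
proof -
  show "nary_tree n (coh_tree n) proper_ext" by (rule nary_coh_tree)
  show "regular_tree (coh_tree n) proper_ext" using coh_tree_mem[OF assms] by (intro coh_tree.regular) blast
  have "uncountable (coh_tree n)"
  proof
    let ?s = "\<lambda>a p. if p < (a, 0) then Some (graph_char a p) else None"
    assume "countable (coh_tree n)"
    moreover have "range ?s \<subseteq> coh_tree n" using coh_tree_mem[OF assms] by auto
    ultimately have "countable (range ?s)" by (rule countable_subset[rotated])
    moreover have "inj ?s"
    proof (rule injI)
      fix a b assume "?s a = ?s b"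
      then have "dom (?s a) = dom (?s b)" by simp
      moreover have "dom (?s c) = {..<(c, 0)}" for c by (auto split: if_splits)
      ultimately have "{..<(a, 0::nat)} = {..<(b, 0)}" by simp
      then show "a = b" by (metis Pair_inject lessThan_eq_iff)
    qed
    ultimately show False using uncountable_w1 countable_image_inj_on by blast
  qed
  then have "omega1_tree (coh_tree n) proper_ext" using coh_tree.omega1_treeI coh_tree_level by blast
  then show "aronszajn_tree (coh_tree n) proper_ext"
    unfolding aronszajn_tree_def using coh_tree_chain pred_on.maxchain_imp_chain by metis
qed

section \<open>Isomorphic copies\<close>

text \<open>
  The trees of sequences are built on the type \<^typ>\<open>pos \<Rightarrow> nat option\<close>
  and then carried over to an arbitrary uncountable type.
\<close>
locale tree_iso =
  fixes T :: "'a set" and lt :: "'a \<Rightarrow> 'a \<Rightarrow> bool" and g :: "'a \<Rightarrow> 'b" and T2 lt2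
  assumes tree: "is_tree T lt" and bij: "bij_betw g T T2"
    and iso: "\<And>x y. x \<in> T \<Longrightarrow> y \<in> T \<Longrightarrow> lt2 (g x) (g y) \<longleftrightarrow> lt x y"
begin

lemma image: "T2 = g ` T"
  using bij by (simp add: bij_betw_def)

lemma g_eq: "x \<in> T \<Longrightarrow> y \<in> T \<Longrightarrow> g x = g y \<longleftrightarrow> x = y"
  using bij by (auto simp: bij_betw_def inj_on_def)

lemma preds_image: "t \<in> T \<Longrightarrow> preds T2 lt2 (g t) = g ` preds T lt t"
  using iso by (auto simp: preds_def image)

lemma image_eq_iff: "A \<subseteq> T \<Longrightarrow> B \<subseteq> T \<Longrightarrow> g ` A = g ` B \<longleftrightarrow> A = B"
  using bij by (meson bij_betw_imp_inj_on inj_on_image_eq_iff)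

lemma is_tree2: "is_tree T2 lt2"
  unfolding is_tree_iff
proof (intro conjI ballI)
  show "irreflp_on T2 lt2" using tree_irrefl[OF tree] iso by (auto simp: irreflp_on_def image)
  show "transp_on T2 lt2" using tree_trans[OF tree] iso unfolding transp_on_def image by blast
  have "wf {(x, y). x \<in> T \<and> y \<in> T \<and> lt x y}" using tree by (simp add: is_tree_iff)
  then have "wf (inv_image {(x, y). x \<in> T \<and> y \<in> T \<and> lt x y} (inv_into T g))" by (rule wf_inv_image)
  moreover have "inv_into T g (g x) = x" if "x \<in> T" for x
    using that bij by (simp add: bij_betw_def inv_into_f_f)
  ultimately show "wf {(x, y). x \<in> T2 \<and> y \<in> T2 \<and> lt2 x y}"
    by (elim wf_subset) (auto simp: image iso)
next
  fix t x y assume t: "t \<in> T2" and "x \<in> preds T2 lt2 t" "y \<in> preds T2 lt2 t"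
  then obtain t' x' y' where "t' \<in> T" "x' \<in> T" "y' \<in> T" "t = g t'" "x = g x'" "y = g y'"
    "lt x' t'" "lt y' t'" by (auto simp: image iso)
  then show "x = y \<or> lt2 x y \<or> lt2 y x" using tree_linear[OF tree, of x' t' y'] iso by auto
qed

lemma height_iso:
  assumes "t \<in> T" shows "height_at T2 lt2 (g t) =o height_at T lt t"
proof -
  have "BNF_Wellorder_Embedding.iso (height_at T lt t) (height_at T2 lt2 (g t)) g"
    unfolding iso_iff2 Field_height_at preds_image[OF assms]
  proof (intro conjI ballI)
    show "bij_betw g (preds T lt t) (g ` preds T lt t)"
      using bij by (auto simp: bij_betw_def preds_def intro: inj_on_subset)
    fix a b assume "a \<in> preds T lt t" "b \<in> preds T lt t"
    then show "(a, b) \<in> height_at T lt t \<longleftrightarrow> (g a, g b) \<in> height_at T2 lt2 (g t)"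
      using assms iso g_eq by (auto simp: height_at_def image)
  qed
  then have "height_at T lt t =o height_at T2 lt2 (g t)"
    using Well_order_height_at[OF tree assms] Well_order_height_at[OF is_tree2] assms
    unfolding ordIso_def by (auto simp: image)
  then show ?thesis by (rule ordIso_symmetric)
qed

lemma level_image: "level T2 lt2 \<alpha> = g ` level T lt \<alpha>"
proof -
  have "height_at T2 lt2 (g t) =o \<alpha> \<longleftrightarrow> height_at T lt t =o \<alpha>" if "t \<in> T" for t
    using height_iso[OF that] ordIso_transitive ordIso_symmetric by metis
  then show ?thesis by (auto simp: level_def image)
qed

lemma has_max_image: "A \<subseteq> T \<Longrightarrow> has_max lt2 (g ` A) \<longleftrightarrow> has_max lt A"
  unfolding has_max_def bex_simps(7) ball_simps(9) by (metis g_eq iso subsetD)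

lemma node_image: "t \<in> T \<Longrightarrow> node T2 lt2 (g t) = g ` node T lt t"
proof -
  assume t: "t \<in> T"
  have "preds T2 lt2 (g s) = preds T2 lt2 (g t) \<longleftrightarrow> preds T lt s = preds T lt t" if "s \<in> T" for s
    unfolding preds_image[OF that] preds_image[OF t] by (rule image_eq_iff) (auto simp: preds_def)
  then show ?thesis by (auto simp: node_def image)
qed

lemma card_node_image: "t \<in> T \<Longrightarrow> card (node T2 lt2 (g t)) = card (node T lt t)"
  unfolding node_image using bij
  by (intro card_image) (auto simp: bij_betw_def node_def intro: inj_on_subset)

lemma has_max_preds_image: "t \<in> T \<Longrightarrow> has_max lt2 (preds T2 lt2 (g t)) \<longleftrightarrow> has_max lt (preds T lt t)"
  unfolding preds_image by (rule has_max_image) (auto simp: preds_def)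

lemma nary2: "nary_tree n T lt \<Longrightarrow> nary_tree n T2 lt2"
  using is_tree2 by (auto simp: nary_tree_iff image card_node_image[unfolded image]
    has_max_preds_image[unfolded image])

lemma regular2: assumes "regular_tree T lt" shows "regular_tree T2 lt2"
  unfolding regular_tree_iff
proof (intro conjI ballI impI is_tree2)
  obtain r where "r \<in> T" "\<And>t. t \<in> T \<Longrightarrow> t \<noteq> r \<Longrightarrow> lt r t"
    using assms by (auto simp: regular_tree_iff)
  then show "\<exists>r\<in>T2. \<forall>t\<in>T2. t \<noteq> r \<longrightarrow> lt2 r t"
    unfolding image by (intro bexI[of _ "g r"]) (auto simp: iso)
next
  fix t assume "t \<in> T2" and t: "preds T2 lt2 t \<noteq> {} \<and> \<not> has_max lt2 (preds T2 lt2 t)"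
  then obtain u where u: "u \<in> T" "t = g u" by (auto simp: image)
  then have "node T lt u = {u}"
    using t assms has_max_preds_image[OF u(1)] preds_image[OF u(1)] by (simp add: regular_tree_iff)
  then show "node T2 lt2 t = {t}" using node_image[OF u(1)] u by simp
qed

lemma countable_image_iff: "A \<subseteq> T \<Longrightarrow> countable (g ` A) \<longleftrightarrow> countable A"
  using bij by (meson bij_betw_def countable_image countable_image_inj_on inj_on_subset)

lemma omega1_tree2: "omega1_tree T lt \<Longrightarrow> omega1_tree T2 lt2"
  using is_tree2 by (auto simp: omega1_tree_iff level_image)
    (auto simp: image preds_image[unfolded image] countable_image_iff)

lemma chain_preimage:
  assumes "pred_on.chain T2 lt2 C"
  obtains D where "pred_on.chain T lt D" "C = g ` D"
proof -
  have "C \<subseteq> g ` T" using assms by (auto simp: pred_on.chain_def image)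
  then obtain D where D: "D \<subseteq> T" "C = g ` D" by (meson subset_imageE)
  have "x = y \<or> lt x y \<or> lt y x" if "x \<in> D" "y \<in> D" for x y
  proof -
    have "x \<in> T" "y \<in> T" using that D by auto
    moreover have "g x = g y \<or> lt2 (g x) (g y) \<or> lt2 (g y) (g x)"
    proof -
      have "\<forall>x\<in>C. \<forall>y\<in>C. x = y \<or> lt2 x y \<or> lt2 y x" using assms by (auto simp: pred_on.chain_def)
      moreover have "g x \<in> C" "g y \<in> C" using that D(2) by auto
      ultimately show ?thesis by blast
    qed
    ultimately show ?thesis using iso g_eq by auto
  qed
  then have "pred_on.chain T lt D" using D by (auto simp: pred_on.chain_def)
  then show thesis using that D(2) by blast
qed

lemma chain_image: "pred_on.chain T lt D \<Longrightarrow> pred_on.chain T2 lt2 (g ` D)"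
  by (fastforce simp: pred_on.chain_def image iso subset_iff)

lemma branch_image:
  assumes "branch T lt B" shows "branch T2 lt2 (g ` B)"
proof -
  have B: "pred_on.chain T lt B" "B \<subseteq> T" using assms by (auto simp: pred_on.maxchain_def pred_on.chain_def)
  have "\<not> g ` B \<subset> S" if S: "pred_on.chain T2 lt2 S" for S
  proof
    assume psub: "g ` B \<subset> S"
    obtain D where D: "pred_on.chain T lt D" "S = g ` D" using chain_preimage[OF S] by blast
    then have DT: "D \<subseteq> T" by (auto simp: pred_on.chain_def)
    have "x \<in> D" if x: "x \<in> B" for x
    proof -
      have "g x \<in> g ` D" using psub D(2) x by auto
      then obtain y where "y \<in> D" "g x = g y" by auto
      then show ?thesis using g_eq[of x y] x B(2) DT by auto
    qed
    then have "B \<subset> D" using psub D(2) by auto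
    then show False using assms D(1) by (auto simp: pred_on.maxchain_def)
  qed
  then show ?thesis using chain_image[OF B(1)] by (auto simp: pred_on.maxchain_def)
qed

lemma antichain_preimage:
  assumes "antichain T2 lt2 A"
  obtains D where "antichain T lt D" "A = g ` D"
proof -
  have "A \<subseteq> g ` T" using assms by (auto simp: antichain_def image)
  then obtain D where D: "D \<subseteq> T" "A = g ` D" by (meson subset_imageE)
  have "\<not> lt x y" if "x \<in> D" "y \<in> D" "x \<noteq> y" for x y
  proof -
    have "x \<in> T" "y \<in> T" using that D by auto
    moreover have "g x \<noteq> g y \<longrightarrow> \<not> lt2 (g x) (g y)"
      using assms that D(2) by (auto simp: antichain_def)
    ultimately show ?thesis using iso g_eq that by auto
  qed
  then have "antichain T lt D" using D by (auto simp: antichain_def)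
  then show thesis using that D(2) by blast
qed

lemma countable_branches2:
  assumes "omega1_tree T lt" "\<forall>B. branch T lt B \<longrightarrow> countable B"
  shows "\<forall>B. branch T2 lt2 B \<longrightarrow> countable B"
proof -
  have "\<forall>C. pred_on.chain T lt C \<longrightarrow> countable C"
    using countable_branches_iff[OF tree] assms by (simp add: omega1_tree_iff)
  then show ?thesis by (metis chain_preimage countable_image pred_on.maxchain_imp_chain)
qed

lemma aronszajn2: "aronszajn_tree T lt \<Longrightarrow> aronszajn_tree T2 lt2"
  using omega1_tree2 countable_branches2 by (simp add: aronszajn_tree_def)

lemma suslin2: assumes "suslin_tree T lt" shows "suslin_tree T2 lt2"
proof -
  have "omega1_tree T lt" using assms by (simp add: suslin_tree_iff)
  then have "omega1_tree T2 lt2" "\<forall>C. pred_on.chain T2 lt2 C \<longrightarrow> countable C"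
    using omega1_tree2 assms by (auto simp: suslin_tree_iff elim!: chain_preimage)
  moreover have "\<forall>A. antichain T2 lt2 A \<longrightarrow> countable A"
    using assms by (auto simp: suslin_tree_def elim!: antichain_preimage)
  ultimately show ?thesis by (simp add: suslin_tree_iff)
qed

lemma uncountable_branches_ordLeq:
  "|{B. branch T lt B \<and> uncountable B}| \<le>o |{B. branch T2 lt2 B \<and> uncountable B}|"
proof (rule card_of_ordLeqI[of "(`) g"])
  have sub: "B \<subseteq> T" if "branch T lt B" for B
    using that by (auto simp: pred_on.maxchain_def pred_on.chain_def)
  show "inj_on ((`) g) {B. branch T lt B \<and> uncountable B}"
    by (rule inj_onI) (use sub image_eq_iff in auto)
  show "\<And>B. B \<in> {B. branch T lt B \<and> uncountable B} \<Longrightarrow> g ` B \<in> {B. branch T2 lt2 B \<and> uncountable B}"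
    using sub countable_image_iff branch_image by auto
qed

lemma kurepa2: "kurepa_tree T lt \<Longrightarrow> kurepa_tree T2 lt2"
  unfolding kurepa_tree_def using omega1_tree2 uncountable_branches_ordLeq ordLeq_transitive by blast

end

lemma omega1_tree_card:
  assumes "omega1_tree T lt" shows "|T| \<le>o omega1"
proof -
  have tree: "is_tree T lt" and lev: "\<And>a. countable (level T lt (ord_w1 a))"
    and pc: "\<forall>t\<in>T. countable (preds T lt t)" using assms by (auto simp: omega1_tree_iff)
  have inf: "infinite (Field omega1)"
    using ordLess_omega1_iff[OF Well_order_omega1] ordLess_irreflexive uncountable_infinite by metis
  have "|UNIV :: w1 set| \<le>o |Field omega1|"
    by (rule card_of_ordLeqI[of Rep_w1]) (auto simp: Rep_w1_inject Rep_w1 intro: injI)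
  then have I: "|UNIV :: w1 set| \<le>o omega1"
    using card_of_Field_ordIso[OF Card_order_omega1] ordLeq_ordIso_trans by blast
  have "|level T lt (ord_w1 a)| \<le>o omega1" for a
    using lev[of a] countable_card_le_natLeq cardSuc_ordLeq[OF natLeq_Card_order] ordLeq_transitive by blast
  then have "|\<Union>a. level T lt (ord_w1 a)| \<le>o omega1"
    by (intro card_of_UNION_ordLeq_infinite_Field[OF inf Card_order_omega1 I] ballI)
  moreover have "T \<subseteq> (\<Union>a. level T lt (ord_w1 a))"
    using countable_preds_iff[OF tree] pc by (auto simp: level_def)
  ultimately show ?thesis using card_of_mono1 ordLeq_transitive by blast
qed

text \<open>
  A tree of height \<open>\<omega>\<^sub>1\<close> with countable levels has at most
  \<open>\<omega>\<^sub>1\<close> elements, and \<open>\<omega>\<^sub>1\<close> is the least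
  uncountable cardinal.
\<close>
lemma omega1_tree_copy:
  assumes "omega1_tree T lt" and unc: "uncountable (UNIV :: 'u set)"
  obtains g :: "'a \<Rightarrow> 'u" and T2 lt2 where "tree_iso T lt g T2 lt2"
proof -
  have "\<not> |UNIV :: 'u set| \<le>o natLeq" using unc countable_card_le_natLeq by blast
  then have "natLeq <o |UNIV :: 'u set|"
    using ordLess_or_ordLeq[OF natLeq_Well_order card_of_Well_order] by blast
  then have "omega1 \<le>o |UNIV :: 'u set|"
    using cardSuc_least[OF natLeq_Card_order card_of_Card_order] by blast
  then have "|T| \<le>o |UNIV :: 'u set|" using omega1_tree_card[OF assms(1)] ordLeq_transitive by blast
  then obtain g :: "'a \<Rightarrow> 'u" where g: "inj_on g T" unfolding card_of_ordLeq[symmetric] by auto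
  have "tree_iso T lt g (g ` T) (\<lambda>x y. lt (inv_into T g x) (inv_into T g y))"
    using assms(1) g by unfold_locales (auto simp: omega1_tree_def inj_on_imp_bij_betw inv_into_f_f)
  then show thesis using that by blast
qed

section \<open>Coding trees by 0-1-sequences\<close>

lemma lessThan_Suc_pos: "{..<(a, Suc m)} = insert (a, m) {..<(a :: w1, m)}"
  by (auto simp: less_Suc_eq)

text \<open>
  What the coding needs of a tree of height \<open>\<omega>\<^sub>1\<close> with countable levels:
  its ranks \<open>\<rho>\<close>, which are unique, and a choice of a numbering \<open>k\<close> of
  each level.
\<close>
locale ranked_tree =
  fixes S :: "'a set" and lt :: "'a \<Rightarrow> 'a \<Rightarrow> bool" and \<rho> :: "'a \<Rightarrow> w1" and k :: "'a \<Rightarrow> nat"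
  assumes tree: "is_tree S lt"
    and rank_less: "\<And>x y. x \<in> S \<Longrightarrow> y \<in> S \<Longrightarrow> lt x y \<Longrightarrow> \<rho> x < \<rho> y"
    and rank_attained: "\<And>y a. y \<in> S \<Longrightarrow> a < \<rho> y \<Longrightarrow> \<exists>x\<in>S. lt x y \<and> \<rho> x = a"
    and countable_rank: "\<And>a. countable {y\<in>S. \<rho> y = a}"
    and uncountable_tree: "uncountable S"
    and k_inj: "\<And>x y. x \<in> S \<Longrightarrow> y \<in> S \<Longrightarrow> \<rho> x = \<rho> y \<Longrightarrow> k x = k y \<Longrightarrow> x = y"
begin

definition le :: "'a \<Rightarrow> 'a \<Rightarrow> bool" where
  "le x y \<longleftrightarrow> x = y \<or> lt x y"

text \<open>
  The single 1 in the block of an ordinal up to the rank of \<open>y\<close> marks the number of an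
  element of that rank. Blocks beyond the rank of \<open>y\<close> are zero; the sequences
  \<open>seq y m\<close> are cut off before the end of the block of \<open>y\<close>.
\<close>
definition code :: "'a \<Rightarrow> pos \<Rightarrow> nat" where
  "code y p = (if \<exists>x\<in>S. le x y \<and> \<rho> x = fst p \<and> k x = snd p then 1 else 0)"

text \<open>
  All \<open>seq y m\<close> are needed for closure under initial segments. For growing
  \<open>m\<close>, more and more of the number of \<open>y\<close> itself becomes visible.
\<close>
definition seq :: "'a \<Rightarrow> nat \<Rightarrow> pos \<Rightarrow> nat option" where
  "seq y m p = (if p < (\<rho> y, m) then Some (code y p) else None)"

definition seqs :: "(pos \<Rightarrow> nat option) set" where
  "seqs = {seq y m | y m. y \<in> S}"

lemma le_rank: "x \<in> S \<Longrightarrow> y \<in> S \<Longrightarrow> le x y \<Longrightarrow> \<rho> x \<le> \<rho> y"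
  using rank_less by (auto simp: le_def intro: less_imp_le)

lemma le_trans: "le x y \<Longrightarrow> le y z \<Longrightarrow> x \<in> S \<Longrightarrow> y \<in> S \<Longrightarrow> z \<in> S \<Longrightarrow> le x z"
  unfolding le_def using tree_trans[OF tree] by blast

lemma le_linear: "le x z \<Longrightarrow> le y z \<Longrightarrow> x \<in> S \<Longrightarrow> y \<in> S \<Longrightarrow> z \<in> S \<Longrightarrow> le x y \<or> lt y x"
  unfolding le_def using tree_linear[OF tree, of x z y] by blast

lemma below:
  assumes "y \<in> S" "a \<le> \<rho> y" obtains x where "x \<in> S" "le x y" "\<rho> x = a"
  using assms rank_attained[OF assms(1), of a] unfolding le_def by (metis order_le_less)

lemma dom_seq [simp]: "dom (seq y m) = {..<(\<rho> y, m)}"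
  by (auto simp: seq_def split: if_splits)

lemma ran_seq: "ran (seq y m) \<subseteq> {0, 1}"
proof
  fix v assume "v \<in> ran (seq y m)"
  then obtain p where "seq y m p = Some v" by (auto simp: ran_def)
  then have "v = code y p" by (simp add: seq_def split: if_splits)
  then show "v \<in> {0, 1}" by (simp add: code_def)
qed

lemma seq_mem: "y \<in> S \<Longrightarrow> seq y m \<in> seqs"
  by (auto simp: seqs_def)

lemma code_eq:
  assumes "x \<in> S" "y \<in> S" "le x y" "fst p \<le> \<rho> x" shows "code y p = code x p"
proof -
  have "le w y \<longleftrightarrow> le w x" if w: "w \<in> S" "\<rho> w = fst p" for w
  proof
    assume "le w y"
    then have "le w x \<or> lt x w" using le_linear w assms by blast
    then show "le w x" using rank_less[of x w] w assms by auto
  next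
    assume "le w x" then show "le w y" using le_trans w assms by blast
  qed
  then show ?thesis unfolding code_def by metis
qed

text \<open>
  Up to the rank of \<open>x\<close>, the elements below \<open>x\<close> and those below
  \<open>y\<close> are the same. Since \<open>x\<close> can be chosen at any smaller rank, initial
  segments of codes are codes.
\<close>
lemma seq_restrict:
  assumes "x \<in> S" "y \<in> S" "le x y" "(\<rho> x, j) \<le> (\<rho> y, m)"
  shows "seq y m |` {..<(\<rho> x, j)} = seq x j"
proof
  fix p
  have "p < (\<rho> y, m)" if "p < (\<rho> x, j)" using that assms(4) by (rule less_le_trans)
  moreover have "fst p \<le> \<rho> x" if "p < (\<rho> x, j)" using that by (auto simp: less_prod_def intro: less_imp_le)
  ultimately show "(seq y m |` {..<(\<rho> x, j)}) p = seq x j p"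
    using code_eq[OF assms(1-3)] by (auto simp: seq_def restrict_map_def)
qed

lemma seq_le:
  assumes "x \<in> S" "y \<in> S" "le x y" "(\<rho> x, j) < (\<rho> y, m)" shows "proper_ext (seq x j) (seq y m)"
proof -
  have "{..<(\<rho> x, j)} \<subset> {..<(\<rho> y, m)}" using assms(4) by (simp only: lessThan_strict_subset_iff)
  then show ?thesis
    unfolding proper_ext_iff dom_seq seq_restrict[OF assms(1-3) less_imp_le[OF assms(4)]] by simp
qed

lemma seq_less: "x \<in> S \<Longrightarrow> y \<in> S \<Longrightarrow> lt x y \<Longrightarrow> proper_ext (seq x j) (seq y m)"
  using seq_le[of x y j m] rank_less[of x y] by (simp add: le_def)

text \<open>
  Decoding: a predecessor \<open>w\<close> of \<open>x\<close> shows as a 1 at \<open>(\<rho> w, k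
  w)\<close>, and injectivity of \<open>k\<close> on levels recovers \<open>w\<close> from this
  position. The element \<open>x\<close> itself need not be visible in \<open>seq x j\<close>.
\<close>
lemma seq_preds:
  assumes "x \<in> S" "y \<in> S" "seq x j \<subseteq>\<^sub>m seq y m" shows "preds S lt x \<subseteq> preds S lt y"
proof
  fix w assume "w \<in> preds S lt x"
  then have w: "w \<in> S" "lt w x" by auto
  let ?p = "(\<rho> w, k w)"
  have lx: "\<rho> w < \<rho> x" using rank_less w assms by blast
  have "{..<(\<rho> x, j)} \<subseteq> {..<(\<rho> y, m)}" using map_le_implies_dom_le[OF assms(3)] by simp
  then have "\<rho> x \<le> \<rho> y" by (auto simp: less_imp_le)
  have "code x ?p = 1" using w by (auto simp: code_def le_def)
  moreover have "seq x j ?p = seq y m ?p" using assms(3) lx by (auto simp: map_le_def)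
  moreover have "\<rho> w < \<rho> y" using lx \<open>\<rho> x \<le> \<rho> y\<close> by simp
  ultimately have "code y ?p = 1" using lx by (simp add: seq_def)
  then obtain v where "v \<in> S" "le v y" "\<rho> v = \<rho> w" "k v = k w" by (auto simp: code_def split: if_splits)
  then have "le w y" using k_inj w by metis
  moreover have "w \<noteq> y" using lx \<open>\<rho> x \<le> \<rho> y\<close> by auto
  ultimately show "w \<in> preds S lt y" using w by (simp add: le_def)
qed

lemma uncountable_rank: "uncountable (\<rho> ` S)"
proof
  assume "countable (\<rho> ` S)"
  then have "countable (\<Union>a\<in>\<rho> ` S. {y\<in>S. \<rho> y = a})" using countable_rank by blast
  moreover have "S \<subseteq> (\<Union>a\<in>\<rho> ` S. {y\<in>S. \<rho> y = a})" by auto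
  ultimately show False using uncountable_tree countable_subset by blast
qed

lemma uncountable_seqs: "uncountable seqs"
proof
  assume "countable seqs"
  then have "countable (dom ` seqs)" by simp
  moreover have "(\<lambda>a. {..<(a, 0::nat)}) ` \<rho> ` S \<subseteq> dom ` seqs"
    using seq_mem by (force simp flip: dom_seq)
  ultimately have "countable ((\<lambda>a. {..<(a, 0::nat)}) ` \<rho> ` S)" by (rule countable_subset[rotated])
  moreover have "inj_on (\<lambda>a. {..<(a, 0::nat)}) (\<rho> ` S)"
    by (rule inj_onI) (metis Pair_inject lessThan_eq_iff)
  ultimately show False using uncountable_rank countable_image_inj_on by blast
qed

sublocale seqs: pos_tree seqs
proof
  fix s \<beta> assume "s \<in> seqs" "\<beta> \<in> dom s"
  then obtain y m where y: "y \<in> S" "s = seq y m" by (auto simp: seqs_def)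
  then have b': "\<beta> < (\<rho> y, m)" using \<open>\<beta> \<in> dom s\<close> by simp
  obtain a j where b: "\<beta> = (a, j)" by fastforce
  then have "a \<le> \<rho> y" using b' by auto
  then obtain x where "x \<in> S" "le x y" "\<rho> x = a" using below y by blast
  then have "s |` {..<\<beta>} = seq x j"
    using seq_restrict[of x y j m] y(1) unfolding y(2) b
    using less_imp_le[OF b'] b by simp
  then show "s |` {..<\<beta>} \<in> seqs" using seq_mem \<open>x \<in> S\<close> by simp
next
  show "\<And>s. s \<in> seqs \<Longrightarrow> \<exists>\<beta>. dom s = {..<\<beta>}" by (auto simp: seqs_def)
qed

section \<open>Regular Kurepa trees\<close>

text \<open>
  The codes with all their one-step extensions. An extension that is no code itself is maximal.
\<close>
definition leafy :: "nat \<Rightarrow> (pos \<Rightarrow> nat option) set" where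
  "leafy n = seqs \<union> {(seq y m)((\<rho> y, m) \<mapsto> i) | y m i. y \<in> S \<and> i < n}"

lemma leafy_cases:
  assumes "s \<in> leafy n"
  obtains y m where "y \<in> S" "s = seq y m" "dom s = {..<(\<rho> y, m)}"
  | y m i where "y \<in> S" "i < n" "s = (seq y m)((\<rho> y, m) \<mapsto> i)" "dom s = {..<(\<rho> y, Suc m)}"
  using assms unfolding leafy_def seqs_def by (auto simp: lessThan_Suc_pos)

sublocale leafy: pos_tree "leafy n" for n
proof
  fix s \<beta> assume s: "s \<in> leafy n" and b: "\<beta> \<in> dom s"
  from s show "s |` {..<\<beta>} \<in> leafy n"
  proof (cases rule: leafy_cases)
    case (1 y m)
    then have "s |` {..<\<beta>} \<in> seqs" using seqs.restrict_lessThan[OF seq_mem, of y \<beta> m] b by simp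
    then show ?thesis by (simp add: leafy_def)
  next
    case (2 y m i)
    then have le: "\<beta> \<le> (\<rho> y, m)" using b by (cases \<beta>) (auto simp: less_Suc_eq_le)
    then have eq: "s |` {..<\<beta>} = seq y m |` {..<\<beta>}" using 2 by (auto simp: restrict_map_def fun_eq_iff)
    have "seq y m |` {..<\<beta>} \<in> seqs"
    proof (cases "\<beta> = (\<rho> y, m)")
      case True
      then have "seq y m |` {..<\<beta>} = seq y m" by (auto simp: restrict_map_def fun_eq_iff seq_def)
      then show ?thesis using seq_mem 2 by simp
    next
      case False
      then have "\<beta> \<in> dom (seq y m)" using le by simp
      then show ?thesis using seqs.restrict_lessThan[OF seq_mem[OF 2(1)]] by blast
    qed
    then show ?thesis using eq by (simp add: leafy_def)
  qed
next
  show "\<And>s. s \<in> leafy n \<Longrightarrow> \<exists>\<beta>. dom s = {..<\<beta>}" by (erule leafy_cases) blast+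
qed

lemma leafy_omega1_tree: "omega1_tree (leafy n) proper_ext"
proof (rule leafy.omega1_treeI)
  show "uncountable (leafy n)" using uncountable_seqs by (simp add: leafy_def)
  fix \<beta> :: pos
  let ?Y = "{y\<in>S. \<rho> y = fst \<beta>}"
  have "s \<in> (\<lambda>(y, m). seq y m) ` (?Y \<times> UNIV) \<union> (\<lambda>(y, m, i). (seq y m)((\<rho> y, m) \<mapsto> i)) ` (?Y \<times> UNIV)"
    if s: "s \<in> leafy n" "dom s = {..<\<beta>}" for s
    using s(1)
  proof (cases rule: leafy_cases)
    case (1 y m)
    then have "\<beta> = (\<rho> y, m)" using s(2) by (metis lessThan_eq_iff)
    then show ?thesis using 1 by force
  next
    case (2 y m i)
    then have "\<beta> = (\<rho> y, Suc m)" using s(2) by (metis lessThan_eq_iff)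
    then show ?thesis using 2 by (intro UnI2 image_eqI[of _ _ "(y, m, i)"]) auto
  qed
  then have "{s\<in>leafy n. dom s = {..<\<beta>}} \<subseteq>
    (\<lambda>(y, m). seq y m) ` (?Y \<times> UNIV) \<union> (\<lambda>(y, m, i). (seq y m)((\<rho> y, m) \<mapsto> i)) ` (?Y \<times> UNIV)" by blast
  moreover have "countable ((\<lambda>(y, m). seq y m) ` (?Y \<times> UNIV) \<union> (\<lambda>(y, m, i). (seq y m)((\<rho> y, m) \<mapsto> i)) ` (?Y \<times> UNIV))"
    using countable_rank by (intro countable_Un countable_image countable_SIGMA) auto
  ultimately show "countable {s\<in>leafy n. dom s = {..<\<beta>}}" by (rule countable_subset)
qed

lemma leafy_regular: "regular_tree (leafy n) proper_ext"
  using uncountable_seqs by (intro leafy.regular) (auto simp: leafy_def)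

text \<open>
  Every last entry may be changed: a sequence with a last position is a one-step extension of the
  code that remains when this entry is deleted.
\<close>
lemma leafy_nary:
  assumes "n \<ge> 2" shows "nary_tree n (leafy n) proper_ext"
proof (rule leafy.nary)
  fix s assume s: "s \<in> leafy n"
  have upd: "ran (f(p \<mapsto> i)) \<subseteq> insert i (ran f)" for f :: "pos \<Rightarrow> nat option" and p i
    by (auto simp: ran_def)
  from s show "ran s \<subseteq> {..<n}"
  proof (cases rule: leafy_cases)
    case (1 y m)
    have "{0, 1} \<subseteq> {..<n}" using assms by auto
    then show ?thesis using ran_seq[of y m] 1(2) by (simp only: order_trans)
  next
    case (2 y m i)
    have "insert i {0, 1} \<subseteq> {..<n}" using assms 2(2) by auto
    moreover have "ran ((seq y m)((\<rho> y, m) \<mapsto> i)) \<subseteq> insert i {0, 1}"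
      using upd[of "seq y m" "(\<rho> y, m)" i] ran_seq[of y m] by blast
    ultimately show ?thesis unfolding 2(3) by (rule order_trans[rotated])
  qed
next
  fix s p i assume s: "s \<in> leafy n" and p: "p \<in> dom s" "dom s = insert p (underS {(x, y). x \<le> y} p)" and i: "i < n"
  obtain a j where a: "p = (a, j)" by fastforce
  have "dom s = {..<(a, Suc j)}" using p(2) a by (simp add: lessThan_Suc_pos leafy.underS_le)
  have aj: "(\<rho> y, m) = (a, Suc j)" if "dom s = {..<(\<rho> y, m)}" for y m
    using that \<open>dom s = {..<(a, Suc j)}\<close> by (metis lessThan_eq_iff)
  from s show "s(p \<mapsto> i) \<in> leafy n"
  proof (cases rule: leafy_cases)
    case (1 y m)
    then have y: "\<rho> y = a" "m = Suc j" using aj by auto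
    have "s(p \<mapsto> i) = (seq y j)((\<rho> y, j) \<mapsto> i)"
      using 1 y a by (auto simp: fun_eq_iff seq_def less_Suc_eq)
    then show ?thesis using 1 i by (auto simp: leafy_def)
  next
    case (2 y m i')
    then have y: "\<rho> y = a" "m = j" using aj by auto
    then have "s(p \<mapsto> i) = (seq y m)((\<rho> y, m) \<mapsto> i)" using 2 a by simp
    then show ?thesis using 2 i by (auto simp: leafy_def)
  qed
qed

text \<open>
  The codes of the elements of an uncountable branch are closed under initial segments and unbounded
  in length. Any sequence comparable with all of them is therefore an initial segment of one of
  them.
\<close>
lemma leafy_branch:
  assumes B: "branch S lt B" "uncountable B"
  shows "branch (leafy n) proper_ext {seq y m | y m. y \<in> B}" "uncountable {seq y m | y m. y \<in> B}"
proof -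
  let ?C = "{seq y m | y m. y \<in> B}"
  have BS: "B \<subseteq> S" and cmp: "\<And>x y. x \<in> B \<Longrightarrow> y \<in> B \<Longrightarrow> le x y \<or> lt y x"
    using B(1) by (auto simp: pred_on.maxchain_def pred_on.chain_def le_def)
  (* Branches are closed downwards, by maximality. *)
  have down: "z \<in> B" if z: "z \<in> S" "y \<in> B" "le z y" for z y
  proof (rule ccontr)
    assume "z \<notin> B"
    have "z = w \<or> lt z w \<or> lt w z" if w: "w \<in> B" for w
      using cmp[OF w z(2)] z BS w le_linear[of z y w] le_trans[of z y w] unfolding le_def by blast
    then have "pred_on.chain S lt (insert z B)"
      using z(1) B(1) by (auto simp: pred_on.maxchain_def pred_on.chain_def)
    then show False using B(1) \<open>z \<notin> B\<close> unfolding pred_on.maxchain_def by blast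
  qed
  have seq_cmp: "seq x j = seq y m \<or> proper_ext (seq x j) (seq y m) \<or> proper_ext (seq y m) (seq x j)"
    if xy: "x \<in> B" "y \<in> B" for x y j m
  proof -
    have "x = y \<or> lt x y \<or> lt y x" using cmp[OF xy] by (auto simp: le_def)
    moreover have "j = m \<or> j < m \<or> m < j" by auto
    ultimately show ?thesis
      using seq_less[of x y j m] seq_less[of y x m j] seq_le[of x x j m] seq_le[of x x m j] xy BS
      by (auto simp: le_def)
  qed
  have chain: "pred_on.chain (leafy n) proper_ext ?C"
    using seq_cmp BS seq_mem unfolding pred_on.chain_def leafy_def by blast
  have rB: "uncountable (\<rho> ` B)"
  proof
    assume "countable (\<rho> ` B)"
    moreover have "inj_on \<rho> B"
      using cmp rank_less BS unfolding inj_on_def le_def by (metis order_less_irrefl subsetD)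
    ultimately show False using B(2) countable_image_inj_on by blast
  qed
  have cofinal: "\<exists>y\<in>B. a < \<rho> y" for a
  proof (rule ccontr)
    assume "\<not> ?thesis"
    then have "\<rho> ` B \<subseteq> insert a {..<a}" by auto
    then show False using rB countable_lessThan_w1 by (metis countable_insert countable_subset)
  qed
  show "uncountable ?C"
  proof
    assume "countable ?C"
    then have "countable ((\<lambda>y. seq y 0) ` B)" by (rule countable_subset[rotated]) auto
    then have "countable ((\<lambda>s. fst (Least (\<lambda>b. b \<notin> dom s))) ` (\<lambda>y. seq y 0) ` B)" by simp
    moreover have "fst (Least (\<lambda>b. b \<notin> dom (seq y 0))) = \<rho> y" for y
      by (subst Least_equality[of _ "(\<rho> y, 0)"]) auto
    ultimately show False using rB by (simp add: image_image)
  qed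
  have "\<not> ?C \<subset> X" if X: "pred_on.chain (leafy n) proper_ext X" for X
  proof
    assume "?C \<subset> X"
    then obtain s where s: "s \<in> X" "s \<notin> ?C" by blast
    then have sL: "s \<in> leafy n" using X by (auto simp: pred_on.chain_def)
    then obtain \<beta> where b: "dom s = {..<\<beta>}" using leafy.dom_lessThan by blast
    obtain y where y: "y \<in> B" "fst \<beta> < \<rho> y" using cofinal by blast
    then have "seq y 0 \<in> X" using \<open>?C \<subset> X\<close> by blast
    then have "s = seq y 0 \<or> proper_ext s (seq y 0) \<or> proper_ext (seq y 0) s"
      using X s(1) by (auto simp: pred_on.chain_def)
    moreover have "\<not> proper_ext (seq y 0) s"
    proof
      assume "proper_ext (seq y 0) s"
      then have "{..<(\<rho> y, 0)} \<subset> {..<\<beta>}" using b by (simp add: proper_ext_iff)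
      then have "(\<rho> y, 0) < \<beta>" by (simp only: lessThan_strict_subset_iff)
      then have "\<rho> y \<le> fst \<beta>" by (auto simp: less_prod_def)
      then show False using y(2) by simp
    qed
    ultimately have "proper_ext s (seq y 0)" using s(2) y(1) by blast
    then have "s = seq y 0 |` {..<\<beta>}" using b by (simp add: proper_ext_iff)
    moreover have "y \<in> S" "fst \<beta> \<le> \<rho> y" using y BS by auto
    then obtain z where z: "z \<in> S" "le z y" "\<rho> z = fst \<beta>" by (rule below)
    moreover have "\<beta> \<le> (\<rho> y, 0)" using y(2) by (simp add: less_eq_prod_def)
    ultimately have "s = seq z (snd \<beta>)"
      using seq_restrict[of z y "snd \<beta>" 0] \<open>y \<in> S\<close> by simp
    then show False using s(2) down[OF z(1) y(1) z(2)] by blast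
  qed
  then show "branch (leafy n) proper_ext ?C" using chain by (auto simp: pred_on.maxchain_def)
qed

text \<open>
  An uncountable branch has no maximum, so each of its elements is visible in the code of a larger
  one.
\<close>
lemma leafy_branch_inj:
  assumes "branch S lt B" "uncountable B" "branch S lt B'"
    and eq: "{seq y m | y m. y \<in> B} \<subseteq> {seq y m | y m. y \<in> B'}"
  shows "B \<subseteq> B'"
proof
  have BS: "B \<subseteq> S" "B' \<subseteq> S" and cmp: "\<And>x y. x \<in> B \<Longrightarrow> y \<in> B \<Longrightarrow> le x y \<or> lt y x"
    and cmp': "\<And>x y. x \<in> B' \<Longrightarrow> y \<in> B' \<Longrightarrow> le x y \<or> lt y x"
    using assms by (auto simp: pred_on.maxchain_def pred_on.chain_def le_def)
  fix x assume x: "x \<in> B"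
  have "\<exists>y\<in>B. lt x y"
  proof (rule ccontr)
    assume no: "\<not> ?thesis"
    have "\<rho> y \<le> \<rho> x" if "y \<in> B" for y
      using cmp[OF that x] no that le_rank[of y x] BS x by auto
    moreover have "inj_on \<rho> B"
      using cmp rank_less BS unfolding inj_on_def le_def by (metis order_less_irrefl subsetD)
    moreover have "countable {..\<rho> x}"
      using countable_lessThan_w1[of "\<rho> x"] by (simp add: ivl_disj_un_singleton(2)[symmetric])
    ultimately show False
      using assms(2) countable_image_inj_on countable_subset by (metis atMost_iff image_subsetI)
  qed
  then obtain y where y: "y \<in> B" "lt x y" by blast
  then obtain y' m where y': "y' \<in> B'" "seq y 0 = seq y' m" using eq by blast
  then have "preds S lt y \<subseteq> preds S lt y'" using seq_preds[of y y' 0 m] y BS by auto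
  moreover have "x \<in> preds S lt y" using x y BS by auto
  ultimately have "x \<in> preds S lt y'" by blast
  then have xy': "lt x y'" "x \<in> S" by auto
  show "x \<in> B'"
  proof (rule ccontr)
    assume "x \<notin> B'"
    have "x = w \<or> lt x w \<or> lt w x" if w: "w \<in> B'" for w
      using cmp'[OF w y'(1)] xy' BS w y'(1) le_linear[of x y' w] le_trans[of x y' w] unfolding le_def by blast
    then have "pred_on.chain S lt (insert x B')"
      using xy' assms(3) by (auto simp: pred_on.maxchain_def pred_on.chain_def)
    then show False using assms(3) \<open>x \<notin> B'\<close> unfolding pred_on.maxchain_def by blast
  qed
qed

lemma leafy_uncountable_branches:
  "|{B. branch S lt B \<and> uncountable B}| \<le>o |{B. branch (leafy n) proper_ext B \<and> uncountable B}|"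
proof (rule card_of_ordLeqI[of "\<lambda>B. {seq y m | y m. y \<in> B}"])
  show "inj_on (\<lambda>B. {seq y m | y m. y \<in> B}) {B. branch S lt B \<and> uncountable B}"
  proof (rule inj_onI)
    fix B B' assume "B \<in> {B. branch S lt B \<and> uncountable B}" "B' \<in> {B. branch S lt B \<and> uncountable B}"
      and eq: "{seq y m | y m. y \<in> B} = {seq y m | y m. y \<in> B'}"
    then have "branch S lt B" "uncountable B" "branch S lt B'" "uncountable B'" by auto
    then show "B = B'" using leafy_branch_inj eq by (intro equalityI) simp_all
  qed
qed (use leafy_branch in simp)

text \<open>
  The elements that are visible in the members of \<open>C\<close> form a chain, and it is
  uncountable because the lengths of the members of an uncountable chain are unbounded.
\<close>
lemma chain_seqs:
  assumes C: "pred_on.chain seqs proper_ext C" "uncountable C"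
  shows "\<exists>D. pred_on.chain S lt D \<and> uncountable D"
proof -
  have sub: "C \<subseteq> seqs" and "\<forall>s\<in>C. \<forall>t\<in>C. s = t \<or> proper_ext s t \<or> proper_ext t s"
    using C(1) by (auto simp: pred_on.chain_def)
  then have cmp: "s \<subseteq>\<^sub>m t \<or> t \<subseteq>\<^sub>m s" if "s \<in> C" "t \<in> C" for s t
    using that unfolding proper_ext_def by (metis map_le_refl)
  define Y where "Y = {y\<in>S. \<exists>m. seq y m \<in> C}"
  define D where "D = (\<Union>y\<in>Y. preds S lt y)"
  have nested: "preds S lt x \<subseteq> preds S lt y \<or> preds S lt y \<subseteq> preds S lt x" if xy: "x \<in> Y" "y \<in> Y" for x y
  proof -
    obtain j m where "seq x j \<in> C" "seq y m \<in> C" "x \<in> S" "y \<in> S" using xy by (auto simp: Y_def)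
    then show ?thesis using cmp seq_preds by blast
  qed
  have "v = w \<or> lt v w \<or> lt w v" if vw: "v \<in> D" "w \<in> D" for v w
  proof -
    obtain x y where "x \<in> Y" "v \<in> preds S lt x" "y \<in> Y" "w \<in> preds S lt y" using vw by (auto simp: D_def)
    then obtain z where "z \<in> Y" "v \<in> preds S lt z" "w \<in> preds S lt z" using nested[of x y] by blast
    then show ?thesis using tree_linear[OF tree, of v z w] by (auto simp: Y_def)
  qed
  moreover have "D \<subseteq> S" by (auto simp: D_def)
  ultimately have "pred_on.chain S lt D" unfolding pred_on.chain_def by blast
  moreover have "uncountable D"
  proof
    assume "countable D"
    then have "countable (\<rho> ` D)" by simp
    then obtain b where b: "\<And>a. a \<in> \<rho> ` D \<Longrightarrow> a < b" using countable_bounded_w1 by blast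
    have "\<rho> y \<le> b" if y: "y \<in> Y" for y
    proof (rule ccontr)
      assume "\<not> \<rho> y \<le> b"
      then have "b < \<rho> y" by simp
      then obtain x where "x \<in> S" "lt x y" "\<rho> x = b" using rank_attained[of y b] y by (auto simp: Y_def)
      then have "x \<in> D" "b = \<rho> x" using y by (auto simp: D_def)
      then have "b \<in> \<rho> ` D" by simp
      then show False using b by blast
    qed
    then have "dom s \<in> lessThan ` (({..b} :: w1 set) \<times> (UNIV :: nat set))" if s: "s \<in> C" for s
    proof -
      obtain y m where "y \<in> S" "s = seq y m" using sub s by (auto simp: seqs_def)
      then show ?thesis using s \<open>\<And>y. y \<in> Y \<Longrightarrow> \<rho> y \<le> b\<close> by (auto simp: Y_def)
    qed
    then have "dom ` C \<subseteq> lessThan ` ({..b} \<times> UNIV)" by blast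
    moreover have "countable {..b}"
      using countable_lessThan_w1[of b] by (simp add: ivl_disj_un_singleton(2)[symmetric])
    ultimately have "countable (dom ` C)" by (meson countable_SIGMA countable_image countable_subset countableI_type)
    moreover have "inj_on dom C"
    proof (rule inj_onI)
      fix s t assume st: "s \<in> C" "t \<in> C" "dom s = dom t"
      then show "s = t" using cmp[OF st(1,2)] by (metis map_le_antisym map_le_def)
    qed
    ultimately show False using C(2) countable_image_inj_on by blast
  qed
  ultimately show ?thesis by blast
qed

text \<open>
  Comparable elements of the tree have comparable codes, so an antichain of codes comes from an
  antichain.
\<close>
lemma antichain_seqs:
  assumes A: "antichain seqs proper_ext A" and c: "\<And>A. antichain S lt A \<Longrightarrow> countable A"
  shows "countable A"
proof -
  have sub: "A \<subseteq> seqs" and anti: "\<And>s t. s \<in> A \<Longrightarrow> t \<in> A \<Longrightarrow> \<not> proper_ext s t"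
    using A by (auto simp: antichain_def proper_ext_def)
  have "\<forall>s\<in>A. \<exists>y m. y \<in> S \<and> s = seq y m" using sub unfolding seqs_def by blast
  then obtain y m where y: "\<And>s. s \<in> A \<Longrightarrow> y s \<in> S" "\<And>s. s \<in> A \<Longrightarrow> s = seq (y s) (m s)" by metis
  have "inj_on y A"
  proof (rule inj_onI)
    fix s t assume st: "s \<in> A" "t \<in> A" "y s = y t"
    have "\<not> m s < m t" "\<not> m t < m s"
      using anti[OF st(1,2)] anti[OF st(2,1)] y(2)[OF st(1)] y(2)[OF st(2)] st(3) y(1)[OF st(1)]
        seq_le[of "y s" "y s" "m s" "m t"] seq_le[of "y s" "y s" "m t" "m s"] by (auto simp: le_def)
    then have "m s = m t" by simp
    then show "s = t" using y(2)[OF st(1)] y(2)[OF st(2)] st(3) by simp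
  qed
  moreover have "antichain S lt (y ` A)"
    unfolding antichain_def
  proof (intro conjI ballI impI)
    fix a b assume "a \<in> y ` A" "b \<in> y ` A"
    then obtain s t where "s \<in> A" "t \<in> A" "a = y s" "b = y t" by blast
    then show "\<not> lt a b" using seq_less[of a b "m s" "m t"] y anti by metis
  qed (use y in auto)
  ultimately show ?thesis using c countable_image_inj_on by blast
qed

end

lemma omega1_tree_ranked:
  assumes "omega1_tree S lt" obtains \<rho> k where "ranked_tree S lt \<rho> k"
proof -
  have tree: "is_tree S lt" and pc: "\<forall>t\<in>S. countable (preds S lt t)" and unc: "uncountable S"
    and lev: "\<And>a. countable (level S lt (ord_w1 a))" using assms by (auto simp: omega1_tree_iff)
  obtain \<rho> where \<rho>: "\<And>s t. s \<in> S \<Longrightarrow> t \<in> S \<Longrightarrow> lt s t \<Longrightarrow> \<rho> s < \<rho> t"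
    "\<And>t a. t \<in> S \<Longrightarrow> a < \<rho> t \<Longrightarrow> \<exists>s\<in>S. lt s t \<and> \<rho> s = a"
    "\<And>t. t \<in> S \<Longrightarrow> height_at S lt t =o ord_w1 (\<rho> t)"
    using tree_rank[OF tree pc] by blast
  have c: "countable {y\<in>S. \<rho> y = a}" for a
    by (rule countable_subset[OF _ lev[of a]]) (use \<rho>(3) in \<open>auto simp: level_def\<close>)
  have "ranked_tree S lt \<rho> (\<lambda>x. to_nat_on {y\<in>S. \<rho> y = \<rho> x} x)"
  proof (unfold_locales)
    fix x y assume xy: "x \<in> S" "y \<in> S" "\<rho> x = \<rho> y"
      "to_nat_on {z\<in>S. \<rho> z = \<rho> x} x = to_nat_on {z\<in>S. \<rho> z = \<rho> y} y"
    then show "x = y"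
      using to_nat_on_inj[OF c[of "\<rho> y"], of x y] by simp
  qed (use tree \<rho> c unc in auto)
  then show thesis using that by blast
qed

theorem nary_kurepa_tree:
  assumes "kurepa_tree S lt" "n \<ge> 2"
  shows "\<exists>F :: (pos \<Rightarrow> nat option) set. regular_tree F proper_ext \<and> nary_tree n F proper_ext \<and> kurepa_tree F proper_ext"
proof -
  have "omega1_tree S lt" using assms by (simp add: kurepa_tree_def)
  then obtain \<rho> k where "ranked_tree S lt \<rho> k" by (rule omega1_tree_ranked)
  then interpret ranked_tree S lt \<rho> k .
  have "kurepa_tree (leafy n) proper_ext"
    using assms(1) leafy_omega1_tree leafy_uncountable_branches ordLeq_transitive
    unfolding kurepa_tree_def by blast
  then show ?thesis using leafy_regular leafy_nary[OF assms(2)] by blast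
qed

section \<open>Finite maximal antichains in splitting trees\<close>

definition comparable :: "(pos \<Rightarrow> nat option) \<Rightarrow> (pos \<Rightarrow> nat option) \<Rightarrow> bool" where
  "comparable s t \<longleftrightarrow> s \<subseteq>\<^sub>m t \<or> t \<subseteq>\<^sub>m s"

context pos_tree
begin

lemma restrict_any: assumes "s \<in> F" shows "s |` {..<\<beta>} \<in> F"
proof (cases "\<beta> \<in> dom s")
  case False
  obtain \<gamma> where "dom s = {..<\<gamma>}" using dom_lessThan[OF assms] by blast
  then have "dom s \<subseteq> {..<\<beta>}" using False by auto
  then have "s |` {..<\<beta>} = s" by (metis domIff ext restrict_in restrict_out subsetD)
  then show ?thesis using assms by simp
qed (rule restrict_lessThan[OF assms])

lemma dom_down: "s \<in> F \<Longrightarrow> \<beta> \<in> dom s \<Longrightarrow> \<gamma> \<le> \<beta> \<Longrightarrow> \<gamma> \<in> dom s"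
  using dom_lessThan[of s] by (metis lessThan_iff order.strict_trans1)

lemma incomparable_diff:
  assumes st: "s \<in> F" "t \<in> F" and "\<not> comparable s t"
  obtains \<beta> where "\<beta> \<in> dom s" "\<beta> \<in> dom t" "s |` {..<\<beta>} = t |` {..<\<beta>}" "s \<beta> \<noteq> t \<beta>"
proof -
  obtain \<gamma> \<delta> where d: "dom s = {..<\<gamma>}" "dom t = {..<\<delta>}" using dom_lessThan st by metis
  have "\<exists>p. p \<in> dom s \<and> p \<in> dom t \<and> s p \<noteq> t p"
  proof (cases "\<gamma> \<le> \<delta>")
    case True
    then have "dom s \<subseteq> dom t" using d by auto
    then show ?thesis using assms(3) by (metis comparable_def map_le_def subsetD)
  next
    case False
    then have "dom t \<subseteq> dom s" using d by auto
    then show ?thesis using assms(3) by (metis comparable_def map_le_def subsetD)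
  qed
  then obtain p where p: "p \<in> dom s \<and> p \<in> dom t \<and> s p \<noteq> t p"
    and least: "\<And>q. q < p \<Longrightarrow> \<not> (q \<in> dom s \<and> q \<in> dom t \<and> s q \<noteq> t q)"
    using exists_least_iff[of "\<lambda>p. p \<in> dom s \<and> p \<in> dom t \<and> s p \<noteq> t p"] by blast
  have "s q = t q" if "q < p" for q
    using least[OF that] dom_down[OF st(1), of p q] dom_down[OF st(2), of p q] p that by auto
  then have "s |` {..<p} = t |` {..<p}" by (auto simp: restrict_map_def fun_eq_iff)
  then show thesis using that p by blast
qed

lemma proper_ext_restrict:
  "s \<in> F \<Longrightarrow> \<beta> \<in> dom s \<Longrightarrow> proper_ext (s |` {..<\<beta>}) s"
proof -
  assume "s \<in> F" "\<beta> \<in> dom s"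
  then have "s |` {..<\<beta>} \<in> preds F proper_ext s" unfolding preds_eq[OF \<open>s \<in> F\<close>] underS_le by blast
  then show ?thesis by simp
qed

lemma empty_mem: "F \<noteq> {} \<Longrightarrow> Map.empty \<in> F"
proof -
  assume "F \<noteq> {}"
  then obtain s where s: "s \<in> F" by blast
  have "{..<(LEAST b :: pos. True)} = {}" using not_less_Least by blast
  then show ?thesis using restrict_any[OF s, of "LEAST b. True"] by simp
qed

end

locale splitting_tree = pos_tree F for F +
  fixes n :: nat
  assumes n: "n \<ge> 2" and ne: "F \<noteq> {}"
    and ran01: "\<And>s. s \<in> F \<Longrightarrow> ran s \<subseteq> {0, 1}"
    and splits: "\<And>s. s \<in> F \<Longrightarrow> \<exists>a\<in>F. \<exists>b\<in>F. s \<subseteq>\<^sub>m a \<and> s \<subseteq>\<^sub>m b \<and> \<not> comparable a b"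
begin

text \<open>
  Take the least position \<open>\<beta>\<close> at which two extensions of \<open>s\<close> part,
  and cut them off after \<open>\<beta>\<close>. An extension \<open>z\<close> incomparable with
  both would part from both at \<open>\<beta>\<close>, by minimality, but there are only two values.
\<close>
lemma two_split:
  assumes s: "s \<in> F"
  shows "\<exists>a\<in>F. \<exists>b\<in>F. proper_ext s a \<and> proper_ext s b \<and> \<not> comparable a b \<and>
    (\<forall>z\<in>F. s \<subseteq>\<^sub>m z \<longrightarrow> comparable z a \<or> comparable z b)"
proof -
  define P where "P \<beta> \<longleftrightarrow> (\<exists>a\<in>F. \<exists>b\<in>F. s \<subseteq>\<^sub>m a \<and> s \<subseteq>\<^sub>m b \<and> \<beta> \<in> dom a \<and> \<beta> \<in> dom b \<and>
    a |` {..<\<beta>} = b |` {..<\<beta>} \<and> a \<beta> \<noteq> b \<beta>)" for \<beta>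
  have PI: "\<exists>\<beta>. \<beta> \<in> dom a \<and> \<beta> \<in> dom b \<and> a \<beta> \<noteq> b \<beta> \<and> P \<beta>"
    if ab: "a \<in> F" "b \<in> F" "s \<subseteq>\<^sub>m a" "s \<subseteq>\<^sub>m b" "\<not> comparable a b" for a b
    using incomparable_diff[OF ab(1,2,5)] ab unfolding P_def by metis
  then have "\<exists>\<beta>. P \<beta>" using splits[OF s] by metis
  then obtain \<beta> where \<beta>: "P \<beta>" "\<And>\<gamma>. P \<gamma> \<Longrightarrow> \<beta> \<le> \<gamma>" by (metis LeastI_ex Least_le)
  then obtain a' b' where ab': "a' \<in> F" "b' \<in> F" "s \<subseteq>\<^sub>m a'" "s \<subseteq>\<^sub>m b'" "\<beta> \<in> dom a'" "\<beta> \<in> dom b'"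
    "a' |` {..<\<beta>} = b' |` {..<\<beta>}" "a' \<beta> \<noteq> b' \<beta>" unfolding P_def by blast
  have "\<beta> \<notin> dom s" using ab' by (metis map_le_def)
  then have ds: "dom s \<subseteq> {..<\<beta>}" using dom_down[OF s] by (metis lessThan_iff linorder_not_le subsetI)
  obtain \<beta>' where \<beta>': "{..<\<beta>'} = insert \<beta> {..<\<beta>}" using lessThan_Suc_pos by (metis surj_pair)
  have r: "c |` {..<\<beta>'} \<in> F" "dom (c |` {..<\<beta>'}) = insert \<beta> {..<\<beta>}" "(c |` {..<\<beta>'}) \<beta> = c \<beta>"
    "proper_ext s (c |` {..<\<beta>'})"
    if c: "c \<in> F" "s \<subseteq>\<^sub>m c" "\<beta> \<in> dom c" for c
  proof -
    show "c |` {..<\<beta>'} \<in> F" using restrict_any[OF c(1)] .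
    have "{..<\<beta>'} \<subseteq> dom c" unfolding \<beta>' using dom_down[OF c(1,3)] c(3)
      by (metis insert_subset lessThan_iff less_imp_le subsetI)
    then show d: "dom (c |` {..<\<beta>'}) = insert \<beta> {..<\<beta>}" using \<beta>' by auto
    show "(c |` {..<\<beta>'}) \<beta> = c \<beta>" by (simp add: \<beta>')
    have "s \<subseteq>\<^sub>m c |` {..<\<beta>'}" using c(2) ds by (auto simp: map_le_def \<beta>')
    moreover have "s \<noteq> c |` {..<\<beta>'}" using d \<open>\<beta> \<notin> dom s\<close> by (metis insertI1)
    ultimately show "proper_ext s (c |` {..<\<beta>'})" by (simp add: proper_ext_def)
  qed
  define a where "a = a' |` {..<\<beta>'}"
  define b where "b = b' |` {..<\<beta>'}"
  note a = r[OF ab'(1,3,5), folded a_def] and b = r[OF ab'(2,4,6), folded b_def]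
  have diff: "z \<beta> \<noteq> c \<beta> \<and> \<beta> \<in> dom z"
    if z: "z \<in> F" "s \<subseteq>\<^sub>m z" and c: "c \<in> F" "proper_ext s c" "dom c = insert \<beta> {..<\<beta>}" "\<not> comparable z c" for z c
  proof -
    obtain \<gamma> where g: "\<gamma> \<in> dom z" "\<gamma> \<in> dom c" "z \<gamma> \<noteq> c \<gamma>" "P \<gamma>"
      using PI[OF z(1) c(1) z(2) _ c(4)] c(2) by (auto simp: proper_ext_def)
    have "\<gamma> \<le> \<beta>" using g(2) c(3) by auto
    then have "\<gamma> = \<beta>" using \<beta>(2)[OF g(4)] by simp
    then show ?thesis using g by simp
  qed
  have "a \<beta> \<noteq> b \<beta>" using a(3) b(3) ab'(8) by simp
  have "\<not> comparable a b"
    using \<open>a \<beta> \<noteq> b \<beta>\<close> a(2) b(2) by (auto simp: comparable_def map_le_def)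
  moreover have "comparable z a \<or> comparable z b" if z: "z \<in> F" "s \<subseteq>\<^sub>m z" for z
  proof (rule ccontr)
    assume "\<not> ?thesis"
    then have z\<beta>: "z \<beta> \<noteq> a \<beta>" "z \<beta> \<noteq> b \<beta>" "\<beta> \<in> dom z"
      using diff[OF z a(1,4,2)] diff[OF z b(1,4,2)] by auto
    have v: "c \<beta> = Some 0 \<or> c \<beta> = Some 1" if "c \<in> F" "\<beta> \<in> dom c" for c
      using ran01[OF that(1)] that(2) ranI[of c \<beta>] by blast
    show False using v[OF z(1) z\<beta>(3)] v[OF a(1)] v[OF b(1)] a(2) b(2) z\<beta> \<open>a \<beta> \<noteq> b \<beta>\<close> by auto
  qed
  ultimately show ?thesis using a b by blast
qed

text \<open>
  A frame is a maximal antichain of size \<open>m\<close> in the part of the tree strictly above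
  \<open>s\<close>.
\<close>
definition is_frame :: "nat \<Rightarrow> (pos \<Rightarrow> nat option) \<Rightarrow> (pos \<Rightarrow> nat option) set \<Rightarrow> bool" where
  "is_frame m s A \<longleftrightarrow> A \<subseteq> F \<and> finite A \<and> card A = m \<and> (\<forall>a\<in>A. proper_ext s a) \<and>
    (\<forall>a\<in>A. \<forall>b\<in>A. a \<noteq> b \<longrightarrow> \<not> comparable a b) \<and> (\<forall>z\<in>F. s \<subseteq>\<^sub>m z \<longrightarrow> (\<exists>a\<in>A. comparable z a))"

lemma linear_below: assumes "x \<in> F" "y \<in> F" "x \<subseteq>\<^sub>m z" "y \<subseteq>\<^sub>m z" shows "comparable x y"
proof -
  obtain \<gamma> \<delta> where "dom x = {..<\<gamma>}" "dom y = {..<\<delta>}" using dom_lessThan assms by metis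
  then have "dom x \<subseteq> dom y \<or> dom y \<subseteq> dom x" by auto
  then show ?thesis using assms(3,4) unfolding comparable_def map_le_def by (metis subsetD)
qed

text \<open>
  Frames grow by one element when a member is replaced by the two elements of
  \<open>two_split\<close> above it.
\<close>
lemma ex_frame: "s \<in> F \<Longrightarrow> \<exists>A. is_frame (Suc (Suc m)) s A"
proof (induction m)
  case 0
  obtain a b where "a \<in> F" "b \<in> F" "proper_ext s a" "proper_ext s b" "\<not> comparable a b"
    "\<forall>z\<in>F. s \<subseteq>\<^sub>m z \<longrightarrow> comparable z a \<or> comparable z b" using two_split[OF 0] by blast
  moreover from this have "a \<noteq> b" by (auto simp: comparable_def)
  ultimately have "is_frame (Suc (Suc 0)) s {a, b}" by (auto simp: is_frame_def comparable_def)
  then show ?case by blast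
next
  case (Suc m)
  then obtain A where A: "is_frame (Suc (Suc m)) s A" by blast
  then have A': "A \<subseteq> F" "finite A" "card A = Suc (Suc m)" "\<And>a. a \<in> A \<Longrightarrow> proper_ext s a"
    "\<And>a b. a \<in> A \<Longrightarrow> b \<in> A \<Longrightarrow> a \<noteq> b \<Longrightarrow> \<not> comparable a b"
    "\<And>z. z \<in> F \<Longrightarrow> s \<subseteq>\<^sub>m z \<Longrightarrow> \<exists>a\<in>A. comparable z a" by (auto simp: is_frame_def)
  then obtain c where c: "c \<in> A" by fastforce
  then have cF: "c \<in> F" using A' by blast
  obtain a b where ab: "a \<in> F" "b \<in> F" "proper_ext c a" "proper_ext c b" "\<not> comparable a b"
    "\<And>z. z \<in> F \<Longrightarrow> c \<subseteq>\<^sub>m z \<Longrightarrow> comparable z a \<or> comparable z b" using two_split[OF cF] by blast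
  have inc: "\<not> comparable d e" if d: "d \<in> A" "d \<noteq> c" and e: "e \<in> F" "proper_ext c e" for d e
  proof
    assume "comparable d e"
    moreover have ce: "c \<subseteq>\<^sub>m e" using e by (simp add: proper_ext_def)
    ultimately have "comparable d c"
      using linear_below[of d c e] d A'(1) cF map_le_trans[of c e d] by (auto simp: comparable_def)
    then show False using A'(5) d c by blast
  qed
  let ?B = "insert a (insert b (A - {c}))"
  have "a \<noteq> b" using ab(5) by (auto simp: comparable_def)
  have notin: "e \<notin> A" if "proper_ext c e" "e \<in> F" for e
    using A'(5)[OF _ c, of e] that by (auto simp: proper_ext_def comparable_def)
  have "is_frame (Suc (Suc (Suc m))) s ?B"
    unfolding is_frame_def
  proof (intro conjI)
    show "?B \<subseteq> F" "finite ?B" using A' ab by auto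
    show "card ?B = Suc (Suc (Suc m))"
      using notin[OF ab(3,1)] notin[OF ab(4,2)] \<open>a \<noteq> b\<close> A'(2,3) c by simp
    show "\<forall>e\<in>?B. proper_ext s e" using A'(4) c ab(3,4) proper_ext_trans by blast
    have sym: "comparable x y \<longleftrightarrow> comparable y x" for x y by (auto simp: comparable_def)
    show "\<forall>d\<in>?B. \<forall>e\<in>?B. d \<noteq> e \<longrightarrow> \<not> comparable d e"
      using inc[OF _ _ ab(1,3)] inc[OF _ _ ab(2,4)] ab(5) A'(5) sym by blast
    show "\<forall>z\<in>F. s \<subseteq>\<^sub>m z \<longrightarrow> (\<exists>e\<in>?B. comparable z e)"
    proof (intro ballI impI)
      fix z assume z: "z \<in> F" "s \<subseteq>\<^sub>m z"
      then obtain d where d: "d \<in> A" "comparable z d" using A'(6) by blast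
      show "\<exists>e\<in>?B. comparable z e"
      proof (cases "d = c")
        case True
        then consider "z \<subseteq>\<^sub>m c" | "c \<subseteq>\<^sub>m z" using d(2) by (auto simp: comparable_def)
        then show ?thesis
        proof cases
          case 1
          then have "z \<subseteq>\<^sub>m a" using ab(3) map_le_trans by (auto simp: proper_ext_def)
          then show ?thesis by (auto simp: comparable_def)
        qed (use ab(6)[OF z(1)] in blast)
      qed (use d in blast)
    qed
  qed
  then show ?case by blast
qed

definition frame :: "(pos \<Rightarrow> nat option) \<Rightarrow> (pos \<Rightarrow> nat option) set" where
  "frame s = (SOME A. is_frame n s A)"

lemma frame:
  assumes "s \<in> F"
  shows "frame s \<subseteq> F" "card (frame s) = n" "\<And>a. a \<in> frame s \<Longrightarrow> proper_ext s a"
    "\<And>a b. a \<in> frame s \<Longrightarrow> b \<in> frame s \<Longrightarrow> a \<noteq> b \<Longrightarrow> \<not> comparable a b"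
    "\<And>z. z \<in> F \<Longrightarrow> s \<subseteq>\<^sub>m z \<Longrightarrow> \<exists>a\<in>frame s. comparable z a"
proof -
  obtain m where "n = Suc (Suc m)" using n by (metis add_2_eq_Suc le_Suc_ex)
  then have "is_frame n s (frame s)" unfolding frame_def using ex_frame[OF assms] by (metis someI_ex)
  then show "frame s \<subseteq> F" "card (frame s) = n" "\<And>a. a \<in> frame s \<Longrightarrow> proper_ext s a"
    "\<And>a b. a \<in> frame s \<Longrightarrow> b \<in> frame s \<Longrightarrow> a \<noteq> b \<Longrightarrow> \<not> comparable a b"
    "\<And>z. z \<in> F \<Longrightarrow> s \<subseteq>\<^sub>m z \<Longrightarrow> \<exists>a\<in>frame s. comparable z a"
    unfolding is_frame_def by blast+
qed

section \<open>The tree generated by the frames\<close>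

text \<open>
  The limit rule demands an element of the set strictly between \<open>y\<close> and
  \<open>x\<close>. Therefore \<open>x\<close> cannot be an immediate successor in the set, and the
  two rules never apply to the same element. The root falls under the limit rule.
\<close>
inductive_set frame_tree :: "(pos \<Rightarrow> nat option) set" where
  step: "p \<in> frame_tree \<Longrightarrow> x \<in> frame p \<Longrightarrow> x \<in> frame_tree"
| lim: "x \<in> F \<Longrightarrow> (\<And>y. y \<in> F \<Longrightarrow> proper_ext y x \<Longrightarrow> \<exists>v. v \<in> frame_tree \<and> proper_ext y v \<and> proper_ext v x) \<Longrightarrow> x \<in> frame_tree"

lemma frame_tree_mem: "x \<in> frame_tree \<Longrightarrow> x \<in> F"
  by (induction rule: frame_tree.induct) (use frame(1) in auto)

lemma is_tree_frame_tree: "is_tree frame_tree proper_ext"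
  using is_tree_subset[OF is_tree] frame_tree_mem by blast

lemmas ext_irrefl = tree_irrefl[OF is_tree]

lemma ext_iff: "proper_ext x y \<longleftrightarrow> x \<subseteq>\<^sub>m y \<and> x \<noteq> y"
  by (simp add: proper_ext_def)

text \<open>
  The elements of a frame of \<open>p\<close> are immediate successors of \<open>p\<close> in
  \<open>frame_tree\<close>. Suppose \<open>p < v < x\<close>. If \<open>v\<close> belongs to the
  frame of \<open>p'\<close>, then \<open>p' = p\<close> contradicts the antichain property,
  \<open>p < p'\<close> gives the smaller counterexample \<open>p'\<close> between \<open>p\<close>
  and \<open>x\<close>, and \<open>p' < p\<close> gives the smaller counterexample \<open>p' < p <
  v\<close>. This needs an outer induction on \<open>x\<close> and an inner one on \<open>v\<close>.
\<close>
lemma frame_tree_below_frame: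
  assumes "x \<in> F" "p \<in> frame_tree" "x \<in> frame p" "v \<in> frame_tree" "proper_ext v x"
  shows "v \<subseteq>\<^sub>m p"
  using is_tree assms
proof (induction x arbitrary: p v rule: tree_induct)
  case (less x)
  note outer = less.IH
  have x: "x \<in> F" "p \<in> frame_tree" "x \<in> frame p" using less by auto
  have px: "proper_ext p x" using frame(3) frame_tree_mem x by blast
  have "v \<in> F" using frame_tree_mem less by blast
  with is_tree show ?case using \<open>v \<in> frame_tree\<close> \<open>proper_ext v x\<close>
  proof (induction v rule: tree_induct)
    case (less v)
    note inner = less.IH
    show ?case
    proof (rule ccontr)
      assume "\<not> v \<subseteq>\<^sub>m p"
      then have pv: "proper_ext p v"
        using linear_below[of v p x] less px frame_tree_mem x(2) by (auto simp: ext_iff comparable_def)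
      from \<open>v \<in> frame_tree\<close> show False
      proof cases
        case (step p')
        have p': "proper_ext p' v" "p' \<in> F" using frame(3) frame_tree_mem step by blast+
        have p'x: "proper_ext p' x" using proper_ext_trans p'(1) less(4) by blast
        have "comparable p' p" using linear_below[of p' p v] p' pv frame_tree_mem x(2) by (auto simp: ext_iff)
        then consider "p = p'" | "proper_ext p p'" | "proper_ext p' p" by (auto simp: comparable_def ext_iff)
        then show False
        proof cases
          case 1
          then have "x = v" using frame(4)[OF frame_tree_mem[OF x(2)] x(3), of v] step less(4) 
            by (auto simp: comparable_def ext_iff)
          then show False using less(4) by (simp add: ext_iff)
        next
          case 2
          then show False using inner[OF p'(2,1) step(1) p'x] by (metis ext_iff map_le_antisym)
        next
          case 3
          then show False using outer[OF frame_tree_mem[OF less(3)] less(4) step(1,2) x(2) pv]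
            by (metis ext_iff map_le_antisym)
        qed
      next
        case lim
        then obtain w where w: "w \<in> frame_tree" "proper_ext p w" "proper_ext w v" using pv frame_tree_mem x(2) by blast
        then have "w \<subseteq>\<^sub>m p" using inner[OF frame_tree_mem[OF w(1)] w(3,1)] proper_ext_trans less(4) by blast
        then show False using w(2) by (metis ext_iff map_le_antisym)
      qed
    qed
  qed
qed

lemma preds_frame:
  assumes "p \<in> frame_tree" "x \<in> frame p" shows "preds frame_tree proper_ext x = {v\<in>frame_tree. v \<subseteq>\<^sub>m p}"
proof -
  have xF: "x \<in> F" using frame(1) frame_tree_mem assms by blast
  have px: "proper_ext p x" using frame(3) frame_tree_mem assms by blast
  have "proper_ext v x" if "v \<subseteq>\<^sub>m p" for v
    using that px proper_ext_trans by (cases "v = p") (auto simp: ext_iff)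
  then show ?thesis using frame_tree_below_frame[OF xF assms] by (auto simp: preds_def)
qed

lemma has_max_frame:
  assumes "p \<in> frame_tree" "x \<in> frame p" shows "has_max proper_ext (preds frame_tree proper_ext x)"
  unfolding preds_frame[OF assms] has_max_def
  by (rule bexI[of _ p]) (use assms in \<open>auto simp: ext_iff\<close>)

definition is_limit :: "(pos \<Rightarrow> nat option) \<Rightarrow> bool" where
  "is_limit x \<longleftrightarrow> x \<in> F \<and> (\<forall>y\<in>F. proper_ext y x \<longrightarrow> (\<exists>v\<in>frame_tree. proper_ext y v \<and> proper_ext v x))"

lemma frame_tree_cases: "x \<in> frame_tree \<Longrightarrow> is_limit x \<or> (\<exists>p\<in>frame_tree. x \<in> frame p)"
  by (erule frame_tree.cases) (auto simp: is_limit_def)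

lemma limit_no_max: "is_limit x \<Longrightarrow> \<not> has_max proper_ext (preds frame_tree proper_ext x)"
proof
  assume x: "is_limit x" and "has_max proper_ext (preds frame_tree proper_ext x)"
  then obtain m where m: "m \<in> frame_tree" "proper_ext m x"
    "\<And>v. v \<in> frame_tree \<Longrightarrow> proper_ext v x \<Longrightarrow> v = m \<or> proper_ext v m" by (auto simp: has_max_def)
  then obtain v where v: "v \<in> frame_tree" "proper_ext m v" "proper_ext v x" using x frame_tree_mem by (auto simp: is_limit_def)
  then have "v = m \<or> proper_ext v m" using m(3) by blast
  then show False using v(2) by (metis ext_iff map_le_antisym)
qed

lemma nary_frame_tree: "nary_tree n frame_tree proper_ext"
  unfolding nary_tree_iff
proof (intro conjI ballI impI is_tree_frame_tree)
  fix t assume t: "t \<in> frame_tree" "has_max proper_ext (preds frame_tree proper_ext t)"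
  then obtain p where p: "p \<in> frame_tree" "t \<in> frame p" using frame_tree_cases limit_no_max by blast
  have "node frame_tree proper_ext t = frame p"
  proof (intro equalityI subsetI)
    fix s assume "s \<in> node frame_tree proper_ext t"
    then have s: "s \<in> frame_tree" "preds frame_tree proper_ext s = preds frame_tree proper_ext t" by (auto simp: node_def)
    then obtain q where q: "q \<in> frame_tree" "s \<in> frame q" using frame_tree_cases limit_no_max t(2) by metis
    have "{v\<in>frame_tree. v \<subseteq>\<^sub>m q} = {v\<in>frame_tree. v \<subseteq>\<^sub>m p}" using s(2) preds_frame p q by simp
    then have "v \<subseteq>\<^sub>m q \<longleftrightarrow> v \<subseteq>\<^sub>m p" if "v \<in> frame_tree" for v using that by blast
    then have "q \<subseteq>\<^sub>m p" "p \<subseteq>\<^sub>m q" using p(1) q(1) map_le_refl by metis+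
    then show "s \<in> frame p" using q(2) map_le_antisym by blast
  next
    fix s assume "s \<in> frame p"
    then show "s \<in> node frame_tree proper_ext t"
      using preds_frame p frame_tree.step by (simp add: node_def)
  qed
  then show "card (node frame_tree proper_ext t) = n" using frame(2) frame_tree_mem p by simp
qed

text \<open>
  A limit element is the union of its predecessors in \<open>frame_tree\<close>, which makes it
  unique in its node.
\<close>
lemma limit_le:
  assumes "is_limit t" "preds frame_tree proper_ext t \<subseteq> preds frame_tree proper_ext s" shows "t \<subseteq>\<^sub>m s"
  unfolding map_le_def
proof
  fix q assume q: "q \<in> dom t"
  have tF: "t \<in> F" using assms(1) by (simp add: is_limit_def)
  have "{..<q} \<subseteq> dom t" using dom_down[OF tF q] by (meson lessThan_iff less_imp_le subsetI)
  then have d: "dom (t |` {..<q}) = {..<q}" by auto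
  obtain v where v: "v \<in> frame_tree" "proper_ext (t |` {..<q}) v" "proper_ext v t"
    using assms(1) proper_ext_restrict[OF tF q] restrict_any[OF tF] unfolding is_limit_def by blast
  obtain \<gamma> where g: "dom v = {..<\<gamma>}" using dom_lessThan frame_tree_mem v(1) by blast
  have "dom (t |` {..<q}) \<subset> dom v" using v(2) unfolding proper_ext_iff by blast
  then have "{..<q} \<subset> {..<\<gamma>}" unfolding d g .
  then have "q \<in> dom v" using g by (simp add: lessThan_strict_subset_iff)
  moreover have "v \<in> preds frame_tree proper_ext s" using v assms(2) by auto
  then have "v \<subseteq>\<^sub>m s" "v \<subseteq>\<^sub>m t" using v(3) by (auto simp: ext_iff)
  ultimately show "t q = s q" by (metis map_le_def)
qed

lemma regular_frame_tree: "regular_tree frame_tree proper_ext"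
  unfolding regular_tree_iff
proof (intro conjI ballI impI is_tree_frame_tree)
  have "Map.empty \<in> frame_tree"
    by (rule frame_tree.lim) (use empty_mem[OF ne] in \<open>auto simp: ext_iff map_le_def\<close>)
  then show "\<exists>e\<in>frame_tree. \<forall>t\<in>frame_tree. t \<noteq> e \<longrightarrow> proper_ext e t"
    by (intro bexI[of _ Map.empty]) (auto simp: ext_iff)
next
  fix t assume t: "t \<in> frame_tree" "preds frame_tree proper_ext t \<noteq> {} \<and> \<not> has_max proper_ext (preds frame_tree proper_ext t)"
  have lim: "is_limit s" if "s \<in> node frame_tree proper_ext t" for s
    using that t frame_tree_cases[of s] has_max_frame[of _ s] by (auto simp: node_def)
  have "s = t" if s: "s \<in> node frame_tree proper_ext t" for s
  proof (rule map_le_antisym)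
    have eq: "preds frame_tree proper_ext s = preds frame_tree proper_ext t" using s by (simp add: node_def)
    show "s \<subseteq>\<^sub>m t" using limit_le[OF lim[OF s]] eq by simp
    show "t \<subseteq>\<^sub>m s" using limit_le[OF lim[OF self_in_node[OF t(1)]]] eq by simp
  qed
  then show "node frame_tree proper_ext t = {t}" using self_in_node[OF t(1)] by blast
qed

text \<open>
  Suppose no element of \<open>frame_tree\<close> extends \<open>z\<close>, and consider its
  elements \<open>v\<close> below \<open>z\<close>. Since \<open>frame v\<close> is maximal, one of
  its members is comparable with \<open>z\<close> and hence again below \<open>z\<close>. So these
  elements have no largest one, and their union \<open>u\<close>, an initial segment of
  \<open>z\<close>, belongs to \<open>frame_tree\<close> by the limit rule, a contradiction.
\<close>
lemma frame_tree_cofinal: assumes z: "z \<in> F" shows "\<exists>v\<in>frame_tree. z \<subseteq>\<^sub>m v"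
proof (rule ccontr)
  assume no: "\<not> ?thesis"
  define M where "M = {v\<in>frame_tree. v \<subseteq>\<^sub>m z}"
  have up: "\<exists>v'\<in>M. proper_ext v v'" if v: "v \<in> M" for v
  proof -
    have vF: "v \<in> F" "v \<in> frame_tree" "v \<subseteq>\<^sub>m z" using v frame_tree_mem by (auto simp: M_def)
    obtain a where a: "a \<in> frame v" "comparable z a" using frame(5)[OF vF(1) z vF(3)] by blast
    have "a \<in> frame_tree" using frame_tree.step vF a by blast
    then have "a \<in> M" using no a(2) by (auto simp: M_def comparable_def)
    then show ?thesis using frame(3)[OF vF(1) a(1)] by blast
  qed
  define D where "D = (\<Union>v\<in>M. dom v)"
  have MD: "dom v \<subseteq> D" if "v \<in> M" for v using that by (auto simp: D_def)
  have Dz: "D \<subseteq> dom z" using map_le_implies_dom_le[of _ z] unfolding D_def M_def by blast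
  have down: "\<gamma> \<in> D" if bg: "\<beta> \<in> D" "\<gamma> \<le> \<beta>" for \<beta> \<gamma>
  proof -
    obtain v where v: "v \<in> M" "\<beta> \<in> dom v" using bg(1) by (auto simp: D_def)
    then have "v \<in> F" using frame_tree_mem by (simp add: M_def)
    then have "\<gamma> \<in> dom v" using dom_down v(2) bg(2) by blast
    then show ?thesis using v(1) by (auto simp: D_def)
  qed
  obtain \<zeta> where \<zeta>: "dom z = {..<\<zeta>}" using dom_lessThan z by blast
  then have "\<zeta> \<notin> D" using Dz by auto
  then obtain \<delta> where \<delta>: "\<delta> \<notin> D" "\<And>q. q < \<delta> \<Longrightarrow> q \<in> D"
    using exists_least_iff[of "\<lambda>d. d \<notin> D"] by blast
  have D: "D = {..<\<delta>}"
    using \<delta> down by (metis lessThan_iff linorder_not_le subsetI subset_antisym)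
  define u where "u = z |` {..<\<delta>}"
  have uF: "u \<in> F" unfolding u_def by (rule restrict_any[OF z])
  have du: "dom u = D" using Dz D by (auto simp: u_def)
  have Mu: "v \<subseteq>\<^sub>m u" if "v \<in> M" for v
    using that MD[OF that] D by (auto simp: u_def M_def map_le_def)
  have Mu': "proper_ext v u" if v: "v \<in> M" for v
  proof -
    obtain v' where "v' \<in> M" "proper_ext v v'" using up v by blast
    then show ?thesis using Mu[of v'] proper_ext_trans[of v v' u] by (auto simp: ext_iff)
  qed
  have "u \<in> frame_tree"
  proof (rule frame_tree.lim[OF uF])
    fix y assume y: "y \<in> F" "proper_ext y u"
    obtain \<gamma> where g: "dom y = {..<\<gamma>}" using dom_lessThan y(1) by blast
    have "{..<\<gamma>} \<subset> {..<\<delta>}" using y(2) g du D by (simp add: proper_ext_iff)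
    then have "\<gamma> \<in> D" using D by (simp add: lessThan_strict_subset_iff)
    then obtain v where v: "v \<in> M" "\<gamma> \<in> dom v" by (auto simp: D_def)
    have vF: "v \<in> F" using v frame_tree_mem by (auto simp: M_def)
    have "comparable y v" using linear_below[OF y(1) vF] y(2) Mu[OF v(1)] by (auto simp: ext_iff)
    moreover have "\<not> v \<subseteq>\<^sub>m y" using v(2) g map_le_implies_dom_le[of v y] by auto
    ultimately have "proper_ext y v" by (auto simp: comparable_def ext_iff)
    then show "\<exists>v. v \<in> frame_tree \<and> proper_ext y v \<and> proper_ext v u"
      using v Mu' by (auto simp: M_def)
  qed
  moreover have "u \<subseteq>\<^sub>m z" by (auto simp: u_def map_le_def)
  ultimately have "u \<in> M" by (simp add: M_def)
  then show False using Mu' ext_irrefl uF by blast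
qed

lemma uncountable_frame_tree: assumes "uncountable F" shows "uncountable frame_tree"
proof
  assume "countable frame_tree"
  then have "countable (\<Union>v\<in>frame_tree. insert v (preds F proper_ext v))"
    using countable_preds frame_tree_mem by simp
  moreover have "F \<subseteq> (\<Union>v\<in>frame_tree. insert v (preds F proper_ext v))"
    using frame_tree_cofinal by (fastforce simp: ext_iff)
  ultimately show False using assms countable_subset by blast
qed

lemma suslin_frame_tree:
  assumes "uncountable F" "\<And>C. pred_on.chain F proper_ext C \<Longrightarrow> countable C"
    "\<And>A. antichain F proper_ext A \<Longrightarrow> countable A"
  shows "suslin_tree frame_tree proper_ext"
proof (rule suslin_treeI[OF is_tree_frame_tree])
  show "countable (preds frame_tree proper_ext t)" if "t \<in> frame_tree" for t
    by (rule countable_subset[OF _ countable_preds[OF frame_tree_mem[OF that]]]) (use frame_tree_mem in \<open>auto simp: preds_def\<close>)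
  show "uncountable frame_tree" using uncountable_frame_tree assms(1) by blast
  show "countable C" if "pred_on.chain frame_tree proper_ext C" for C
    using that frame_tree_mem by (intro assms(2)) (auto simp: pred_on.chain_def)
  show "countable A" if "antichain frame_tree proper_ext A" for A
    using that frame_tree_mem by (intro assms(3)) (auto simp: antichain_def)
qed

end

section \<open>Regular Suslin trees\<close>

text \<open>
  Keep the elements with uncountably many successors. The minimal removed elements form an
  antichain, so only countably many elements are removed. What remains above a kept element is
  uncountable, hence not a chain.
\<close>
lemma suslin_tree_pruned:
  assumes "suslin_tree S lt"
  obtains S' where "suslin_tree S' lt"
    "\<And>x. x \<in> S' \<Longrightarrow> \<exists>y\<in>S'. \<exists>z\<in>S'. lt x y \<and> lt x z \<and> y \<noteq> z \<and> \<not> lt y z \<and> \<not> lt z y"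
proof -
  have tree: "is_tree S lt" and pc: "\<And>t. t \<in> S \<Longrightarrow> countable (preds S lt t)" and unc: "uncountable S"
    and chain: "\<And>C. pred_on.chain S lt C \<Longrightarrow> countable C"
    and anti: "\<And>A. antichain S lt A \<Longrightarrow> countable A"
    using assms by (auto simp: suslin_tree_iff omega1_tree_iff)
  define cone where "cone x = {y\<in>S. x = y \<or> lt x y}" for x
  define S' where "S' = {x\<in>S. uncountable (cone x)}"
  have sub: "S' \<subseteq> S" by (auto simp: S'_def)
  define M where "M = {x\<in>S - S'. \<forall>y\<in>S - S'. \<not> lt y x}"
  have "countable M" by (rule anti) (auto simp: antichain_def M_def)
  then have cM: "countable (\<Union>m\<in>M. cone m)" by (auto simp: M_def S'_def)
  have "x \<in> (\<Union>m\<in>M. cone m)" if x: "x \<in> S - S'" for x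
  proof -
    let ?A = "{y\<in>S - S'. y = x \<or> lt y x}"
    have A: "?A \<subseteq> S" "?A \<noteq> {}" using x by auto
    obtain m where m: "m \<in> ?A" "\<And>y. y \<in> ?A \<Longrightarrow> \<not> lt y m" using tree_minimal[OF tree A] by blast
    have "\<not> lt y m" if y: "y \<in> S - S'" for y
    proof
      assume "lt y m"
      then have "y \<in> ?A" using m(1) y tree_trans[OF tree, of y m x] x by auto
      then show False using m(2) \<open>lt y m\<close> by blast
    qed
    then have "m \<in> M" using m(1) by (auto simp: M_def)
    moreover have "x \<in> cone m" using m(1) x by (auto simp: cone_def)
    ultimately show ?thesis by blast
  qed
  then have "S - S' \<subseteq> (\<Union>m\<in>M. cone m)" by blast
  then have cd: "countable (S - S')" using cM countable_subset by blast
  have "uncountable S'"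
  proof
    assume "countable S'"
    with cd have "countable ((S - S') \<union> S')" by (rule countable_Un)
    moreover have "S \<subseteq> (S - S') \<union> S'" by blast
    ultimately show False using unc countable_subset by metis
  qed
  have sus: "suslin_tree S' lt"
  proof (rule suslin_treeI)
    show "is_tree S' lt" by (rule is_tree_subset[OF tree sub])
    show "countable (preds S' lt t)" if t: "t \<in> S'" for t
    proof (rule countable_subset)
      show "preds S' lt t \<subseteq> preds S lt t" using sub by (auto simp: preds_def)
      show "countable (preds S lt t)" using pc t sub by blast
    qed
    show "countable C" if "pred_on.chain S' lt C" for C
      using that sub by (intro chain) (auto simp: pred_on.chain_def)
    show "countable A" if "antichain S' lt A" for A
      using that sub by (intro anti) (auto simp: antichain_def)
  qed fact
  moreover have "\<exists>y\<in>S'. \<exists>z\<in>S'. lt x y \<and> lt x z \<and> y \<noteq> z \<and> \<not> lt y z \<and> \<not> lt z y" if x: "x \<in> S'" for x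
  proof -
    have "\<not> countable (cone x \<inter> S')"
    proof
      assume "countable (cone x \<inter> S')"
      then have "countable ((cone x \<inter> S') \<union> (S - S'))" using cd by simp
      moreover have "cone x \<subseteq> (cone x \<inter> S') \<union> (S - S')" by (auto simp: cone_def)
      ultimately have "countable (cone x)" by (rule countable_subset[rotated])
      then show False using x by (simp add: S'_def)
    qed
    then have "\<not> pred_on.chain S lt (cone x \<inter> S')" using chain by blast
    then obtain y z where "y \<in> cone x \<inter> S'" "z \<in> cone x \<inter> S'" "y \<noteq> z" "\<not> lt y z" "\<not> lt z y"
      by (auto simp: pred_on.chain_def cone_def)
    then show ?thesis unfolding cone_def by blast
  qed
  ultimately show thesis using that by blast
qed

text \<open>
  If \<open>y\<close> and \<open>z\<close> are incomparable extensions of \<open>x\<close>, their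
  own codes may still agree, because \<open>y\<close> and \<open>z\<close> need not be visible in
  them. The codes of extensions \<open>y'\<close> of \<open>y\<close> and \<open>z'\<close> of
  \<open>z\<close> are incomparable.
\<close>
theorem nary_suslin_tree:
  assumes "suslin_tree S lt" "n \<ge> 2"
  shows "\<exists>V :: (pos \<Rightarrow> nat option) set. regular_tree V proper_ext \<and> nary_tree n V proper_ext \<and> suslin_tree V proper_ext"
proof -
  obtain S' where S': "suslin_tree S' lt"
    and split: "\<And>x. x \<in> S' \<Longrightarrow> \<exists>y\<in>S'. \<exists>z\<in>S'. lt x y \<and> lt x z \<and> y \<noteq> z \<and> \<not> lt y z \<and> \<not> lt z y"
    using suslin_tree_pruned[OF assms(1)] by blast
  have "omega1_tree S' lt" using S' by (simp add: suslin_tree_iff)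
  then obtain \<rho> k where "ranked_tree S' lt \<rho> k" by (rule omega1_tree_ranked)
  then interpret ranked_tree S' lt \<rho> k .
  interpret splitting_tree seqs n
  proof
    show "n \<ge> 2" by fact
    show "seqs \<noteq> {}" using uncountable_seqs by auto
    show "ran s \<subseteq> {0, 1}" if "s \<in> seqs" for s using that ran_seq by (auto simp: seqs_def)
    fix s assume "s \<in> seqs"
    then obtain x m where x: "x \<in> S'" "s = seq x m" by (auto simp: seqs_def)
    obtain y z where yz: "y \<in> S'" "z \<in> S'" "lt x y" "lt x z" "y \<noteq> z" "\<not> lt y z" "\<not> lt z y"
      using split[OF x(1)] by blast
    obtain y' z' where yz': "y' \<in> S'" "lt y y'" "z' \<in> S'" "lt z z'"
      using split[OF yz(1)] split[OF yz(2)] by blast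
    have False if w: "w \<in> S'" "lt y w" "lt z w" for w
      using tree_linear[OF tree w(2,3) yz(1,2) w(1)] yz by blast
    then have "\<not> preds S' lt y' \<subseteq> preds S' lt z'" "\<not> preds S' lt z' \<subseteq> preds S' lt y'"
      using yz yz' mem_preds[of y S' lt y'] mem_preds[of y S' lt z'] mem_preds[of z S' lt y'] mem_preds[of z S' lt z'] by blast+
    then have "\<not> comparable (seq y' 0) (seq z' 0)"
      using seq_preds yz' unfolding comparable_def by blast
    moreover have "lt x y'" "lt x z'"
      using tree_trans[OF tree yz(3) yz'(2) x(1) yz(1) yz'(1)] tree_trans[OF tree yz(4) yz'(4) x(1) yz(2) yz'(3)]
      by auto
    then have "s \<subseteq>\<^sub>m seq y' 0" "s \<subseteq>\<^sub>m seq z' 0"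
      using seq_less x yz' by (auto simp: proper_ext_def)
    ultimately show "\<exists>a\<in>seqs. \<exists>b\<in>seqs. s \<subseteq>\<^sub>m a \<and> s \<subseteq>\<^sub>m b \<and> \<not> comparable a b"
      using seq_mem yz' by blast
  qed
  have "suslin_tree frame_tree proper_ext"
  proof (rule suslin_frame_tree[OF uncountable_seqs])
    show "countable C" if "pred_on.chain seqs proper_ext C" for C
      using chain_seqs[OF that] S' by (auto simp: suslin_tree_iff)
    show "countable A" if "antichain seqs proper_ext A" for A
      using antichain_seqs[OF that] S' by (auto simp: suslin_tree_iff)
  qed
  then show ?thesis using regular_frame_tree nary_frame_tree by blast
qed

section \<open>Reversible regular trees\<close>

theorem theorem5p3:
  shows
   "((\<forall>n\<ge>1. \<forall>(T :: 'a set) lt. regular_tree T lt \<and> nary_tree n T lt \<longrightarrow> reversible T lt) \<and>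
     (\<forall>n\<ge>1. \<forall>\<alpha> :: 'b rel. Well_order \<alpha> \<and> Field \<alpha> \<noteq> {} \<longrightarrow>
        reversible (complete_tree \<alpha> n) proper_ext)) \<and>
    (uncountable (UNIV :: 'u set) \<longrightarrow>
      (\<forall>n\<ge>2. \<exists>(T :: 'u set) lt. nary_tree n T lt \<and> aronszajn_tree T lt \<and> reversible T lt)) \<and>
    (uncountable (UNIV :: 'u set) \<longrightarrow>
      ((\<exists>(S :: 's set) lt. suslin_tree S lt) \<longrightarrow>
        (\<forall>n\<ge>2. \<exists>(T :: 'u set) lt. nary_tree n T lt \<and> suslin_tree T lt \<and> reversible T lt)) \<and>
      ((\<exists>(K :: 'k set) lt. kurepa_tree K lt) \<longrightarrow>
        (\<forall>n\<ge>2. \<exists>(T :: 'u set) lt. nary_tree n T lt \<and> kurepa_tree T lt \<and> reversible T lt)))"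
proof (intro conjI allI impI)
  show "reversible T lt" if "n \<ge> 1" "regular_tree T lt \<and> nary_tree n T lt" for n and T :: "'a set" and lt
    using that regular_nary_reversible by blast
  show "reversible (complete_tree \<alpha> n) proper_ext"
    if "n \<ge> 1" "Well_order \<alpha> \<and> Field \<alpha> \<noteq> {}" for n and \<alpha> :: "'b rel"
    using that complete_tree_reversible by blast
next
  fix n :: nat assume unc: "uncountable (UNIV :: 'u set)" and n: "n \<ge> 2"
  note C = coh_tree_aronszajn[OF n]
  then have "omega1_tree (coh_tree n) proper_ext" by (simp add: aronszajn_tree_def)
  then obtain g :: "_ \<Rightarrow> 'u" and T lt where "tree_iso (coh_tree n) proper_ext g T lt"
    using unc by (rule omega1_tree_copy)
  then interpret tree_iso "coh_tree n" proper_ext g T lt .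
  show "\<exists>(T :: 'u set) lt. nary_tree n T lt \<and> aronszajn_tree T lt \<and> reversible T lt"
    using nary2[OF C(2)] aronszajn2[OF C(3)] regular_nary_reversible[OF regular2[OF C(1)] nary2[OF C(2)]] n
    by auto
next
  fix n :: nat assume unc: "uncountable (UNIV :: 'u set)" and n: "n \<ge> 2"
    and "\<exists>(S :: 's set) lt. suslin_tree S lt"
  then obtain V :: "(pos \<Rightarrow> nat option) set"
    where V: "regular_tree V proper_ext" "nary_tree n V proper_ext" "suslin_tree V proper_ext"
    using nary_suslin_tree by blast
  then have "omega1_tree V proper_ext" by (simp add: suslin_tree_iff)
  then obtain g :: "_ \<Rightarrow> 'u" and T lt where "tree_iso V proper_ext g T lt"
    using unc by (rule omega1_tree_copy)
  then interpret tree_iso V proper_ext g T lt .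
  show "\<exists>(T :: 'u set) lt. nary_tree n T lt \<and> suslin_tree T lt \<and> reversible T lt"
    using nary2[OF V(2)] suslin2[OF V(3)] regular_nary_reversible[OF regular2[OF V(1)] nary2[OF V(2)]] n
    by auto
next
  fix n :: nat assume unc: "uncountable (UNIV :: 'u set)" and n: "n \<ge> 2"
    and "\<exists>(K :: 'k set) lt. kurepa_tree K lt"
  then obtain V :: "(pos \<Rightarrow> nat option) set"
    where V: "regular_tree V proper_ext" "nary_tree n V proper_ext" "kurepa_tree V proper_ext"
    using nary_kurepa_tree by blast
  then have "omega1_tree V proper_ext" by (simp add: kurepa_tree_def)
  then obtain g :: "_ \<Rightarrow> 'u" and T lt where "tree_iso V proper_ext g T lt"
    using unc by (rule omega1_tree_copy)
  then interpret tree_iso V proper_ext g T lt .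
  show "\<exists>(T :: 'u set) lt. nary_tree n T lt \<and> kurepa_tree T lt \<and> reversible T lt"
    using nary2[OF V(2)] kurepa2[OF V(3)] regular_nary_reversible[OF regular2[OF V(1)] nary2[OF V(2)]] n
    by auto
qed

end
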